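(* Let $p$ be a prime with $p\equiv 1\pmod 4$, let $\zeta=e^{2\pi i/p}$, and let $a$ be an integer not divisible by $p$. Let $N=\left|\left\{k\in\mathbb{Z}:\ 1\le k<\frac p4,\ \left(\frac kp\right)=-1\right\}\right|$. (i) If $p\equiv 1\pmod 8$, then $$\prod_{1\le j<k\le (p-1)/2}\left(\zeta^{aj^2}+\zeta^{ak^2}\right)=(-1)^{N}.$$ (ii) If $p\equiv 5\pmod 8$, then $$(-1)^{N}\prod_{1\le j<k\le (p-1)/2}\left(\zeta^{aj^2}+\zeta^{ak^2}\right)=\left(\frac ap\right)\varepsilon_p^{-\left(\frac ap\right)h(p)}.$$
   Context: $\left(\frac{\cdot}{p}\right)$ denotes the Legendre symbol. $\varepsilon_p$ denotes the fundamental unit (the one greater than $1$) of the real quadratic field $\mathbb{Q}(\sqrt p)$, and $h(p)$ denotes the class number of $\mathbb{Q}(\sqrt p)$. *)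

theory Defs
  imports Complex_Main "HOL-Algebra.Ideal" "HOL-Number_Theory.Number_Theory"
    "HOL-Computational_Algebra.Polynomial"
begin

text \<open>Real quadratic fields are realised as subfields of the reals. The definitions are meant for
  squarefree \<open>d > 1\<close>.\<close>

definition quadratic_field :: "nat \<Rightarrow> real set" where
  "quadratic_field d = {x + y * sqrt (real d) | x y. x \<in> \<rat> \<and> y \<in> \<rat>}"

definition integer_ring :: "nat \<Rightarrow> real ring" where
  "integer_ring d =
     \<lparr>carrier = {x \<in> quadratic_field d. algebraic_int x},
      mult = (*), one = 1, zero = 0, add = (+)\<rparr>"

text \<open>The unit group is \<open>{1, -1}\<close> times an infinite cyclic group; exactly one of the four
  possible generators of the cyclic part exceeds \<open>1\<close>.\<close>

definition fundamental_unit :: "nat \<Rightarrow> real" where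
  "fundamental_unit d =
     (THE e. e \<in> Units (integer_ring d) \<and> e > 1 \<and>
        (\<forall>u \<in> Units (integer_ring d). \<exists>n::int. u = e powi n \<or> u = - (e powi n)))"

definition nonzero_ideals :: "nat \<Rightarrow> real set set" where
  "nonzero_ideals d = {I. ideal I (integer_ring d) \<and> I \<noteq> {0}}"

text \<open>Two nonzero ideals \<open>I\<close>, \<open>J\<close> lie in the same class iff \<open>\<alpha> I = \<beta> J\<close> for some nonzero
  integers \<open>\<alpha>\<close>, \<open>\<beta>\<close> of the field, and the class number is the number of ideal classes.\<close>

definition ideal_class_rel :: "nat \<Rightarrow> (real set \<times> real set) set" where
  "ideal_class_rel d =
     {(I, J). I \<in> nonzero_ideals d \<and> J \<in> nonzero_ideals d \<and>
        (\<exists>\<alpha> \<in> carrier (integer_ring d) - {0}. \<exists>\<beta> \<in> carrier (integer_ring d) - {0}.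
           (*) \<alpha> ` I = (*) \<beta> ` J)}"

definition class_number :: "nat \<Rightarrow> nat" where
  "class_number d = card (nonzero_ideals d // ideal_class_rel d)"

end

theory Submission
  imports Defs "HOL-Analysis.Analysis" "HOL-Computational_Algebra.Polynomial_Factorial"
begin

text \<open>
  Write \<open>\<chi>\<close> for the quadratic character modulo \<open>p\<close>. Up to a root of unity, which cancels in the product, each
  factor \<open>\<zeta>\<^bsup>aj^2\<^esup> + \<zeta>\<^bsup>ak^2\<^esup>\<close> is \<open>2 cos (2 \<pi> t / p)\<close> with \<open>2 t \<equiv> a (j\<^sup>2 - k\<^sup>2)\<close>. The number of representations of a
  residue \<open>d\<close> as \<open>j\<^sup>2 - k\<^sup>2 = (j - k) (j + k)\<close> depends only on \<open>\<chi> d\<close>. Counting the negative cosines gives the sign of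
  the product, and \<open>\<bar>2 cos (2 \<pi> t / p)\<bar> = \<bar>1 - \<zeta>\<^bsup>4t\<^esup>\<bar> / \<bar>1 - \<zeta>\<^bsup>2t\<^esup>\<bar>\<close> shows that its absolute value is \<open>1\<close> if \<open>\<chi> 2 = 1\<close>
  and the exponential of \<open>\<chi> a / 2 \<cdot> (\<Sum>b. \<chi> b ln \<bar>1 - \<zeta>\<^bsup>b\<^esup>\<bar>)\<close> if \<open>\<chi> 2 = - 1\<close>. In the second case the sum is
  \<open>- \<surd>p L(1, \<chi>)\<close>, because the Gauss sum is \<open>+\<surd>p\<close> (Estermann's argument), and \<open>\<surd>p L(1, \<chi>) = 2 h ln \<epsilon>\<close> is Dirichlet's
  class number formula: each ideal class has asymptotically \<open>(2 ln \<epsilon> / \<surd>p) X\<close> ideals of norm at most \<open>X\<close>, by counting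
  lattice points in a sector between hyperbolas, whereas the number of all ideals of norm \<open>n\<close> is the sum of \<open>\<chi>\<close>
  over the divisors of \<open>n\<close>.
\<close>

text \<open>An even periodic phi with phi 0 = 0, summed over the values j^2 - k^2, is a sum over
  residues d with weight ((p - 1) / 4 - (1 + chi d) / 2) / 2. For the logarithms of the absolute
  values phi is a difference of two dilates, by 2a and by a, of ln |1 - zeta^x|. The constant part
  of the weight cancels, since both dilations permute the residues; the twisted part leaves the
  factor chi (2a) - chi a. Hence a unit appears exactly when chi 2 = -1. The same weight, applied to
  the indicator of negative cosines, gives the sign, and there the twisted part brings in N. Two
  obstacles remain. Orthogonality determines only the square of the Gauss sum, and a wrong sign
  would invert the power of the unit, so an inequality has to exclude the value - sqrt p. And
  \<open>card\<close> of an infinite quotient is 0, so the finiteness of the class group has to come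
  out of the count: all classes have the same positive density, and the total density is
  finite.\<close>

section \<open>The quadratic character\<close>

text \<open>The short name \<open>cong_def\<close> is shadowed by a fact about quotients.\<close>
lemmas icong_def = unique_euclidean_semiring_class.cong_def

lemma abs_cong_eq:
  fixes x y :: int and p :: nat
  assumes "[x = y] (mod int p)" "\<bar>x - y\<bar> < int p"
  shows "x = y"
  by (metis assms cong_iff_dvd_diff dvd_imp_le_int not_less eq_iff_diff_eq_0 abs_of_nat)

locale prime_one_mod_four =
  fixes p :: nat
  assumes prime_p: "prime p" and p_mod_4: "p mod 4 = 1"
begin

definition chi :: "int \<Rightarrow> int" where "chi n = Legendre n (int p)"

lemma p_ge_5: "p \<ge> 5"
proof -
  have "p \<ge> 2" using prime_p prime_ge_2_nat by blast
  moreover have "p \<noteq> 2" "p \<noteq> 3" "p \<noteq> 4" using p_mod_4 by auto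
  ultimately show ?thesis by linarith
qed

lemma odd_p: "odd p" using p_mod_4 by presburger

lemma p_eq: "p = 4 * (p div 4) + 1" using p_mod_4 by presburger

lemma half_p: "(p - 1) div 2 = 2 * (p div 4)" using p_mod_4 by presburger

lemma prime_int_p: "prime (int p)" using prime_p by simp

lemma chi_cong: "[a = b] (mod int p) \<Longrightarrow> chi a = chi b"
proof -
  assume ab: "[a = b] (mod int p)"
  have "[a = 0] (mod int p) \<longleftrightarrow> [b = 0] (mod int p)"
    using ab cong_sym cong_trans by blast
  moreover have "QuadRes (int p) a \<longleftrightarrow> QuadRes (int p) b"
    unfolding QuadRes_def using ab cong_sym cong_trans by blast
  ultimately show ?thesis unfolding chi_def Legendre_def by simp
qed

lemma chi_mod [simp]: "chi (a mod int p) = chi a"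
  by (rule chi_cong) simp

lemma chi_eq_0_iff: "chi a = 0 \<longleftrightarrow> int p dvd a"
  unfolding chi_def Legendre_def by (simp add: cong_0_iff)

lemma chi_cases: "chi a = 0 \<or> chi a = 1 \<or> chi a = -1"
  unfolding chi_def Legendre_def by auto

lemma abs_chi_le: "\<bar>chi a\<bar> \<le> 1" using chi_cases[of a] by auto

lemma chi_euler: "[chi a = a ^ ((p - 1) div 2)] (mod int p)"
  unfolding chi_def using euler_criterion[OF prime_p] p_ge_5 by simp

lemma chi_mult: "chi (a * b) = chi a * chi b"
proof (rule abs_cong_eq)
  have "[chi (a * b) = a ^ ((p - 1) div 2) * b ^ ((p - 1) div 2)] (mod int p)"
    using chi_euler[of "a * b"] by (simp add: power_mult_distrib)
  moreover have "[chi a * chi b = a ^ ((p - 1) div 2) * b ^ ((p - 1) div 2)] (mod int p)"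
    by (intro cong_mult chi_euler)
  ultimately show "[chi (a * b) = chi a * chi b] (mod int p)" by (metis cong_sym cong_trans)
  show "\<bar>chi (a * b) - chi a * chi b\<bar> < int p"
    using chi_cases[of "a * b"] chi_cases[of a] chi_cases[of b] p_ge_5 by auto
qed

lemma chi_one [simp]: "chi 1 = 1"
  using chi_mult[of 1 1] chi_eq_0_iff[of 1] p_ge_5 by auto

lemma chi_power: "chi (a ^ k) = chi a ^ k"
  by (induction k) (auto simp: chi_mult)

lemma chi_minus_one [simp]: "chi (-1) = 1"
proof (rule abs_cong_eq)
  show "[chi (- 1) = 1] (mod int p)" using chi_euler[of "-1"] half_p by simp
  show "\<bar>chi (- 1) - 1\<bar> < int p" using chi_cases[of "-1"] p_ge_5 by auto
qed

lemma chi_minus [simp]: "chi (- a) = chi a"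
  using chi_mult[of "-1" a] by simp

lemma chi_eq_1_iff: "chi a = 1 \<longleftrightarrow> \<not> int p dvd a \<and> (\<exists>y. [y\<^sup>2 = a] (mod int p))"
  unfolding chi_def Legendre_def QuadRes_def by (auto simp: cong_0_iff)

text \<open>Gauss's lemma: with m = p div 4 the doubles of 1, ..., 2m lie below p, hence are already
  reduced, and exactly the m of them coming from x > m exceed (p - 1) / 2 = 2m.\<close>

lemma chi_two: "chi 2 = (-1) ^ (p div 4)"
proof -
  interpret G: GAUSS p 2
    using prime_p p_ge_5 by unfold_locales (auto simp: cong_0_iff dest: zdvd_imp_le)
  have C: "G.C = (\<lambda>x. 2 * x) ` {0<..2 * int (p div 4)}"
    unfolding G.C_def G.B_def G.A_def image_image
    using p_eq by (intro image_cong) (auto simp: half_p)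
  have "G.E = (\<lambda>x. 2 * x) ` {int (p div 4)<..2 * int (p div 4)}"
  proof -
    have "(int p - 1) div 2 = 2 * int (p div 4)" using p_eq by presburger
    thus ?thesis unfolding G.E_def C by (auto simp del: zdiv_int of_nat_div)
  qed
  also have "card \<dots> = card {int (p div 4)<..2 * int (p div 4)}"
    by (intro card_image inj_onI) auto
  also have "\<dots> = p div 4" by simp
  finally show ?thesis unfolding chi_def using G.gauss_lemma by simp
qed

lemma chi_reciprocity:
  assumes "prime q" "q \<noteq> 2" "q \<noteq> p"
  shows "Legendre (int p) (int q) = chi (int q)"
proof -
  have "odd q" using assms by (metis prime_odd_nat prime_ge_2_nat le_neq_implies_less)
  have "q > 2" using assms prime_ge_2_nat[of q] by linarith
  have "Legendre (int p) (int q) * Legendre (int q) (int p) = (- 1) ^ ((p - 1) div 2 * ((q - 1) div 2))"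
    using Quadratic_Reciprocity[OF prime_p _ assms(1) \<open>q > 2\<close>] p_ge_5 assms by simp
  also have "\<dots> = 1" unfolding half_p by simp
  finally show ?thesis using chi_cases[of q] unfolding chi_def by auto
qed

lemma bij_betw_mult_mod:
  fixes a :: int
  assumes "\<not> int p dvd a"
  shows "bij_betw (\<lambda>x. (a * x) mod int p) {0..<int p} {0..<int p}"
proof -
  have "inj_on (\<lambda>x. (a * x) mod int p) {0..<int p}"
  proof (rule inj_onI)
    fix x y assume xy: "x \<in> {0..<int p}" "y \<in> {0..<int p}" "a * x mod int p = a * y mod int p"
    hence "[a * x = a * y] (mod int p)" unfolding icong_def by blast
    hence "[x = y] (mod int p)" using assms prime_int_p
      by (metis cong_mult_lcancel coprime_commute prime_imp_coprime)
    thus "x = y" using xy by (simp add: icong_def)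
  qed
  moreover have "(\<lambda>x. (a * x) mod int p) ` {0..<int p} \<subseteq> {0..<int p}"
    using p_ge_5 by auto
  ultimately show ?thesis unfolding bij_betw_def by (simp add: endo_inj_surj)
qed

lemma card_sqrt_mod: "int (card {x \<in> {0..<int p}. [x\<^sup>2 = a] (mod int p)}) = 1 + chi a"
proof -
  consider "chi a = 0" | "chi a = 1" | "chi a = -1" using chi_cases by blast
  thus ?thesis
  proof cases
    case 1
    hence a: "int p dvd a" using chi_eq_0_iff by blast
    have "{x \<in> {0..<int p}. [x\<^sup>2 = a] (mod int p)} = {0}"
    proof (intro equalityI subsetI)
      fix x assume "x \<in> {x \<in> {0..<int p}. [x\<^sup>2 = a] (mod int p)}"
      hence x: "0 \<le> x" "x < int p" "[x\<^sup>2 = a] (mod int p)" by auto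
      hence "int p dvd x\<^sup>2" using a by (simp add: cong_dvd_iff)
      hence "int p dvd x" using prime_int_p prime_dvd_power by blast
      thus "x \<in> {0}" using x zdvd_not_zless[of x "int p"] by force
    next
      fix x assume "x \<in> {0 :: int}"
      moreover have "[0 = a] (mod int p)" using a cong_0_iff cong_sym by blast
      ultimately show "x \<in> {x \<in> {0..<int p}. [x\<^sup>2 = a] (mod int p)}"
        using p_ge_5 by simp
    qed
    thus ?thesis using 1 by simp
  next
    case 2
    then obtain y where na: "\<not> int p dvd a" and y: "[y\<^sup>2 = a] (mod int p)"
      using chi_eq_1_iff by blast
    define z where "z = y mod int p"
    have z2: "[z\<^sup>2 = a] (mod int p)" using y unfolding z_def by (simp add: icong_def power_mod)
    have z: "0 \<le> z" "z < int p" using p_ge_5 unfolding z_def by auto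
    have "z \<noteq> 0" using z2 na by (auto simp: icong_def mod_eq_0_iff_dvd cong_0_iff dest!: cong_sym)
    have "{x \<in> {0..<int p}. [x\<^sup>2 = a] (mod int p)} = {z, int p - z}"
    proof (intro equalityI subsetI)
      fix x assume "x \<in> {x \<in> {0..<int p}. [x\<^sup>2 = a] (mod int p)}"
      hence x: "0 \<le> x" "x < int p" "[x\<^sup>2 = a] (mod int p)" by auto
      hence "[x\<^sup>2 = z\<^sup>2] (mod int p)" using z2 cong_trans cong_sym by blast
      hence "int p dvd (x - z) * (x + z)"
        by (simp add: cong_iff_dvd_diff power2_eq_square algebra_simps)
      hence "int p dvd x - z \<or> int p dvd x + z" using prime_int_p prime_dvd_mult_iff by blast
      thus "x \<in> {z, int p - z}"
      proof
        assume "int p dvd x - z"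
        hence "x = z" using x z by (intro abs_cong_eq[of _ _ p]) (auto simp: cong_iff_dvd_diff)
        thus ?thesis by simp
      next
        assume "int p dvd x + z"
        then obtain k where k: "x + z = int p * k" by (elim dvdE)
        have "0 < int p * k" "int p * k < int p * 2" unfolding k[symmetric] using x z \<open>z \<noteq> 0\<close> by linarith+
        hence "0 < k" by (simp add: zero_less_mult_iff)
        moreover have "k < 2"
          using \<open>int p * k < int p * 2\<close> mult_left_mono[of 2 k "int p"] by linarith
        ultimately have "0 < k" "k < 2" by auto
        hence "k = 1" by auto
        thus ?thesis using k by auto
      qed
    next
      fix x assume "x \<in> {z, int p - z}"
      moreover have "[(int p - z)\<^sup>2 = z\<^sup>2] (mod int p)"
        by (simp add: cong_iff_dvd_diff power2_eq_square algebra_simps)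
      ultimately show "x \<in> {x \<in> {0..<int p}. [x\<^sup>2 = a] (mod int p)}"
        using z z2 \<open>z \<noteq> 0\<close> by (auto intro: cong_trans)
    qed
    moreover have "z \<noteq> int p - z" using odd_p by presburger
    ultimately show ?thesis using 2 by simp
  next
    case 3
    hence "\<not> int p dvd a" using chi_eq_0_iff[of a] by auto
    hence "{x \<in> {0..<int p}. [x\<^sup>2 = a] (mod int p)} = {}"
      using 3 chi_eq_1_iff[of a] by auto
    thus ?thesis using 3 by (simp only: card.empty)
  qed
qed

text \<open>Every x is a square root of exactly one residue, so the root counts 1 + chi a add up to
  p and chi sums to 0; the value chi 1 = 1 must be compensated by a negative one.\<close>

lemma ex_chi_minus_1: "\<exists>a. chi a = -1"
proof (rule ccontr)
  assume "\<nexists>a. chi a = -1"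
  hence *: "chi a \<ge> 0" for a using chi_cases[of a] by auto
  let ?S = "\<lambda>a. {x \<in> {0..<int p}. [x\<^sup>2 = a] (mod int p)}"
  have "(\<Sum>a\<in>{0..<int p}. int (card (?S a))) = int (card {0..<int p})"
  proof -
    have "\<exists>a\<in>{0..<int p}. [x\<^sup>2 = a] (mod int p)" for x
      using p_ge_5 by (intro bexI[of _ "x\<^sup>2 mod int p"]) (auto simp: icong_def)
    hence "(\<Union>a\<in>{0..<int p}. ?S a) = {0..<int p}" by auto
    moreover have "card (\<Union>a\<in>{0..<int p}. ?S a) = (\<Sum>a\<in>{0..<int p}. card (?S a))"
      by (intro card_UN_disjoint) (auto simp: icong_def intro: finite_subset[of _ "{0..<int p}"])
    ultimately have "card {0..<int p} = (\<Sum>a\<in>{0..<int p}. card (?S a))" by argo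
    thus ?thesis by (simp only: of_nat_sum)
  qed
  moreover have "(\<Sum>a\<in>{0..<int p}. int (card (?S a))) = (\<Sum>a\<in>{0..<int p}. 1 + chi a)"
    by (intro sum.cong refl card_sqrt_mod)
  ultimately have "(\<Sum>a\<in>{0..<int p}. chi a) = 0" by (simp add: sum.distrib)
  moreover have "chi 1 \<le> (\<Sum>a\<in>{0..<int p}. chi a)"
    using * p_ge_5 by (intro member_le_sum) auto
  ultimately show False by simp
qed

lemma sum_chi: "(\<Sum>a\<in>{0..<int p}. chi a) = 0"
proof -
  obtain b where b: "chi b = -1" using ex_chi_minus_1 by blast
  hence "\<not> int p dvd b" using chi_eq_0_iff[of b] by auto
  from sum.reindex_bij_betw[OF bij_betw_mult_mod[OF this], of chi]
  have "(\<Sum>a\<in>{0..<int p}. chi a) = - (\<Sum>a\<in>{0..<int p}. chi a)"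
    by (simp add: chi_mult b sum_negf)
  thus ?thesis by simp
qed

section \<open>Functions periodic modulo p\<close>

definition periodic :: "(int \<Rightarrow> 'a) \<Rightarrow> bool" where
  "periodic \<phi> \<longleftrightarrow> (\<forall>x y. [x = y] (mod int p) \<longrightarrow> \<phi> x = \<phi> y)"

lemma periodicD: "periodic \<phi> \<Longrightarrow> [x = y] (mod int p) \<Longrightarrow> \<phi> x = \<phi> y"
  unfolding periodic_def by blast

lemma periodic_mod: "periodic \<phi> \<Longrightarrow> \<phi> (x mod int p) = \<phi> x"
  by (erule periodicD) simp

lemma sum_periodic_squares:
  fixes \<phi> :: "int \<Rightarrow> 'a :: ring_1"
  assumes "periodic \<phi>"
  shows "(\<Sum>k\<in>{0..<int p}. \<phi> (k\<^sup>2)) = (\<Sum>a\<in>{0..<int p}. of_int (1 + chi a) * \<phi> a)"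
proof -
  let ?S = "\<lambda>a. {k \<in> {0..<int p}. k\<^sup>2 mod int p = a}"
  have "(\<Sum>k\<in>{0..<int p}. \<phi> (k\<^sup>2)) = (\<Sum>a\<in>{0..<int p}. \<Sum>k\<in>?S a. \<phi> (k\<^sup>2))"
    using p_ge_5 by (intro sum.group[symmetric]) auto
  also have "\<dots> = (\<Sum>a\<in>{0..<int p}. of_int (1 + chi a) * \<phi> a)"
  proof (intro sum.cong refl)
    fix a assume a: "a \<in> {0..<int p}"
    have "(\<Sum>k\<in>?S a. \<phi> (k\<^sup>2)) = (\<Sum>k\<in>?S a. \<phi> a)"
      by (intro sum.cong refl) (auto simp: periodic_mod[OF assms])
    also have "\<dots> = of_int (int (card (?S a))) * \<phi> a" by simp
    also have "int (card (?S a)) = int (card {x \<in> {0..<int p}. [x\<^sup>2 = a] (mod int p)})"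
      using a by (intro arg_cong[of _ _ "\<lambda>A. int (card A)"]) (auto simp: icong_def)
    also have "\<dots> = 1 + chi a" by (rule card_sqrt_mod)
    finally show "(\<Sum>k\<in>?S a. \<phi> (k\<^sup>2)) = of_int (1 + chi a) * \<phi> a" .
  qed
  finally show ?thesis .
qed

end

section \<open>The ring of integers\<close>

text \<open>The number p y is rational and, up to sign, the square root of the integer p k; hence it
  is an integer j, and j^2 = p k forces p to divide j. This bounds the denominator of the sqrt p
  coordinate of an algebraic integer.\<close>

lemma real_int_square_times_prime:
  fixes y :: real
  assumes "prime p" "y \<in> \<rat>" "real p * y\<^sup>2 = of_int k"
  shows "y \<in> \<int>"
proof -
  have "(real p * y)\<^sup>2 = of_int (int p * k)"
    using assms(3) by (simp add: power2_eq_square algebra_simps)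
  hence "\<bar>real p * y\<bar> = sqrt (of_int (int p * k))" by (metis real_sqrt_abs)
  hence "algebraic_int \<bar>real p * y\<bar>" by (simp only:) (intro algebraic_int_sqrt int_imp_algebraic_int Ints_of_int)
  hence "algebraic_int (real p * y)" by simp
  moreover have "real p * y \<in> \<rat>" using assms(2) by simp
  ultimately obtain j where j: "real p * y = of_int j"
    using rational_algebraic_int_is_int Ints_cases by metis
  have "real_of_int (j\<^sup>2) = of_int (int p * k)"
    using \<open>(real p * y)\<^sup>2 = _\<close> j by simp
  hence "j\<^sup>2 = int p * k" by (simp only: of_int_eq_iff)
  hence "int p dvd j\<^sup>2" by simp
  hence "int p dvd j" using assms(1) by (metis prime_dvd_power prime_nat_int_transfer)
  then obtain i where "j = int p * i" by (elim dvdE)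
  hence "real p * y = real p * of_int i" using j by simp
  hence "y = of_int i" using assms(1) by (simp add: prime_gt_0_nat)
  thus ?thesis by simp
qed

text \<open>Gauss' lemma for a quadratic factor: pseudo-division by the primitive quadratic polynomial
  of \<open>z\<close> and comparison of contents show that its leading coefficient is a unit.\<close>
lemma algebraic_int_quadratic:
  fixes z :: real
  assumes "algebraic_int z" "z \<notin> \<rat>" "z\<^sup>2 = t * z + n" "t \<in> \<rat>" "n \<in> \<rat>"
  obtains B C :: int where "z\<^sup>2 = of_int B * z + of_int C"
proof -
  obtain f :: "int poly" where f: "poly (map_poly of_int f) z = 0" "lead_coeff f = 1"
    using assms(1) algebraic_int_altdef_ipoly by blast
  obtain t1 t2 where t: "t = of_int t1 / of_int t2" "t2 > (0::int)"
    using assms(4) by (elim Rats_cases') auto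
  obtain n1 n2 where n: "n = of_int n1 / of_int n2" "n2 > (0::int)"
    using assms(5) by (elim Rats_cases') auto
  define q0 where "q0 = [:- (n1 * t2), - (t1 * n2), t2 * n2:]"
  define q where "q = primitive_part q0"
  have q0: "q0 \<noteq> 0" "degree q0 = 2" using t n unfolding q0_def by auto
  have q0q: "q0 = smult (Polynomial.content q0) q" unfolding q_def by simp
  have "poly (map_poly of_int q0) z = of_int t2 * of_int n2 * (z\<^sup>2 - t * z - n)"
    unfolding q0_def t(1) n(1) using t(2) n(2)
    by (simp add: map_poly_pCons field_simps power2_eq_square)
  hence "poly (map_poly of_int q0) z = 0" using assms(3) by simp
  hence qz: "poly (map_poly of_int q) z = 0"
    by (subst (asm) q0q) (use q0(1) in \<open>auto simp: map_poly_smult\<close>)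
  have cq: "Polynomial.content q = 1" unfolding q_def using q0 by simp
  have dq: "degree q = 2" unfolding q_def using q0 by simp
  have qn0: "q \<noteq> 0" using dq by auto
  obtain G R where GR: "pseudo_divmod f q = (G, R)" by fastforce
  define A where "A = lead_coeff q"
  obtain k where k: "smult (A ^ k) f = q * G + R" and R: "R = 0 \<or> degree R < 2"
    using pseudo_divmod[OF qn0 GR] dq unfolding A_def by metis
  have mp_add: "map_poly real_of_int (u + v) = map_poly of_int u + map_poly of_int v" for u v
    by (intro poly_eqI) (simp add: coeff_map_poly)
  have mp_mult: "map_poly real_of_int (u * v) = map_poly of_int u * map_poly of_int v" for u v
    by (intro poly_eqI) (simp add: coeff_map_poly coeff_mult)
  have "poly (map_poly of_int (q * G + R)) z = 0"
    unfolding k[symmetric] using f(1) by (simp add: map_poly_smult)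
  hence Rz: "poly (map_poly of_int R) z = 0" using qz by (simp add: mp_add mp_mult)
  \<comment> \<open>A nonzero remainder would have degree at most 1 and exhibit z as
    rational.\<close>
  have "R = 0"
  proof (rule ccontr)
    assume "R \<noteq> 0"
    hence "degree R < 2" using R by simp
    hence Req: "R = [:coeff R 0, coeff R 1:]"
      by (intro poly_eqI) (auto simp: coeff_pCons coeff_eq_0 split: nat.splits)
    have *: "of_int (coeff R 0) + z * of_int (coeff R 1) = 0"
      using Rz by (subst (asm) Req) (simp add: map_poly_pCons)
    have "coeff R 1 = 0"
    proof (rule ccontr)
      assume "coeff R 1 \<noteq> 0"
      hence "z = of_int (- coeff R 0) / of_int (coeff R 1)" using * by (simp add: field_simps)
      also have "\<dots> \<in> \<rat>" by (intro Rats_divide Rats_of_int)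
      finally show False using assms(2) by blast
    qed
    with * have "coeff R 0 = 0" by simp
    with \<open>coeff R 1 = 0\<close> Req \<open>R \<noteq> 0\<close> show False by simp
  qed
  with k have fG: "smult (A ^ k) f = q * G" by simp
  have An0: "A \<noteq> 0" unfolding A_def using qn0 by simp
  have "Polynomial.content f dvd lead_coeff f" by (rule content_dvd_coeff)
  hence cf: "Polynomial.content f = 1" using f(2) is_unit_normalize normalize_content by metis
  have "Polynomial.content (q * G) = Polynomial.content q * Polynomial.content G" by (rule content_mult)
  hence "Polynomial.content G = normalize (A ^ k)" using cq cf unfolding fG[symmetric] by simp
  moreover have "G = smult (Polynomial.content G) (primitive_part G)" by simp
  ultimately have G: "G = smult (normalize (A ^ k)) (primitive_part G)" by simp
  obtain s where s: "normalize (A ^ k) = s * A ^ k" "s = 1 \<or> s = -1"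
    by (metis abs_minus_cancel abs_of_nonneg abs_of_nonpos linorder_le_cases mult_1 mult_minus_left normalize_int_def)
  \<comment> \<open>Both sides contain \<open>A ^ k\<close>, up to the sign s. Once it is cancelled,
    the leading coefficient 1 of f is a multiple of A.\<close>
  have "lead_coeff (smult (A ^ k) f) = A * (s * A ^ k) * lead_coeff (primitive_part G)"
  proof -
    have "q * G = smult (s * A ^ k) (q * primitive_part G)"
      using G s(1) by (metis mult_smult_right)
    thus ?thesis unfolding fG by (simp only: lead_coeff_smult lead_coeff_mult A_def mult_ac)
  qed
  hence "A ^ k = A ^ k * (A * s * lead_coeff (primitive_part G))"
    unfolding lead_coeff_smult f(2) by (simp only: mult_ac mult_1_right)
  hence "A * (s * lead_coeff (primitive_part G)) = 1" using An0 by simp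
  hence A1: "A = 1 \<or> A = -1" using zmult_eq_1_iff by blast
  have qeq: "q = [:coeff q 0, coeff q 1, A:]"
    by (intro poly_eqI) (auto simp: coeff_pCons A_def dq coeff_eq_0 numeral_2_eq_2 split: nat.splits)
  have eq: "of_int (coeff q 0) + z * (of_int (coeff q 1) + z * of_int A) = 0"
    using qz by (subst (asm) qeq) (simp add: map_poly_pCons)
  have "z\<^sup>2 = of_int (- A * coeff q 1) * z + of_int (- A * coeff q 0)"
    using eq A1 by (auto simp: power2_eq_square algebra_simps)
  thus ?thesis using that by blast
qed

section \<open>Conjugation, norm and integral basis of the field\<close>

context prime_one_mod_four
begin

definition rt :: real where "rt = sqrt (real p)"
text \<open>Together with 1 an integral basis, because p = 1 modulo 4; a root of X^2 - X - m4, where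
  m4 = (p - 1) / 4.\<close>

definition om :: real where "om = (1 + rt) / 2"
definition m4 :: int where "m4 = int (p div 4)"

lemma rt_sq: "rt * rt = real p" unfolding rt_def by simp
lemma rt_pos: "rt > 0" unfolding rt_def using p_ge_5 by simp
lemma rt_gt_2: "rt > 2" unfolding rt_def using p_ge_5 by (intro real_less_rsqrt) auto
lemma p_m4: "real p = 4 * of_int m4 + 1" "int p = 4 * m4 + 1"
proof -
  show "int p = 4 * m4 + 1" unfolding m4_def using p_eq by presburger
  thus "real p = 4 * of_int m4 + 1" by (metis of_int_add of_int_mult of_int_numeral of_int_of_nat_eq of_int_1)
qed

lemma om_sq: "om * om = om + of_int m4"
  using rt_sq p_m4(1) unfolding om_def by (simp add: field_simps)

lemma rt_irrational: "rt \<notin> \<rat>"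
proof
  assume "rt \<in> \<rat>"
  moreover have "algebraic_int rt" unfolding rt_def by (intro algebraic_int_sqrt int_imp_algebraic_int) auto
  ultimately obtain k where k: "rt = of_int k" using rational_algebraic_int_is_int Ints_cases by metis
  have "real_of_int (k * k) = of_int (int p)" using rt_sq k by simp
  hence "k * k = int p" by (simp only: of_int_eq_iff)
  hence "int p dvd k * k" by simp
  hence "int p dvd k" using prime_int_p prime_dvd_mult_iff by blast
  then obtain j where "k = int p * j" by (elim dvdE)
  hence "int p * (int p * j * j) = int p * 1" using \<open>k * k = int p\<close> by (simp add: mult_ac)
  hence "int p * (j * j) = 1" using p_ge_5 by (simp add: mult_ac)
  hence "int p dvd 1" by (metis dvd_triv_left)
  thus False using p_ge_5 by simp
qed

lemma quadratic_eq_iff: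
  assumes "x \<in> \<rat>" "y \<in> \<rat>" "x' \<in> \<rat>" "y' \<in> \<rat>"
  shows "x + y * rt = x' + y' * rt \<longleftrightarrow> x = x' \<and> y = y'"
proof
  assume eq: "x + y * rt = x' + y' * rt"
  have "y = y'"
  proof (rule ccontr)
    assume "y \<noteq> y'"
    hence "rt = (x' - x) / (y - y')" using eq by (simp add: field_simps)
    also have "\<dots> \<in> \<rat>" using assms by simp
    finally show False using rt_irrational by blast
  qed
  thus "x = x' \<and> y = y'" using eq by simp
qed auto

definition K :: "real set" where "K = quadratic_field p"
definition OK :: "real set" where "OK = carrier (integer_ring p)"

lemma K_def': "K = {x + y * rt | x y. x \<in> \<rat> \<and> y \<in> \<rat>}"
  unfolding K_def quadratic_field_def rt_def ..

lemma KE: assumes "z \<in> K" obtains x y where "x \<in> \<rat>" "y \<in> \<rat>" "z = x + y * rt"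
  using assms unfolding K_def' by blast

lemma KI: "x \<in> \<rat> \<Longrightarrow> y \<in> \<rat> \<Longrightarrow> x + y * rt \<in> K" unfolding K_def' by blast

lemma K_Rats: "x \<in> \<rat> \<Longrightarrow> x \<in> K" using KI[of x 0] by simp

text \<open>Galois conjugation; unspecified outside \<open>K\<close>.\<close>
definition con :: "real \<Rightarrow> real" where
  "con z = (THE w. \<exists>x y. x \<in> \<rat> \<and> y \<in> \<rat> \<and> z = x + y * rt \<and> w = x - y * rt)"

lemma con_eq: assumes "x \<in> \<rat>" "y \<in> \<rat>" shows "con (x + y * rt) = x - y * rt"
  unfolding con_def
proof (rule the_equality)
  show "\<exists>x' y'. x' \<in> \<rat> \<and> y' \<in> \<rat> \<and> x + y * rt = x' + y' * rt \<and> x - y * rt = x' - y' * rt"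
    using assms by blast
  fix w assume "\<exists>x' y'. x' \<in> \<rat> \<and> y' \<in> \<rat> \<and> x + y * rt = x' + y' * rt \<and> w = x' - y' * rt"
  thus "w = x - y * rt" using quadratic_eq_iff[OF assms] by blast
qed

lemma con_rat [simp]: "x \<in> \<rat> \<Longrightarrow> con x = x" using con_eq[of x 0] by simp

lemma K_con [simp]: assumes "z \<in> K" shows "con z \<in> K"
proof -
  obtain x y where "x \<in> \<rat>" "y \<in> \<rat>" "z = x + y * rt" using assms by (rule KE)
  thus ?thesis using KI[of x "-y"] by (simp add: con_eq)
qed

lemma con_con [simp]: assumes "z \<in> K" shows "con (con z) = z"
proof -
  obtain x y where "x \<in> \<rat>" "y \<in> \<rat>" "z = x + y * rt" using assms by (rule KE)
  thus ?thesis using con_eq[of x "-y"] by (simp add: con_eq)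
qed

lemma K_add:
  assumes "z \<in> K" "w \<in> K" shows "z + w \<in> K" "con (z + w) = con z + con w"
proof -
  obtain x y where z: "x \<in> \<rat>" "y \<in> \<rat>" "z = x + y * rt" using assms(1) by (rule KE)
  obtain x' y' where w: "x' \<in> \<rat>" "y' \<in> \<rat>" "w = x' + y' * rt" using assms(2) by (rule KE)
  have eq: "z + w = (x + x') + (y + y') * rt" using z w by (simp add: algebra_simps)
  show "z + w \<in> K" unfolding eq using z w by (intro KI) auto
  show "con (z + w) = con z + con w" unfolding eq using z w
    by (subst con_eq) (auto simp: con_eq algebra_simps)
qed

lemma K_mult:
  assumes "z \<in> K" "w \<in> K" shows "z * w \<in> K" "con (z * w) = con z * con w"
proof -
  obtain x y where z: "x \<in> \<rat>" "y \<in> \<rat>" "z = x + y * rt" using assms(1) by (rule KE)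
  obtain x' y' where w: "x' \<in> \<rat>" "y' \<in> \<rat>" "w = x' + y' * rt" using assms(2) by (rule KE)
  have sq: "rt * (rt * a) = real p * a" for a using rt_sq by (simp add: mult.assoc[symmetric])
  have eq: "z * w = (x * x' + real p * y * y') + (x * y' + y * x') * rt"
    using z w by (simp add: algebra_simps sq rt_sq)
  show "z * w \<in> K" unfolding eq using z w by (intro KI) auto
  show "con (z * w) = con z * con w" unfolding eq using z w
    by (subst con_eq) (auto simp: con_eq algebra_simps sq rt_sq)
qed

lemma K_minus:
  assumes "z \<in> K" shows "- z \<in> K" "con (- z) = - con z"
  using K_mult[of "-1" z] K_Rats[of "-1"] assms by auto

lemma con_eq_0_iff [simp]: assumes "z \<in> K" shows "con z = 0 \<longleftrightarrow> z = 0"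
  using con_con[OF assms] con_rat[of 0] by force

lemma norm_rat: assumes "z \<in> K" shows "z * con z \<in> \<rat>" "z + con z \<in> \<rat>"
proof -
  obtain x y where z: "x \<in> \<rat>" "y \<in> \<rat>" "z = x + y * rt" using assms by (rule KE)
  have "z * con z = x * x - real p * y * y" using z by (simp add: con_eq algebra_simps rt_sq)
  thus "z * con z \<in> \<rat>" using z by simp
  show "z + con z \<in> \<rat>" using z by (simp add: con_eq)
qed

lemma K_inverse: assumes "z \<in> K" shows "inverse z \<in> K" "con (inverse z) = inverse (con z)"
proof -
  show "inverse z \<in> K"
  proof (cases "z = 0")
    case False
    hence "inverse z = inverse (z * con z) * con z" using assms by (simp add: field_simps)
    moreover have "inverse (z * con z) \<in> K" using norm_rat(1)[OF assms] by (intro K_Rats Rats_inverse)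
    ultimately show ?thesis using K_mult(1) K_con assms by metis
  qed (simp add: K_Rats)
  show "con (inverse z) = inverse (con z)"
  proof (cases "z = 0")
    case False
    have "con (z * inverse z) = con z * con (inverse z)"
      using K_mult(2) assms \<open>inverse z \<in> K\<close> by blast
    thus ?thesis using False assms by (simp add: field_simps)
  qed simp
qed

lemma K_divide:
  assumes "z \<in> K" "w \<in> K" shows "z / w \<in> K" "con (z / w) = con z / con w"
  using K_mult[of z "inverse w"] K_inverse[of w] assms by (auto simp: divide_inverse)

lemma om_K [simp]: "om \<in> K" using KI[of "1/2" "1/2"] unfolding om_def by (simp add: field_simps)

lemma con_om: "con om = 1 - om"
  using con_eq[of "1/2" "1/2"] unfolding om_def by (simp add: field_simps)

lemma K_of_int [simp]: "of_int k \<in> K" by (simp add: K_Rats)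
definition el :: "int \<Rightarrow> int \<Rightarrow> real" where "el x y = of_int x + of_int y * om"

lemma el_K [simp]: "el x y \<in> K" unfolding el_def by (intro K_add K_mult) auto

lemma con_el: "con (el x y) = of_int x + of_int y * (1 - om)"
proof -
  have "con (el x y) = con (of_int x) + con (of_int y * om)"
    unfolding el_def by (intro K_add(2) K_mult(1)) simp_all
  also have "con (of_int y * om) = con (of_int y) * con om" by (intro K_mult(2)) simp_all
  finally show ?thesis by (simp add: con_om)
qed

lemma con_el': "con (el x y) = el (x + y) (- y)"
  by (subst con_el) (simp add: el_def algebra_simps)

lemma el_add: "el x y + el x' y' = el (x + x') (y + y')" by (simp add: el_def algebra_simps)
lemma el_minus: "- el x y = el (- x) (- y)" by (simp add: el_def algebra_simps)
lemma el_mult: "el x y * el x' y' = el (x * x' + y * y' * m4) (x * y' + y * x' + y * y')"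
proof -
  have "el x y * el x' y' =
      of_int x * of_int x' + (of_int x * of_int y' + of_int y * of_int x') * om
        + of_int y * of_int y' * (om * om)"
    by (simp add: el_def algebra_simps)
  thus ?thesis unfolding om_sq by (simp add: el_def algebra_simps)
qed

lemma el_eq_iff: "el x y = el x' y' \<longleftrightarrow> x = x' \<and> y = y'"
proof -
  have "el x y = (of_int x + of_int y / 2) + (of_int y / 2) * rt" for x y
    unfolding el_def om_def by (simp add: field_simps)
  thus ?thesis using quadratic_eq_iff[of "of_int x + of_int y / 2" "of_int y / 2"
       "of_int x' + of_int y' / 2" "of_int y' / 2"] by auto
qed

definition nrm :: "real \<Rightarrow> real" where "nrm z = z * con z"

lemma nrm_el: "nrm (el x y) = of_int (x\<^sup>2 + x * y - m4 * y\<^sup>2)"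
  unfolding nrm_def con_el' el_mult by (simp add: el_def power2_eq_square algebra_simps)

lemma nrm_mult: "z \<in> K \<Longrightarrow> w \<in> K \<Longrightarrow> nrm (z * w) = nrm z * nrm w"
  unfolding nrm_def by (simp add: K_mult)

lemma nrm_eq_0_iff: "z \<in> K \<Longrightarrow> nrm z = 0 \<longleftrightarrow> z = 0" unfolding nrm_def by simp

text \<open>An element of the form \<open>el x y\<close> is a root of the monic integer polynomial
  with roots z and \<open>con z\<close>. Conversely, an irrational algebraic integer z = a + b rt
  satisfies z^2 = B z + C with integers B, C; then 2a = B and p (2b)^2 = B^2 + 4C, so y = 2b is an
  integer, of the parity of B because p is odd.\<close>

lemma OK_iff: "z \<in> OK \<longleftrightarrow> (\<exists>x y. z = el x y)"
proof
  assume "\<exists>x y. z = el x y"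
  then obtain x y where z: "z = el x y" by blast
  define q where "q = [:x\<^sup>2 + x * y - m4 * y\<^sup>2, - (2 * x + y), 1:]"
  have "poly (map_poly of_int q) z = nrm z - (z + con z) * z + z * z"
    unfolding q_def by (simp add: map_poly_pCons z nrm_el con_el) (simp add: el_def algebra_simps)
  also have "\<dots> = 0" unfolding nrm_def by (simp add: algebra_simps)
  finally have "poly (map_poly of_int q) z = 0" .
  moreover have "lead_coeff q = 1" unfolding q_def by simp
  ultimately have "algebraic_int z" using algebraic_int_altdef_ipoly by blast
  moreover have "z \<in> quadratic_field p" using z el_K unfolding K_def by simp
  ultimately show "z \<in> OK" unfolding OK_def integer_ring_def by simp
next
  assume "z \<in> OK"
  hence zK: "z \<in> K" and zi: "algebraic_int z" unfolding OK_def integer_ring_def K_def by auto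
  obtain a b where ab: "a \<in> \<rat>" "b \<in> \<rat>" "z = a + b * rt" using zK by (rule KE)
  show "\<exists>x y. z = el x y"
  proof (cases "b = 0")
    case True
    hence "z \<in> \<int>" using ab zi rational_algebraic_int_is_int by simp
    then obtain k where "z = of_int k" using Ints_cases by metis
    hence "z = el k 0" by (simp add: el_def)
    thus ?thesis by blast
  next
    case False
    have zQ: "z \<notin> \<rat>"
    proof
      assume "z \<in> \<rat>"
      hence "(z - a) / b \<in> \<rat>" using ab by (intro Rats_divide Rats_diff)
      moreover have "(z - a) / b = rt" using ab(3) False by simp
      ultimately show False using rt_irrational by simp
    qed
    have "z\<^sup>2 = (z + con z) * z + (- (z * con z))" by (simp add: power2_eq_square algebra_simps)
    then obtain B C :: int where BC: "z\<^sup>2 = of_int B * z + of_int C"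
      using algebraic_int_quadratic[OF zi zQ] norm_rat[OF zK] by (metis Rats_minus_iff)
    have "(a * a + real p * b * b) + (2 * a * b) * rt = (of_int B * a + of_int C) + (of_int B * b) * rt"
      using BC ab(3) rt_sq by (simp add: power2_eq_square algebra_simps)
    moreover have "a * a + real p * b * b \<in> \<rat>" "2 * a * b \<in> \<rat>"
      "of_int B * a + of_int C \<in> \<rat>" "of_int B * b \<in> \<rat>" using ab by auto
    ultimately have e: "a * a + real p * b * b = of_int B * a + of_int C" "2 * a * b = of_int B * b"
      using quadratic_eq_iff by blast+
    have a2: "2 * a = of_int B" using e(2) False by simp
    have "real p * (2 * b)\<^sup>2 = 4 * (a * a + real p * b * b) - (2 * a)\<^sup>2"
      by (simp add: power2_eq_square algebra_simps)
    also have "\<dots> = of_int (B\<^sup>2 + 4 * C)"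
      unfolding e(1) using a2 by (simp add: power2_eq_square algebra_simps)
    finally have *: "real p * (2 * b)\<^sup>2 = of_int (B\<^sup>2 + 4 * C)" .
    have "2 * b \<in> \<int>" by (rule real_int_square_times_prime[OF prime_p _ *]) (use ab in simp)
    then obtain y where y: "2 * b = of_int y" using Ints_cases by metis
    have "of_int (int p * y\<^sup>2) = real_of_int (B\<^sup>2 + 4 * C)" using * y by simp
    hence "int p * y\<^sup>2 = B\<^sup>2 + 4 * C" by (simp only: of_int_eq_iff)
    hence "even y = even B" using odd_p by (metis even_add even_mult_iff even_numeral even_of_nat even_power pos2)
    hence "even (B - y)" by simp
    then obtain x where x: "B - y = 2 * x" by (elim evenE)
    have "z = el x y"
    proof -
      have "real_of_int B = 2 * of_int x + of_int y" using x by linarith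
      hence "a = of_int x + of_int y / 2" using a2 by simp
      thus ?thesis using ab(3) y unfolding el_def om_def by (simp add: field_simps)
    qed
    thus ?thesis by blast
  qed
qed

lemma OK_el [simp]: "el x y \<in> OK" using OK_iff by blast

lemma OK_K: "z \<in> OK \<Longrightarrow> z \<in> K" unfolding OK_iff by auto

lemma OK_of_int [simp]: "of_int k \<in> OK" using OK_el[of k 0] by (simp add: el_def del: OK_el)

lemma OK_om [simp]: "om \<in> OK" using OK_el[of 0 1] by (simp add: el_def del: OK_el)

lemma OK_closed:
  "z \<in> OK \<Longrightarrow> w \<in> OK \<Longrightarrow> z + w \<in> OK" "z \<in> OK \<Longrightarrow> w \<in> OK \<Longrightarrow> z * w \<in> OK"
  "z \<in> OK \<Longrightarrow> - z \<in> OK" "z \<in> OK \<Longrightarrow> con z \<in> OK"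
  unfolding OK_iff by (metis el_add, metis el_mult, metis el_minus, metis con_el')

lemma nrm_int: "z \<in> OK \<Longrightarrow> nrm z \<in> \<int>" unfolding OK_iff using nrm_el by auto

lemma integer_ring_simps:
  "carrier (integer_ring p) = OK" "mult (integer_ring p) = (*)" "one (integer_ring p) = 1"
  "zero (integer_ring p) = 0" "add (integer_ring p) = (+)"
  unfolding OK_def by (auto simp: integer_ring_def)

lemma cring_integer_ring: "cring (integer_ring p)"
proof (rule cringI)
  show "abelian_group (integer_ring p)"
    by (rule abelian_groupI)
      (auto simp: integer_ring_simps OK_closed intro!: bexI[of _ "- x" for x] intro: OK_of_int[of 0, simplified])
  show "Group.comm_monoid (integer_ring p)"
    by (rule comm_monoidI) (auto simp: integer_ring_simps OK_closed OK_of_int[of 1, simplified])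
qed (auto simp: integer_ring_simps algebra_simps)

lemma Units_iff: "u \<in> Units (integer_ring p) \<longleftrightarrow> u \<in> OK \<and> \<bar>nrm u\<bar> = 1"
proof
  assume "u \<in> Units (integer_ring p)"
  then obtain v where uv: "u \<in> OK" "v \<in> OK" "v * u = 1"
    unfolding Units_def integer_ring_simps by auto
  have "nrm v * nrm u = 1" using nrm_mult[of v u] uv OK_K by (simp add: nrm_def)
  moreover obtain a b where "nrm v = of_int a" "nrm u = of_int b"
    using nrm_int uv Ints_cases by metis
  ultimately have "real_of_int (a * b) = of_int 1" by simp
  hence "a * b = 1" by (simp only: of_int_eq_iff)
  hence "\<bar>b\<bar> = 1" using zmult_eq_1_iff by auto
  thus "u \<in> OK \<and> \<bar>nrm u\<bar> = 1" using uv \<open>nrm u = of_int b\<close> by simp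
next
  assume u: "u \<in> OK \<and> \<bar>nrm u\<bar> = 1"
  \<comment> \<open>The inverse of u is its conjugate up to the sign \<open>nrm u\<close>.\<close>
  define v where "v = nrm u * con u"
  have n: "nrm u = 1 \<or> nrm u = -1" using u by linarith
  hence "v \<in> OK" unfolding v_def using OK_closed u by auto
  moreover have "v * u = nrm u * nrm u" unfolding v_def nrm_def by simp
  hence "v * u = 1" using n by auto
  ultimately show "u \<in> Units (integer_ring p)"
    unfolding Units_def integer_ring_simps using u by (auto simp: mult.commute)
qed

section \<open>Units\<close>

lemma unit_group:
  assumes "u \<in> Units (integer_ring p)"
  shows "u \<noteq> 0" "- u \<in> Units (integer_ring p)" "inverse u \<in> Units (integer_ring p)"
    "v \<in> Units (integer_ring p) \<Longrightarrow> u * v \<in> Units (integer_ring p)"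
    "u powi n \<in> Units (integer_ring p)"
proof -
  have u: "u \<in> OK" "u \<in> K" "\<bar>nrm u\<bar> = 1" using assms OK_K unfolding Units_iff by auto
  show nz: "u \<noteq> 0" using u unfolding nrm_def by auto
  show "- u \<in> Units (integer_ring p)" using u unfolding Units_iff nrm_def
    by (auto simp: OK_closed K_minus)
  have "nrm u = 1 \<or> nrm u = -1" using u by linarith
  hence "inverse u = con u \<or> inverse u = - con u"
    using nz unfolding nrm_def by (auto simp: field_simps)
  hence iO: "inverse u \<in> OK" using u OK_closed by metis
  have "nrm u * nrm (inverse u) = 1"
    using nz u by (subst nrm_mult[symmetric]) (auto simp: K_inverse nrm_def)
  hence "\<bar>nrm u\<bar> * \<bar>nrm (inverse u)\<bar> = 1" by (metis abs_mult abs_1)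
  hence ni: "\<bar>nrm (inverse u)\<bar> = 1" using u by simp
  show inv: "inverse u \<in> Units (integer_ring p)" using iO ni unfolding Units_iff by simp
  have mult: "a * b \<in> Units (integer_ring p)"
    if "a \<in> Units (integer_ring p)" "b \<in> Units (integer_ring p)" for a b
    using that unfolding Units_iff by (auto simp: nrm_mult OK_closed OK_K abs_mult)
  show "v \<in> Units (integer_ring p) \<Longrightarrow> u * v \<in> Units (integer_ring p)" using mult assms by blast
  have one: "1 \<in> Units (integer_ring p)" unfolding Units_iff nrm_def
    using OK_of_int[of 1] by simp
  have pow: "a ^ k \<in> Units (integer_ring p)" if "a \<in> Units (integer_ring p)" for a k
    using that by (induction k) (auto simp: one mult)
  show "u powi n \<in> Units (integer_ring p)"
    unfolding power_int_def using pow[OF assms] pow[OF inv] by auto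
qed

text \<open>Dirichlet approximation: an irrational number has infinitely many h / k within 1 / k^2,
  and then h^2 - p k^2 is, in absolute value, the product of |k rt - h| < 1 / k and |k rt + h| <= 2
  k rt + 1 / k.\<close>

lemma infinite_small_norm:
  "infinite {(h :: int, k :: int). k > 0 \<and> \<bar>real_of_int (h\<^sup>2 - int p * k\<^sup>2)\<bar> \<le> 2 * rt + 1}"
proof (rule infinite_super)
  show "infinite (approx_set rt)" using rational_iff_finite_approx_set rt_irrational by blast
  show "approx_set rt \<subseteq> {(h, k). k > 0 \<and> \<bar>real_of_int (h\<^sup>2 - int p * k\<^sup>2)\<bar> \<le> 2 * rt + 1}"
  proof (rule subsetI)
    fix hk assume "hk \<in> approx_set rt"
    then obtain h k :: int where hk: "hk = (h, k)" and k: "0 < k"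
      and *: "\<bar>rt - of_int h / of_int k\<bar> < 1 / (of_int k)\<^sup>2"
      unfolding approx_set_def by auto
    define H where "H = real_of_int h" define k' where "k' = real_of_int k"
    have k1: "k' \<ge> 1" using k unfolding k'_def by simp
    have "k' * \<bar>rt - H / k'\<bar> < k' * (1 / k'\<^sup>2)"
      using * k1 unfolding H_def k'_def by (intro mult_strict_left_mono) auto
    moreover have "k' * \<bar>rt - H / k'\<bar> = \<bar>k' * rt - H\<bar>"
      using k1 by (simp add: abs_mult_pos' right_diff_distrib)
    ultimately have a: "\<bar>k' * rt - H\<bar> < 1 / k'" using k1 by (simp add: power2_eq_square)
    have "k' * rt > 0" using k1 rt_pos by simp
    hence "\<bar>k' * rt + H\<bar> \<le> 2 * k' * rt + \<bar>k' * rt - H\<bar>" by linarith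
    also have "\<dots> \<le> 2 * k' * rt + 1 / k'" using a by simp
    finally have b: "\<bar>k' * rt + H\<bar> \<le> 2 * k' * rt + 1 / k'" .
    have "\<bar>(k' * rt - H) * (k' * rt + H)\<bar> \<le> (1 / k') * (2 * k' * rt + 1 / k')"
      unfolding abs_mult using a b k1 by (intro mult_mono) auto
    also have "\<dots> = 2 * rt + 1 / k'\<^sup>2" using k1 by (simp add: field_simps power2_eq_square)
    also have "\<dots> \<le> 2 * rt + 1" using k1 by simp
    also have "(k' * rt - H) * (k' * rt + H) = - real_of_int (h\<^sup>2 - int p * k\<^sup>2)"
      using rt_sq unfolding H_def k'_def by (simp add: power2_eq_square algebra_simps)
    finally show "hk \<in> {(h, k). k > 0 \<and> \<bar>real_of_int (h\<^sup>2 - int p * k\<^sup>2)\<bar> \<le> 2 * rt + 1}"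
      unfolding hk using k by (simp only: abs_minus_cancel mem_Collect_eq prod.case)
  qed
qed

text \<open>Two elements of \<open>\<int>[\<surd>p]\<close> of equal norm \<open>n\<close>, congruent modulo \<open>n\<close>, differ by a unit.\<close>
lemma ex_unit_gt_1: "\<exists>u \<in> Units (integer_ring p). u > 1"
proof -
  let ?S = "{(h :: int, k :: int). k > 0 \<and> \<bar>real_of_int (h\<^sup>2 - int p * k\<^sup>2)\<bar> \<le> 2 * rt + 1}"
  define B where "B = \<lceil>2 * rt + 1\<rceil>"
  \<comment> \<open>Pigeonhole: the norm is bounded and nonzero, so the norm together with the
    residues modulo the norm takes finitely many values, and two different pairs collide.\<close>
  define f where "f = (\<lambda>(h :: int, k :: int). let n = h\<^sup>2 - int p * k\<^sup>2 in (n, h mod n, k mod n))"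
  have nz: "h\<^sup>2 - int p * k\<^sup>2 \<noteq> 0" if "k > 0" for h k
  proof
    assume "h\<^sup>2 - int p * k\<^sup>2 = 0"
    hence "real_of_int (h\<^sup>2) = real_of_int (int p * k\<^sup>2)" by simp
    hence "(of_int h + of_int k * rt) * (of_int h - of_int k * rt) = 0"
      using rt_sq by (simp add: power2_eq_square algebra_simps)
    hence "of_int h + of_int k * rt = 0 + 0 * rt \<or> of_int h + of_int (-k) * rt = 0 + 0 * rt" by auto
    thus False using that quadratic_eq_iff[of "of_int h" "of_int k" 0 0]
        quadratic_eq_iff[of "of_int h" "of_int (-k)" 0 0] by auto
  qed
  have "f ` ?S \<subseteq> {-B..B} \<times> {-B..B} \<times> {-B..B}"
  proof (intro image_subsetI)
    fix hk :: "int \<times> int" assume "hk \<in> ?S"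
    then obtain h k where hk: "hk = (h, k)" and k: "k > 0"
      and *: "\<bar>real_of_int (h\<^sup>2 - int p * k\<^sup>2)\<bar> \<le> 2 * rt + 1" by blast
    define n where "n = h\<^sup>2 - int p * k\<^sup>2"
    have "\<bar>n\<bar> \<le> B" using * unfolding B_def n_def by linarith
    moreover have "\<bar>h mod n\<bar> \<le> \<bar>n\<bar>" "\<bar>k mod n\<bar> \<le> \<bar>n\<bar>"
      using nz[OF k, of h] abs_mod_less[of n] unfolding n_def by (auto intro: less_imp_le)
    ultimately show "f hk \<in> {-B..B} \<times> {-B..B} \<times> {-B..B}"
      unfolding f_def Let_def n_def hk by auto
  qed
  hence "finite (f ` ?S)" by (rule finite_subset) auto
  hence "\<not> inj_on f ?S" using infinite_small_norm finite_imageD by blast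
  then obtain h1 k1 h2 k2 where hk: "k1 > 0" "k2 > 0" "(h1, k1) \<noteq> (h2, k2)" "f (h1, k1) = f (h2, k2)"
    unfolding inj_on_def by auto
  define n where "n = h1\<^sup>2 - int p * k1\<^sup>2"
  have n2: "n = h2\<^sup>2 - int p * k2\<^sup>2" and c: "[h1 = h2] (mod n)" "[k1 = k2] (mod n)"
    using hk(4) unfolding f_def Let_def n_def icong_def by auto
  have n0: "n \<noteq> 0" unfolding n_def using nz hk by simp
  \<comment> \<open>X and Y will be the coordinates of z1 times the conjugate of z2, divided by the
    common norm n. That both are integers makes u = z1 / z2 integral.\<close>
  have "[h1 * h2 - int p * (k1 * k2) = h2 * h2 - int p * (k2 * k2)] (mod n)"
    using c by (intro cong_diff cong_mult cong_refl) auto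
  also have "h2 * h2 - int p * (k2 * k2) = n" unfolding n2 by (simp add: power2_eq_square)
  finally have "n dvd h1 * h2 - int p * (k1 * k2)" by (simp add: cong_dvd_iff)
  then obtain X where X: "h1 * h2 - int p * (k1 * k2) = n * X" by (elim dvdE)
  have "[h2 * k1 - h1 * k2 = h2 * k2 - h2 * k2] (mod n)"
    using c by (intro cong_diff cong_mult cong_refl) auto
  hence "n dvd h2 * k1 - h1 * k2" by (simp add: cong_0_iff)
  then obtain Y where Y: "h2 * k1 - h1 * k2 = n * Y" by (elim dvdE)
  define z1 where "z1 = of_int h1 + of_int k1 * rt"
  define z2 where "z2 = of_int h2 + of_int k2 * rt"
  define u where "u = of_int X + of_int Y * rt"
  have zK: "z1 \<in> K" "z2 \<in> K" unfolding z1_def z2_def by (auto intro!: KI)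
  have cz: "con z1 = of_int h1 - of_int k1 * rt" "con z2 = of_int h2 - of_int k2 * rt"
    unfolding z1_def z2_def by (rule con_eq; simp)+
  have nz1: "nrm z1 = of_int n"
    unfolding nrm_def cz unfolding z1_def n_def using rt_sq by (simp add: algebra_simps power2_eq_square)
  have nz2: "nrm z2 = of_int n"
    unfolding nrm_def cz unfolding z2_def n2 using rt_sq by (simp add: algebra_simps power2_eq_square)
  have "of_int n * u = of_int (n * X) + of_int (n * Y) * rt" unfolding u_def by (simp add: algebra_simps)
  also have "\<dots> = z1 * con z2" unfolding X[symmetric] Y[symmetric] cz unfolding z1_def using rt_sq
    by (simp add: algebra_simps)
  finally have nu: "of_int n * u = z1 * con z2" .
  have z20: "z2 \<noteq> 0" "con z2 \<noteq> 0" using nz2 n0 unfolding nrm_def by auto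
  have "z2 * u * con z2 = z1 * con z2" using nu nz2 unfolding nrm_def by (simp add: mult_ac)
  hence z12: "z2 * u = z1" using z20 by simp
  have "u = el (X - Y) (2 * Y)" unfolding u_def el_def om_def by (simp add: algebra_simps)
  hence uO: "u \<in> OK" by simp
  have "nrm z2 * nrm u = nrm z1" using nrm_mult[of z2 u] z12 zK OK_K[OF uO] by simp
  hence "nrm u = 1" using nz1 nz2 n0 by simp
  hence uU: "u \<in> Units (integer_ring p)" using uO unfolding Units_iff by simp
  have "u \<noteq> 1" using z12 hk(3) quadratic_eq_iff[of "of_int h1" "of_int k1" "of_int h2" "of_int k2"]
    unfolding z1_def z2_def by auto
  moreover have "u \<noteq> -1" using z12 hk(1,2) quadratic_eq_iff[of "of_int h1" "of_int k1" "- of_int h2" "- of_int k2"]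
    unfolding z1_def z2_def by auto
  moreover have "u \<noteq> 0" using unit_group(1)[OF uU] .
  ultimately consider "u > 1" | "u < -1" | "0 < u" "u < 1" | "-1 < u" "u < 0" by linarith
  thus ?thesis
  proof cases
    case 3
    thus ?thesis using unit_group(3)[OF uU] one_less_inverse by blast
  next
    case 4
    hence "1 < - inverse u" using one_less_inverse[of "-u"] by simp
    thus ?thesis using unit_group(2,3) uU by blast
  next
    case 2
    thus ?thesis using unit_group(2)[OF uU] by (intro bexI[of _ "-u"]) auto
  qed (use uU in blast)
qed

text \<open>The conjugate of a unit above 1 is smaller than 1 in absolute value, so u + con u and u
  - con u are bounded, and they determine the integer coordinates.\<close>

lemma finite_units_le: "finite {u \<in> Units (integer_ring p). 1 < u \<and> u \<le> B}"
proof (rule finite_subset)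
  define C where "C = \<lceil>B\<rceil> + 2"
  show "{u \<in> Units (integer_ring p). 1 < u \<and> u \<le> B} \<subseteq> (\<lambda>(x, y). el x y) ` ({-2 * C..2 * C} \<times> {-C..C})"
  proof
    fix u assume "u \<in> {u \<in> Units (integer_ring p). 1 < u \<and> u \<le> B}"
    hence u: "u \<in> OK" "\<bar>nrm u\<bar> = 1" "1 < u" "u \<le> B" unfolding Units_iff by auto
    obtain x y where xy: "u = el x y" using u OK_iff by blast
    have "\<bar>con u\<bar> < 1"
    proof (rule ccontr)
      assume "\<not> \<bar>con u\<bar> < 1"
      hence "u * 1 \<le> u * \<bar>con u\<bar>" using u by (intro mult_left_mono) auto
      moreover have "u * \<bar>con u\<bar> = 1" using u unfolding nrm_def by (simp add: abs_mult)
      ultimately show False using u(3) by linarith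
    qed
    hence b: "\<bar>u - con u\<bar> < B + 1" "\<bar>u + con u\<bar> < B + 1" using u by linarith+
    have d: "u - con u = of_int y * rt"
      unfolding xy con_el unfolding el_def om_def by (simp add: field_simps)
    have t: "u + con u = of_int (2 * x + y)"
      unfolding xy con_el unfolding el_def by (simp add: algebra_simps)
    have "\<bar>of_int y\<bar> * 1 \<le> \<bar>real_of_int y\<bar> * rt" using rt_gt_2 by (intro mult_left_mono) auto
    hence "\<bar>real_of_int y\<bar> < B + 1" using b(1) d by (simp add: abs_mult rt_pos less_imp_le)
    hence y: "\<bar>y\<bar> \<le> C" unfolding C_def by linarith
    have "\<bar>2 * x + y\<bar> \<le> C" using b(2) t unfolding C_def by linarith
    hence "\<bar>x\<bar> \<le> 2 * C" using y by linarith
    thus "u \<in> (\<lambda>(x, y). el x y) ` ({-2 * C..2 * C} \<times> {-C..C})" using xy y \<open>\<bar>x\<bar> \<le> 2 * C\<close> by (intro image_eqI[of _ _ "(x, y)"]) auto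
  qed
qed auto

text \<open>Shows that the definite description denotes. By finiteness there is a least unit e > 1;
  dividing a positive unit u by the power of e with exponent floor (ln u / ln e) leaves a unit in
  [1, e), which is 1.\<close>

lemma fundamental_unit:
  "fundamental_unit p \<in> Units (integer_ring p)" "fundamental_unit p > 1"
  "\<And>u. u \<in> Units (integer_ring p) \<Longrightarrow>
      \<exists>n::int. u = fundamental_unit p powi n \<or> u = - (fundamental_unit p powi n)"
proof -
  obtain u0 where u0: "u0 \<in> Units (integer_ring p)" "u0 > 1" using ex_unit_gt_1 by blast
  let ?S = "{u \<in> Units (integer_ring p). 1 < u \<and> u \<le> u0}"
  define e where "e = Min ?S"
  have "e \<in> ?S" unfolding e_def using finite_units_le u0 by (intro Min_in) auto
  hence e: "e \<in> Units (integer_ring p)" "e > 1" "e \<le> u0" by auto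
  have min: "e \<le> u" if "u \<in> Units (integer_ring p)" "u > 1" for u
  proof (cases "u \<le> u0")
    case True
    thus ?thesis unfolding e_def using that finite_units_le by (intro Min_le) auto
  qed (use e in auto)
  have gen_pos: "\<exists>n::int. u = e powi n" if u: "u \<in> Units (integer_ring p)" "u > 0" for u
  proof -
    define n where "n = \<lfloor>ln u / ln e\<rfloor>"
    have le: "ln e > 0" using e by simp
    have lnp: "ln (e powi k) = of_int k * ln e" for k
      using e powr_real_of_int'[of e k] ln_powr[of e "of_int k"] by simp
    have "of_int n \<le> ln u / ln e" "ln u / ln e < of_int n + 1" unfolding n_def by linarith+
    hence "of_int n * ln e \<le> ln u" "ln u < of_int n * ln e + ln e"
      using le by (simp_all add: field_simps)
    moreover have "ln (e powi n) = of_int n * ln e" by (rule lnp)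
    moreover define v where "v = u * e powi (- n)"
    have pos: "e powi k > 0" for k using e by (intro zero_less_power_int) auto
    have "ln v = ln u - of_int n * ln e"
      unfolding v_def using u pos[of "-n"] e by (subst ln_mult_pos) (auto simp: lnp)
    ultimately have "0 \<le> ln v" "ln v < ln e" by auto
    moreover have "v > 0" unfolding v_def using u pos by simp
    ultimately have "1 \<le> v" "v < e" using e by auto
    moreover have "v \<in> Units (integer_ring p)"
      unfolding v_def by (rule unit_group(4)[OF u(1) unit_group(5)[OF e(1)]])
    ultimately have "v = 1" using min[of v] by fastforce
    hence "u = e powi n" unfolding v_def using e by (simp add: power_int_minus field_simps)
    thus ?thesis by blast
  qed
  have gen: "\<exists>n::int. u = e powi n \<or> u = - (e powi n)" if u: "u \<in> Units (integer_ring p)" for u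
  proof (cases "u > 0")
    case False
    hence "- u > 0" using unit_group(1)[OF u] by simp
    then obtain n where "- u = e powi n" using gen_pos[of "-u"] unit_group(2)[OF u] by blast
    hence "u = - (e powi n)" by simp
    thus ?thesis by blast
  qed (use gen_pos u in blast)
  \<comment> \<open>Uniqueness: if f > 1 also generates, then e is a power of f with positive
    exponent, so f <= e, while e is minimal.\<close>
  have "fundamental_unit p = e" unfolding fundamental_unit_def
  proof (rule the_equality)
    show "e \<in> Units (integer_ring p) \<and> e > 1 \<and>
        (\<forall>u \<in> Units (integer_ring p). \<exists>n::int. u = e powi n \<or> u = - (e powi n))"
      using e gen by blast
    fix f assume f: "f \<in> Units (integer_ring p) \<and> f > 1 \<and>
        (\<forall>u \<in> Units (integer_ring p). \<exists>n::int. u = f powi n \<or> u = - (f powi n))"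
    hence fe: "e \<le> f" using min by blast
    obtain n :: int where n: "e = f powi n \<or> e = - (f powi n)" using f e by blast
    have pos: "f powi k > 0" for k using f by (intro zero_less_power_int) auto
    have en: "e = f powi n" using n e pos[of n] by auto
    have "n > 0"
    proof (rule ccontr)
      assume "\<not> n > 0"
      hence "f powi n \<le> f powi 0" using f by (intro power_int_increasing) auto
      thus False using en e by simp
    qed
    hence "f powi 1 \<le> f powi n" using f by (intro power_int_increasing) auto
    thus "f = e" using fe en by simp
  qed
  thus "fundamental_unit p \<in> Units (integer_ring p)" "fundamental_unit p > 1"
    "\<And>u. u \<in> Units (integer_ring p) \<Longrightarrow>
      \<exists>n::int. u = fundamental_unit p powi n \<or> u = - (fundamental_unit p powi n)"
    using e gen by simp_all
qed

end

section \<open>Ideals\<close>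

lemma int_subgroup_generator:
  fixes S :: "int set"
  assumes "0 \<in> S" "\<And>x y. x \<in> S \<Longrightarrow> y \<in> S \<Longrightarrow> x + y \<in> S" "\<And>k x. x \<in> S \<Longrightarrow> k * x \<in> S"
    and "x0 \<in> S" "x0 \<noteq> 0"
  obtains d where "d > 0" "\<And>x. x \<in> S \<longleftrightarrow> d dvd x"
proof -
  define d where "d = int (LEAST n. n > 0 \<and> int n \<in> S)"
  have "\<bar>x0\<bar> \<in> S" using assms(3)[of x0 "-1"] assms(4) by (auto simp: abs_if)
  hence "nat \<bar>x0\<bar> > 0 \<and> int (nat \<bar>x0\<bar>) \<in> S" using assms(5) by simp
  hence "(LEAST n. n > 0 \<and> int n \<in> S) > 0 \<and> int (LEAST n. n > 0 \<and> int n \<in> S) \<in> S"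
    by (rule LeastI)
  hence d: "d > 0" "d \<in> S" unfolding d_def by simp_all
  have least: "d \<le> k" if "k > 0" "k \<in> S" for k
  proof -
    have "nat k > 0 \<and> int (nat k) \<in> S" using that by simp
    hence "(LEAST n. n > 0 \<and> int n \<in> S) \<le> nat k" by (rule Least_le)
    thus ?thesis using that unfolding d_def by simp
  qed
  have "x \<in> S \<longleftrightarrow> d dvd x" for x
  proof
    assume x: "x \<in> S"
    have "x + (- (x div d)) * d \<in> S" using assms(2,3) x d by blast
    hence "x mod d \<in> S" by (simp add: minus_div_mult_eq_mod)
    moreover have "0 \<le> x mod d" "x mod d < d" using d by auto
    ultimately have "x mod d = 0" using least[of "x mod d"] by force
    thus "d dvd x" by auto
  next
    assume "d dvd x"
    thus "x \<in> S" using assms(3)[OF d(2)] by (metis dvdE mult.commute)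
  qed
  thus ?thesis using that d by blast
qed

definition latt :: "real \<Rightarrow> real \<Rightarrow> real set" where
  "latt u v = {of_int x * u + of_int y * v | x y :: int. True}"

lemma latt_mult: "(*) c ` latt u v = latt (c * u) (c * v)"
proof -
  have "c * (of_int x * u + of_int y * v) = of_int x * (c * u) + of_int y * (c * v)" for x y :: int
    by (simp add: algebra_simps)
  thus ?thesis unfolding latt_def by (auto simp: image_def) metis
qed

lemma lattI: "of_int x * u + of_int y * v \<in> latt u v" unfolding latt_def by blast

lemma latt_basis: "u \<in> latt u v" "v \<in> latt u v"
  using lattI[of 1 u 0 v] lattI[of 0 u 1 v] by simp_all

lemma latt_add: "s \<in> latt u v \<Longrightarrow> t \<in> latt u v \<Longrightarrow> s + t \<in> latt u v"
  unfolding latt_def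
proof clarify
  fix x y x' y' :: int
  show "\<exists>x'' y''. of_int x * u + of_int y * v + (of_int x' * u + of_int y' * v) =
      of_int x'' * u + of_int y'' * v \<and> True"
    by (intro exI[of _ "x + x'"] exI[of _ "y + y'"]) (simp add: algebra_simps)
qed

lemma latt_int_mult: "s \<in> latt u v \<Longrightarrow> of_int k * s \<in> latt u v"
  unfolding latt_def
proof clarify
  fix x y :: int
  show "\<exists>x'' y''. of_int k * (of_int x * u + of_int y * v) = of_int x'' * u + of_int y'' * v \<and> True"
    by (intro exI[of _ "k * x"] exI[of _ "k * y"]) (simp add: algebra_simps)
qed

context prime_one_mod_four
begin

definition eps :: real where "eps = fundamental_unit p"

lemma a_inv_integer_ring: "x \<in> OK \<Longrightarrow> a_inv (integer_ring p) x = - x"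
proof -
  interpret cring "integer_ring p" by (rule cring_integer_ring)
  assume "x \<in> OK"
  thus ?thesis using minus_equality[of "- x" x] by (simp add: integer_ring_simps OK_closed)
qed

lemma ideal_iff: "ideal I (integer_ring p) \<longleftrightarrow>
  I \<subseteq> OK \<and> 0 \<in> I \<and> (\<forall>x\<in>I. \<forall>y\<in>I. x + y \<in> I) \<and> (\<forall>c\<in>OK. \<forall>x\<in>I. c * x \<in> I)"
proof
  assume I: "ideal I (integer_ring p)"
  interpret ideal I "integer_ring p" by (rule I)
  have "I \<subseteq> OK" using a_subset by (simp add: integer_ring_simps)
  moreover have "0 \<in> I"
    using additive_subgroup.zero_closed[OF is_additive_subgroup] by (simp add: integer_ring_simps)
  moreover have "x + y \<in> I" if "x \<in> I" "y \<in> I" for x y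
    using additive_subgroup.a_closed[OF is_additive_subgroup that] by (simp add: integer_ring_simps)
  moreover have "c * x \<in> I" if "x \<in> I" "c \<in> OK" for c x
    using I_l_closed[of x c] that by (simp add: integer_ring_simps)
  ultimately show "I \<subseteq> OK \<and> 0 \<in> I \<and> (\<forall>x\<in>I. \<forall>y\<in>I. x + y \<in> I) \<and> (\<forall>c\<in>OK. \<forall>x\<in>I. c * x \<in> I)"
    by (intro conjI ballI)
next
  assume I: "I \<subseteq> OK \<and> 0 \<in> I \<and> (\<forall>x\<in>I. \<forall>y\<in>I. x + y \<in> I) \<and> (\<forall>c\<in>OK. \<forall>x\<in>I. c * x \<in> I)"
  interpret cring "integer_ring p" by (rule cring_integer_ring)
  have neg: "- x \<in> I" if "x \<in> I" for x
  proof -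
    have "-1 \<in> OK" using OK_of_int[of "-1"] by simp
    hence "(-1) * x \<in> I" using I that by blast
    thus ?thesis by simp
  qed
  show "ideal I (integer_ring p)"
  proof (rule idealI)
    show "ring (integer_ring p)" by (rule ring_axioms)
    show "subgroup I (add_monoid (integer_ring p))"
    proof
      show "I \<subseteq> carrier (add_monoid (integer_ring p))" using I by (simp add: integer_ring_simps)
      show "x \<otimes>\<^bsub>add_monoid (integer_ring p)\<^esub> y \<in> I" if "x \<in> I" "y \<in> I" for x y
        using I that by (simp add: integer_ring_simps)
      show "\<one>\<^bsub>add_monoid (integer_ring p)\<^esub> \<in> I" using I by (simp add: integer_ring_simps)
      show "inv\<^bsub>add_monoid (integer_ring p)\<^esub> x \<in> I" if "x \<in> I" for x
      proof -
        have "x \<in> OK" using I that by blast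
        hence "inv\<^bsub>add_monoid (integer_ring p)\<^esub> x = - x"
          using a_inv_integer_ring[of x] I that unfolding a_inv_def by blast
        thus ?thesis using neg that by simp
      qed
    qed
    show "x \<otimes>\<^bsub>integer_ring p\<^esub> a \<in> I" if "a \<in> I" "x \<in> carrier (integer_ring p)" for a x
      using I that by (simp add: integer_ring_simps)
    show "a \<otimes>\<^bsub>integer_ring p\<^esub> x \<in> I" if "a \<in> I" "x \<in> carrier (integer_ring p)" for a x
    proof -
      have "x * a \<in> I" using I that by (simp add: integer_ring_simps)
      thus ?thesis unfolding integer_ring_simps by (subst mult.commute)
    qed
  qed
qed

text \<open>Determinant of the vectors (u, con u) and (v, con v), i.e. the signed covolume of
  \<open>latt u v\<close> under the two real embeddings.\<close>

definition det2 :: "real \<Rightarrow> real \<Rightarrow> real" where "det2 u v = u * con v - v * con u"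

lemma det2_mult: "u \<in> K \<Longrightarrow> v \<in> K \<Longrightarrow> c \<in> K \<Longrightarrow> det2 (c * u) (c * v) = nrm c * det2 u v"
  unfolding det2_def nrm_def by (simp add: K_mult algebra_simps)

lemma con_comb: "u \<in> K \<Longrightarrow> v \<in> K \<Longrightarrow>
    con (of_int x * u + of_int y * v) = of_int x * con u + of_int y * con v"
  by (subst K_add(2)) (auto simp: K_mult)

lemma det2_sublattice:
  assumes "u \<in> K" "v \<in> K" "latt u' v' \<subseteq> latt u v"
  obtains k :: int where "det2 u' v' = of_int k * det2 u v"
proof -
  obtain x y where u': "u' = of_int x * u + of_int y * v"
    using latt_basis(1)[of u' v'] assms(3) unfolding latt_def by blast
  obtain z w where v': "v' = of_int z * u + of_int w * v"
    using latt_basis(2)[of v' u'] assms(3) unfolding latt_def by blast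
  have "det2 u' v' = of_int (x * w - y * z) * det2 u v"
    unfolding det2_def u' v' con_comb[OF assms(1,2)] by (simp add: algebra_simps)
  thus ?thesis using that by blast
qed

text \<open>Each basis is an integer combination of the other, so each determinant is an integer
  multiple of the other. This makes \<open>Nm\<close> well defined.\<close>

lemma det2_unique:
  assumes "u \<in> K" "v \<in> K" "u' \<in> K" "v' \<in> K" "latt u' v' = latt u v"
  shows "\<bar>det2 u v\<bar> = \<bar>det2 u' v'\<bar>"
proof -
  obtain k :: int where k: "det2 u' v' = of_int k * det2 u v"
    using det2_sublattice assms by blast
  obtain l :: int where l: "det2 u v = of_int l * det2 u' v'"
    using det2_sublattice[of u' v' u v] assms by blast
  show ?thesis
  proof (cases "det2 u v = 0")
    case False
    have "det2 u v = of_int (l * k) * det2 u v" using k l by (simp add: mult.assoc)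
    hence "of_int (l * k) = (1 :: real)" using False by simp
    hence "l * k = 1" by (simp only: of_int_eq_1_iff)
    hence "\<bar>k\<bar> = 1" using zmult_eq_1_iff by auto
    thus ?thesis using k by (simp add: abs_mult flip: of_int_abs)
  qed (use k in simp)
qed

text \<open>The norm of an ideal is the index of the lattice, i.e. its covolume relative to that of the ring of
  integers.\<close>
definition Nm :: "real set \<Rightarrow> real" where
  "Nm I = (THE c. \<exists>u\<in>K. \<exists>v\<in>K. I = latt u v \<and> c = \<bar>det2 u v\<bar> / rt)"

lemma Nm_latt: assumes "u \<in> K" "v \<in> K" shows "Nm (latt u v) = \<bar>det2 u v\<bar> / rt"
  unfolding Nm_def
proof (rule the_equality)
  show "\<exists>u'\<in>K. \<exists>v'\<in>K. latt u v = latt u' v' \<and> \<bar>det2 u v\<bar> / rt = \<bar>det2 u' v'\<bar> / rt"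
    using assms by blast
  show "c = \<bar>det2 u v\<bar> / rt"
    if "\<exists>u'\<in>K. \<exists>v'\<in>K. latt u v = latt u' v' \<and> c = \<bar>det2 u' v'\<bar> / rt" for c
    using that det2_unique assms by metis
qed

text \<open>A triple \<open>(g, a, b)\<close> stands for the ideal \<open>g (\<int>a + \<int>(b + \<omega>))\<close>, where \<open>b\<^sup>2 + b - m4\<close> is the norm
  of \<open>b + \<omega>\<close>.\<close>
definition triples :: "(int \<times> int \<times> int) set" where
  "triples = {(g, a, b). g > 0 \<and> a > 0 \<and> 0 \<le> b \<and> b < a \<and> a dvd b\<^sup>2 + b - m4}"

definition ideal_of :: "int \<times> int \<times> int \<Rightarrow> real set" where
  "ideal_of = (\<lambda>(g, a, b). latt (of_int (g * a)) (of_int g * (of_int b + om)))"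

lemma latt_el: "of_int x * of_int (g * a) + of_int y * (of_int g * (of_int b + om)) =
    el (g * (x * a + y * b)) (g * y)"
  by (simp add: el_def algebra_simps)

lemma ideal_of_eq: "ideal_of (g, a, b) = {el (g * (x * a + y * b)) (g * y) | x y. True}"
  unfolding ideal_of_def latt_def latt_el by simp

lemma ideal_of_mult: "ideal_of (g, a, b) = (*) (of_int g) ` ideal_of (1, a, b)"
  unfolding ideal_of_def latt_mult prod.case by simp

lemma ideal_of_nonzero_ideal:
  assumes "(g, a, b) \<in> triples" shows "ideal_of (g, a, b) \<in> nonzero_ideals p"
proof -
  have gab: "g > 0" "a > 0" "a dvd b\<^sup>2 + b - m4" using assms unfolding triples_def by auto
  then obtain n where n: "b\<^sup>2 + b - m4 = a * n" by (elim dvdE)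
  have "ideal (ideal_of (g, a, b)) (integer_ring p)"
    unfolding ideal_iff
  proof (intro conjI ballI)
    show "ideal_of (g, a, b) \<subseteq> OK" unfolding ideal_of_eq by auto
    show "0 \<in> ideal_of (g, a, b)"
      unfolding ideal_of_def using lattI[of 0 _ 0] by simp
    show "x + y \<in> ideal_of (g, a, b)" if "x \<in> ideal_of (g, a, b)" "y \<in> ideal_of (g, a, b)" for x y
      using that unfolding ideal_of_def by (simp add: latt_add)
    fix c z assume "c \<in> OK" and z: "z \<in> ideal_of (g, a, b)"
    then obtain s t where c: "c = el s t" unfolding OK_iff by blast
    obtain x y where "z = el (g * (x * a + y * b)) (g * y)" using z unfolding ideal_of_eq by auto
    \<comment> \<open>Here the divisibility in \<open>triples\<close> enters: om (b + om) = (b + 1)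
      (b + om) - a n, whereas om a = a (b + om) - b a holds for every b.\<close>
    have om_z: "om * z \<in> ideal_of (g, a, b)"
    proof -
      have m: "m4 = b\<^sup>2 + b - a * n" using n by simp
      have "om * z = el 0 1 * el (g * (x * a + y * b)) (g * y)" using \<open>z = _\<close> by (simp add: el_def)
      also have "\<dots> = el (g * ((- (b * x) - y * n) * a + (x * a + y * b + y) * b)) (g * (x * a + y * b + y))"
        unfolding el_mult el_eq_iff m by (simp add: algebra_simps power2_eq_square)
      also have "\<dots> \<in> ideal_of (g, a, b)" unfolding ideal_of_eq by blast
      finally show ?thesis .
    qed
    have "c * z = of_int s * z + of_int t * (om * z)" unfolding c el_def by (simp add: algebra_simps)
    also have "\<dots> \<in> ideal_of (g, a, b)"
      using z om_z unfolding ideal_of_def by (auto intro!: latt_add latt_int_mult)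
    finally show "c * z \<in> ideal_of (g, a, b)" .
  qed
  moreover have "ideal_of (g, a, b) \<noteq> {0}"
  proof
    assume "ideal_of (g, a, b) = {0}"
    moreover have "of_int (g * a) \<in> ideal_of (g, a, b)" unfolding ideal_of_def prod.case by (rule latt_basis)
    ultimately have "real_of_int (g * a) = 0" by blast
    thus False using gab(1,2) by simp
  qed
  ultimately show ?thesis unfolding nonzero_ideals_def by blast
qed

text \<open>Hermite normal form of a lattice closed under \<open>om\<close>: A generates the
  rational integers in I, and g the group of om-coordinates. Multiplication by \<open>om\<close>
  turns first coordinates into om-coordinates, so g divides A and x0 and can be pulled out.\<close>

lemma nonzero_ideal_triple:
  assumes "I \<in> nonzero_ideals p" obtains g a b where "(g, a, b) \<in> triples" "I = ideal_of (g, a, b)"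
proof -
  have I: "I \<subseteq> OK" "0 \<in> I" and add: "\<And>x y. x \<in> I \<Longrightarrow> y \<in> I \<Longrightarrow> x + y \<in> I"
    and mult: "\<And>c x. c \<in> OK \<Longrightarrow> x \<in> I \<Longrightarrow> c * x \<in> I" and "I \<noteq> {0}"
    using assms unfolding nonzero_ideals_def ideal_iff by auto
  then obtain z where z: "z \<in> I" "z \<noteq> 0" by blast
  obtain k where k: "nrm z = of_int k" using nrm_int[of z] z I Ints_cases by blast
  have k0: "k \<noteq> 0" using k z I nrm_eq_0_iff[of z] OK_K by auto
  \<comment> \<open>The norm of z is a nonzero rational integer in I; it keeps the two subgroups
    below from being zero.\<close>
  have "con z * z \<in> I" using mult z I OK_closed(4) by blast
  hence kI: "el k 0 \<in> I" using k unfolding nrm_def el_def by (simp add: mult.commute)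
  have smul: "el (c * x) (c * y) \<in> I" if "el x y \<in> I" for c x y
  proof -
    have "of_int c * el x y \<in> I" using mult[OF OK_of_int that] .
    thus ?thesis by (simp add: el_def algebra_simps)
  qed
  have add': "el (x + x') (y + y') \<in> I" if "el x y \<in> I" "el x' y' \<in> I" for x y x' y'
    using add[OF that] by (simp add: el_add)
  have omI: "el (y * m4) (x + y) \<in> I" if "el x y \<in> I" for x y
    using mult[OF OK_om that] el_mult[of 0 1 x y] by (simp add: el_def[of 0 1])
  have I0: "el 0 0 \<in> I" using I by (simp add: el_def)
  obtain A where A: "A > 0" "\<And>x. el x 0 \<in> I \<longleftrightarrow> A dvd x"
  proof (rule int_subgroup_generator[of "{x. el x 0 \<in> I}" k])
    show "0 \<in> {x. el x 0 \<in> I}" using I0 by simp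
    show "x + y \<in> {x. el x 0 \<in> I}" if "x \<in> {x. el x 0 \<in> I}" "y \<in> {x. el x 0 \<in> I}" for x y
      using add'[of x 0 y 0] that by simp
    show "c * x \<in> {x. el x 0 \<in> I}" if "x \<in> {x. el x 0 \<in> I}" for c x
      using smul[of x 0 c] that by simp
  qed (use kI k0 that in auto)
  obtain g where g: "g > 0" "\<And>y. (\<exists>x. el x y \<in> I) \<longleftrightarrow> g dvd y"
  proof (rule int_subgroup_generator[of "{y. \<exists>x. el x y \<in> I}" k])
    show "0 \<in> {y. \<exists>x. el x y \<in> I}" using I0 by blast
    show "y + y' \<in> {y. \<exists>x. el x y \<in> I}" if "y \<in> {y. \<exists>x. el x y \<in> I}" "y' \<in> {y. \<exists>x. el x y \<in> I}" for y y'
      using add' that by blast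
    show "c * y \<in> {y. \<exists>x. el x y \<in> I}" if "y \<in> {y. \<exists>x. el x y \<in> I}" for c y
      using smul that by blast
    show "k \<in> {y. \<exists>x. el x y \<in> I}" using omI[OF kI] by auto
  qed (use k0 that in auto)
  obtain x0 where x0: "el x0 g \<in> I" using g(2)[of g] by (metis dvd_refl)
  have "el A 0 \<in> I" using A by simp
  hence "g dvd A" using omI[of A 0] g(2) by auto
  then obtain a where a: "A = g * a" by (elim dvdE)
  have "a > 0" using a A(1) g(1) zero_less_mult_pos by blast
  have "g dvd x0 + g" using omI[OF x0] g(2) by blast
  hence "g dvd x0" by simp
  then obtain b0 where b0: "x0 = g * b0" by (elim dvdE)
  define b where "b = b0 mod a"
  have b: "0 \<le> b" "b < a" unfolding b_def using \<open>a > 0\<close> by auto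
  have "g * b = x0 + (- (b0 div a)) * A"
    unfolding b0 a b_def by (simp add: algebra_simps minus_mult_div_eq_mod[symmetric])
  moreover have "el (x0 + (- (b0 div a)) * A) (g + 0) \<in> I"
    using add'[OF x0, of "(- (b0 div a)) * A" 0] A(2) by simp
  ultimately have gb: "el (g * b) g \<in> I" by simp
  \<comment> \<open>The factor \<open>el (b + 1) (-1)\<close> is the conjugate of b + om, so the
    product is g times the norm of b + om, a rational integer in I.\<close>
  have "el (b + 1) (-1) * el (g * b) g \<in> I" using mult gb by simp
  hence "el (g * (b\<^sup>2 + b - m4)) 0 \<in> I"
    unfolding el_mult by (simp add: algebra_simps power2_eq_square)
  hence "g * a dvd g * (b\<^sup>2 + b - m4)" using A(2) a by simp
  hence "a dvd b\<^sup>2 + b - m4" using g(1) by simp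
  hence tr: "(g, a, b) \<in> triples" using g(1) \<open>a > 0\<close> b unfolding triples_def by simp
  have "I = ideal_of (g, a, b)"
  proof (intro equalityI subsetI)
    fix z assume zI: "z \<in> I"
    then obtain s t where z: "z = el s t" using I OK_iff by blast
    hence "g dvd t" using g(2) zI by blast
    then obtain y where y: "t = g * y" by (elim dvdE)
    have "el ((- y) * (g * b)) ((- y) * g) \<in> I" using smul gb by blast
    from add'[OF _ this, of s t] have "el (s - y * g * b) 0 \<in> I" using zI z y by (simp add: mult_ac)
    hence "A dvd s - y * g * b" using A(2) by blast
    then obtain x where "s - y * g * b = g * a * x" unfolding a by (elim dvdE)
    hence "s = g * (x * a + y * b)" by (simp add: algebra_simps)
    thus "z \<in> ideal_of (g, a, b)" unfolding ideal_of_eq z y by blast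
  next
    fix z assume "z \<in> ideal_of (g, a, b)"
    then obtain x y where z: "z = el (g * (x * a + y * b)) (g * y)" unfolding ideal_of_eq by auto
    have "el (g * a * x) 0 \<in> I" using A(2) a by simp
    from add'[OF this smul[OF gb, of y]] show "z \<in> I" unfolding z by (simp add: algebra_simps)
  qed
  thus ?thesis using that tr by blast
qed

text \<open>One-sided divisibilities: applied in both directions they yield g = g' and then a = a'
  by antisymmetry, after which b is pinned down as a residue modulo a.\<close>

lemma ideal_of_inj_aux:
  assumes "(g, a, b) \<in> triples" "(g', a', b') \<in> triples" "ideal_of (g, a, b) = ideal_of (g', a', b')"
  shows "g' dvd g" "g = g' \<Longrightarrow> a' dvd a" "g = g' \<Longrightarrow> a = a' \<Longrightarrow> b = b'"
proof -
  have el1: "el (g * b) g \<in> ideal_of (g', a', b')"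
    unfolding assms(3)[symmetric] unfolding ideal_of_eq
    by (rule CollectI, rule exI[of _ "0::int"], rule exI[of _ "1::int"]) (simp add: el_eq_iff)
  then obtain x y where "el (g * b) g = el (g' * (x * a' + y * b')) (g' * y)"
    unfolding ideal_of_eq by blast
  hence xy: "g * b = g' * (x * a' + y * b')" "g = g' * y" unfolding el_eq_iff by blast+
  show "g' dvd g" using xy(2) by simp
  have "el (g * a) 0 \<in> ideal_of (g', a', b')"
    unfolding assms(3)[symmetric] unfolding ideal_of_eq
    by (rule CollectI, rule exI[of _ "1::int"], rule exI[of _ "0::int"]) (simp add: el_eq_iff)
  then obtain z w where "el (g * a) 0 = el (g' * (z * a' + w * b')) (g' * w)"
    unfolding ideal_of_eq by blast
  hence zw: "g * a = g' * (z * a' + w * b')" "0 = g' * w" unfolding el_eq_iff by blast+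
  have pos: "g > 0" "g' > 0" "a > 0" using assms unfolding triples_def by auto
  show "a' dvd a" if "g = g'" using zw pos that by auto
  show "b = b'" if "g = g'" "a = a'"
  proof -
    have "y = 1" using xy(2) that pos by simp
    hence "b = x * a + b'" using xy(1) that pos by simp
    hence "b mod a = b' mod a" by simp
    thus ?thesis using assms that unfolding triples_def by auto
  qed
qed

lemma bij_ideal_of: "bij_betw ideal_of triples (nonzero_ideals p)"
  unfolding bij_betw_def
proof
  show "inj_on ideal_of triples"
  proof (rule inj_onI)
    fix s t assume st: "s \<in> triples" "t \<in> triples" "ideal_of s = ideal_of t"
    obtain g a b g' a' b' where s: "s = (g, a, b)" and t: "t = (g', a', b')"
      by (metis prod_cases3)
    note A = st[unfolded s t]
    have pos: "g > 0" "g' > 0" "a > 0" "a' > 0" using A unfolding triples_def by auto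
    have g: "g = g'" using ideal_of_inj_aux(1)[OF A] ideal_of_inj_aux(1)[OF A(2,1) A(3)[symmetric]] pos
      by (simp add: zdvd_antisym_nonneg)
    have a: "a = a'" using ideal_of_inj_aux(2)[OF A g] ideal_of_inj_aux(2)[OF A(2,1) A(3)[symmetric] g[symmetric]] pos
      by (simp add: zdvd_antisym_nonneg)
    show "s = t" unfolding s t using g a ideal_of_inj_aux(3)[OF A g a] by simp
  qed
  show "ideal_of ` triples = nonzero_ideals p"
  proof (intro equalityI subsetI)
    show "x \<in> nonzero_ideals p" if "x \<in> ideal_of ` triples" for x
      using that ideal_of_nonzero_ideal by auto
    show "x \<in> ideal_of ` triples" if "x \<in> nonzero_ideals p" for x
      using nonzero_ideal_triple[OF that] by blast
  qed
qed

lemma Nm_ideal_of: assumes "(g, a, b) \<in> triples" shows "Nm (ideal_of (g, a, b)) = of_int (g\<^sup>2 * a)"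
proof -
  have pos: "g > 0" "a > 0" using assms unfolding triples_def by auto
  have e: "of_int g * (of_int b + om) = el (g * b) g" "of_int (g * a) = el (g * a) 0"
    unfolding el_def by (simp_all add: algebra_simps)
  have "det2 (el (g * a) 0) (el (g * b) g) = of_int (g\<^sup>2 * a) * (1 - 2 * om)"
    unfolding det2_def con_el unfolding el_def by (simp add: algebra_simps power2_eq_square)
  also have "1 - 2 * om = - rt" unfolding om_def by (simp add: field_simps)
  finally have "\<bar>det2 (el (g * a) 0) (el (g * b) g)\<bar> = of_int (g\<^sup>2 * a) * rt"
    using pos rt_pos by (simp add: abs_mult)
  thus ?thesis unfolding ideal_of_def prod.case e using Nm_latt[of "el (g * a) 0" "el (g * b) g"] rt_pos by simp
qed

lemma nonzero_ideal_latt: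
  assumes "I \<in> nonzero_ideals p" obtains u v where "u \<in> K" "v \<in> K" "I = latt u v"
proof -
  obtain g a b where "I = ideal_of (g, a, b)" using nonzero_ideal_triple[OF assms] by blast
  thus ?thesis unfolding ideal_of_def by (intro that) (auto intro!: K_mult K_add)
qed

lemma Nm_mult: assumes "I \<in> nonzero_ideals p" "c \<in> K" shows "Nm ((*) c ` I) = \<bar>nrm c\<bar> * Nm I"
proof -
  obtain u v where uv: "u \<in> K" "v \<in> K" "I = latt u v" using nonzero_ideal_latt[OF assms(1)] .
  thus ?thesis unfolding uv(3) latt_mult using assms(2)
    by (simp add: Nm_latt K_mult det2_mult abs_mult)
qed

section \<open>Ideal classes\<close>

lemma K_quotient:
  assumes "z \<in> K" obtains c d where "c \<in> OK" "d \<in> OK" "d \<noteq> 0" "z = c / d" "z \<noteq> 0 \<Longrightarrow> c \<noteq> 0"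
proof -
  obtain x y where z: "x \<in> \<rat>" "y \<in> \<rat>" "z = x + y * rt" using assms by (rule KE)
  obtain x1 x2 where x: "x = of_int x1 / of_int x2" "x2 > (0::int)" using z(1) by (elim Rats_cases') auto
  obtain y1 y2 where y: "y = of_int y1 / of_int y2" "y2 > (0::int)" using z(2) by (elim Rats_cases') auto
  define c where "c = el (x1 * y2 - y1 * x2) (2 * y1 * x2)"
  have "z = c / of_int (x2 * y2)" unfolding c_def el_def om_def z(3) x y using x(2) y(2)
    by (simp add: field_simps)
  thus ?thesis using that[of c "of_int (x2 * y2)"] x(2) y(2) OK_of_int[of "x2 * y2"] unfolding c_def by auto
qed

text \<open>A single multiplier from the field replaces the two integral ones: it can be composed
  and inverted, and \<open>K_quotient\<close> leads back to a quotient of integers.\<close>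

lemma ideal_class_rel_iff: "(I, J) \<in> ideal_class_rel p \<longleftrightarrow>
  I \<in> nonzero_ideals p \<and> J \<in> nonzero_ideals p \<and> (\<exists>c\<in>K - {0}. I = (*) c ` J)"
proof
  assume "(I, J) \<in> ideal_class_rel p"
  then obtain \<alpha> \<beta> where IJ: "I \<in> nonzero_ideals p" "J \<in> nonzero_ideals p"
    "\<alpha> \<in> OK - {0}" "\<beta> \<in> OK - {0}" "(*) \<alpha> ` I = (*) \<beta> ` J"
    unfolding ideal_class_rel_def integer_ring_simps by auto
  have "I = (*) (inverse \<alpha>) ` (*) \<alpha> ` I" using IJ(3) by (simp add: image_image mult.assoc[symmetric])
  also have "\<dots> = (*) (\<beta> / \<alpha>) ` J"
    unfolding IJ(5) image_image by (simp add: divide_inverse mult_ac)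
  finally have "I = (*) (\<beta> / \<alpha>) ` J" .
  moreover have "\<beta> / \<alpha> \<in> K - {0}" using IJ OK_K by (auto intro: K_divide)
  ultimately show "I \<in> nonzero_ideals p \<and> J \<in> nonzero_ideals p \<and> (\<exists>c\<in>K - {0}. I = (*) c ` J)"
    using IJ by blast
next
  assume "I \<in> nonzero_ideals p \<and> J \<in> nonzero_ideals p \<and> (\<exists>c\<in>K - {0}. I = (*) c ` J)"
  then obtain c where IJ: "I \<in> nonzero_ideals p" "J \<in> nonzero_ideals p" "c \<in> K" "c \<noteq> 0" "I = (*) c ` J"
    by blast
  obtain \<beta> \<alpha> where ab: "\<beta> \<in> OK" "\<alpha> \<in> OK" "\<alpha> \<noteq> 0" "c = \<beta> / \<alpha>" "\<beta> \<noteq> 0"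
    using K_quotient[OF IJ(3)] IJ(4) by metis
  have "(*) \<alpha> ` I = (*) \<beta> ` J" unfolding IJ(5) image_image using ab by simp
  thus "(I, J) \<in> ideal_class_rel p"
    unfolding ideal_class_rel_def integer_ring_simps using IJ ab by blast
qed

lemma equiv_ideal_class_rel: "equiv (nonzero_ideals p) (ideal_class_rel p)"
proof (rule equivI)
  show "ideal_class_rel p \<subseteq> nonzero_ideals p \<times> nonzero_ideals p"
    by (auto simp: ideal_class_rel_iff)
  have "1 \<in> K" using K_of_int[of 1] by simp
  thus "refl_on (nonzero_ideals p) (ideal_class_rel p)"
    unfolding refl_on_def ideal_class_rel_iff by (auto intro!: bexI[of _ 1])
  show "sym (ideal_class_rel p)"
  proof (rule symI)
    fix I J assume "(I, J) \<in> ideal_class_rel p"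
    then obtain c where c: "I \<in> nonzero_ideals p" "J \<in> nonzero_ideals p" "c \<in> K - {0}" "I = (*) c ` J"
      unfolding ideal_class_rel_iff by blast
    have "J = (*) (inverse c) ` I" unfolding c(4) image_image using c(3) by (simp add: mult.assoc[symmetric])
    moreover have "inverse c \<in> K - {0}" using c K_inverse by auto
    ultimately show "(J, I) \<in> ideal_class_rel p" using c unfolding ideal_class_rel_iff by blast
  qed
  show "trans (ideal_class_rel p)"
  proof (rule transI)
    fix I J L assume "(I, J) \<in> ideal_class_rel p" "(J, L) \<in> ideal_class_rel p"
    then obtain c d where c: "I \<in> nonzero_ideals p" "c \<in> K - {0}" "I = (*) c ` J"
      and d: "L \<in> nonzero_ideals p" "d \<in> K - {0}" "J = (*) d ` L"
      unfolding ideal_class_rel_iff by blast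
    have "I = (*) (c * d) ` L" unfolding c(3) d(3) image_image by (simp add: mult.assoc)
    moreover have "c * d \<in> K - {0}" using c d K_mult by auto
    ultimately show "(I, L) \<in> ideal_class_rel p" using c d unfolding ideal_class_rel_iff by blast
  qed
qed

lemma ideal_class_primitive_rep:
  assumes "J \<in> nonzero_ideals p"
  obtains a b where "(1, a, b) \<in> triples" "(J, ideal_of (1, a, b)) \<in> ideal_class_rel p"
proof -
  obtain g a b where J: "(g, a, b) \<in> triples" "J = ideal_of (g, a, b)"
    using nonzero_ideal_triple[OF assms] .
  have t: "(1, a, b) \<in> triples" and g: "g > 0" using J(1) unfolding triples_def by auto
  have "of_int g \<in> K - {0}" using g by auto
  hence "(J, ideal_of (1, a, b)) \<in> ideal_class_rel p"
    unfolding ideal_class_rel_iff using assms J(2) ideal_of_mult ideal_of_nonzero_ideal[OF t] by blast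
  thus ?thesis using that t by blast
qed

text \<open>A number stabilising a lattice is a root of the characteristic polynomial of an integer matrix.\<close>
lemma stabiliser_in_OK:
  assumes "u \<in> K" "v \<in> K" "det2 u v \<noteq> 0" "c \<in> K" "(*) c ` latt u v \<subseteq> latt u v"
  shows "c \<in> OK"
proof -
  obtain x y where 1: "c * u = of_int x * u + of_int y * v"
    using latt_basis(1)[of u v] assms(5) unfolding latt_def by blast
  obtain z w where 2: "c * v = of_int z * u + of_int w * v"
    using latt_basis(2)[of v u] assms(5) unfolding latt_def by blast
  have uv: "u \<noteq> 0 \<or> v \<noteq> 0" using assms(3) unfolding det2_def by auto
  have a: "(c - of_int x) * u = of_int y * v" "(c - of_int w) * v = of_int z * u"
    using 1 2 by (simp_all add: algebra_simps)
  have "(c - of_int w) * ((c - of_int x) * u) = of_int y * ((c - of_int w) * v)" unfolding a(1) by simp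
  hence "((c - of_int w) * (c - of_int x) - of_int (y * z)) * u = 0" unfolding a(2) by (simp add: algebra_simps)
  moreover have "(c - of_int x) * ((c - of_int w) * v) = of_int z * ((c - of_int x) * u)" unfolding a(2) by simp
  hence "((c - of_int w) * (c - of_int x) - of_int (y * z)) * v = 0" unfolding a(1) by (simp add: algebra_simps)
  ultimately have root: "(c - of_int w) * (c - of_int x) - of_int (y * z) = 0" using uv by auto
  define q where "q = [:w * x - y * z, - (w + x), 1:]"
  have "poly (map_poly of_int q) c = 0"
    unfolding q_def using root by (simp add: map_poly_pCons algebra_simps)
  moreover have "lead_coeff q = 1" unfolding q_def by simp
  ultimately have "algebraic_int c" using algebraic_int_altdef_ipoly by blast
  thus ?thesis using assms(4) unfolding OK_def K_def integer_ring_def by simp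
qed

text \<open>Integrality comes from \<open>stabiliser_in_OK\<close>; comparing the norms of J and c J
  then gives |nrm c| = 1.\<close>

lemma stabiliser_unit:
  assumes "J \<in> nonzero_ideals p" "c \<in> K" "c \<noteq> 0" "(*) c ` J = J"
  shows "c \<in> Units (integer_ring p)"
proof -
  obtain g a b where J: "(g, a, b) \<in> triples" "J = ideal_of (g, a, b)"
    using nonzero_ideal_triple[OF assms(1)] .
  define u where "u = real_of_int (g * a)"
  define v where "v = of_int g * (of_int b + om)"
  have uv: "u \<in> K" "v \<in> K" unfolding u_def v_def by (auto intro!: K_mult K_add simp del: of_int_mult)
  have Juv: "J = latt u v" unfolding J ideal_of_def u_def v_def by simp
  have "\<bar>det2 u v\<bar> / rt = of_int (g\<^sup>2 * a)"
    using Nm_ideal_of[OF J(1)] Nm_latt[OF uv] Juv J(2) by simp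
  hence d: "det2 u v \<noteq> 0" using J(1) unfolding triples_def by auto
  have c1: "c \<in> OK" using stabiliser_in_OK[OF uv d assms(2)] assms(4) Juv by simp
  have "Nm J = \<bar>nrm c\<bar> * Nm J" using Nm_mult[OF assms(1,2)] assms(4) by simp
  moreover have "Nm J > 0" using Nm_ideal_of[OF J(1)] J unfolding triples_def by simp
  ultimately show ?thesis using c1 unfolding Units_iff by simp
qed

lemma unit_stabilises:
  assumes "J \<in> nonzero_ideals p" "u \<in> Units (integer_ring p)"
  shows "(*) u ` J = J"
proof -
  have J: "c * x \<in> J" if "c \<in> OK" "x \<in> J" for c x
    using assms(1) that unfolding nonzero_ideals_def ideal_iff by blast
  have u: "u \<in> OK" "inverse u \<in> OK" "u \<noteq> 0"
    using unit_group[OF assms(2)] assms(2) unfolding Units_iff by auto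
  show ?thesis
  proof (intro equalityI subsetI)
    show "x \<in> J" if "x \<in> (*) u ` J" for x using that J u by blast
    show "x \<in> (*) u ` J" if "x \<in> J" for x
      using J[OF u(2) that] u(3) by (intro image_eqI[of _ _ "inverse u * x"]) auto
  qed
qed

lemma eps: "eps \<in> Units (integer_ring p)" "eps > 1"
  "\<And>u. u \<in> Units (integer_ring p) \<Longrightarrow> \<exists>n::int. u = eps powi n \<or> u = - (eps powi n)"
  using fundamental_unit unfolding eps_def by auto

text \<open>The unit \<open>\<epsilon>\<close> multiplies \<open>z / con z\<close> by \<open>\<epsilon>\<^sup>2\<close> up to sign.\<close>
lemma ex1_unit_multiple:
  assumes "z \<in> K" "z \<noteq> 0"
  shows "\<exists>u\<in>Units (integer_ring p). u * z > 0 \<and> \<bar>con (u * z)\<bar> \<le> u * z \<and> u * z < eps\<^sup>2 * \<bar>con (u * z)\<bar>"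
proof -
  define r where "r = ln (\<bar>z\<bar> / \<bar>con z\<bar>)"
  have le: "ln eps > 0" using eps(2) by simp
  \<comment> \<open>Multiplication by the n-th power of \<open>eps\<close> adds 2 n ln eps to r, and
    this n moves r into [0, 2 ln eps). The sign s below makes the product positive.\<close>
  define n where "n = - \<lfloor>r / (2 * ln eps)\<rfloor>"
  have "- of_int n \<le> r / (2 * ln eps)" "r / (2 * ln eps) < - of_int n + 1" unfolding n_def by linarith+
  hence r: "0 \<le> r + 2 * of_int n * ln eps" "r + 2 * of_int n * ln eps < 2 * ln eps"
    using le by (simp_all add: field_simps)
  define s :: real where "s = (if z > 0 then 1 else -1)"
  define u where "u = s * eps powi n"
  have pos: "eps powi n > 0" using eps(2) by (intro zero_less_power_int) auto
  have uU: "u \<in> Units (integer_ring p)"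
    unfolding u_def s_def using unit_group(5)[OF eps(1), of n] unit_group(2) by auto
  have uK: "u \<in> K" "\<bar>nrm u\<bar> = 1" using uU OK_K unfolding Units_iff by auto
  have c: "con (u * z) = con u * con z" using uK assms K_mult by simp
  have cz: "con z \<noteq> 0" using assms by simp
  have au: "\<bar>u\<bar> = eps powi n" unfolding u_def s_def using pos by simp
  have acu: "\<bar>con u\<bar> = inverse (eps powi n)"
    using uK(2) au unfolding nrm_def abs_mult by (intro inverse_unique[symmetric]) simp
  have lnp: "ln (eps powi n) = of_int n * ln eps"
    using eps(2) powr_real_of_int'[of eps n] ln_powr[of eps "of_int n"] by simp
  have uz: "u * z > 0" using pos assms(2) unfolding u_def s_def by (auto simp: mult_neg_neg zero_less_mult_iff)
  have uz': "u * z = eps powi n * \<bar>z\<bar>" using uz au by (metis abs_mult abs_of_pos)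
  have cc: "\<bar>con (u * z)\<bar> = inverse (eps powi n) * \<bar>con z\<bar>" unfolding c abs_mult acu ..
  have "ln ((u * z) / \<bar>con (u * z)\<bar>) = ln (\<bar>z\<bar> / \<bar>con z\<bar> * (eps powi n * eps powi n))"
    unfolding cc unfolding uz' using pos by (simp add: field_simps)
  also have "\<dots> = r + 2 * of_int n * ln eps"
  proof -
    have "ln (\<bar>z\<bar> / \<bar>con z\<bar> * (eps powi n * eps powi n)) = r + ln (eps powi n * eps powi n)"
      unfolding r_def using pos assms(2) cz by (intro ln_mult_pos) auto
    also have "ln (eps powi n * eps powi n) = ln (eps powi n) + ln (eps powi n)"
      using pos by (intro ln_mult_pos)
    finally show ?thesis by (simp only: lnp)
  qed
  finally have L: "ln ((u * z) / \<bar>con (u * z)\<bar>) = r + 2 * of_int n * ln eps" .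
  have cuz: "\<bar>con (u * z)\<bar> > 0" unfolding cc using pos cz by simp
  have "ln ((u * z) / \<bar>con (u * z)\<bar>) \<ge> 0" using L r by simp
  hence "(u * z) / \<bar>con (u * z)\<bar> \<ge> 1" using uz cuz by (subst (asm) ln_ge_zero_iff) auto
  moreover have "ln ((u * z) / \<bar>con (u * z)\<bar>) < ln (eps\<^sup>2)" using L r eps(2) by (simp add: ln_realpow)
  hence "(u * z) / \<bar>con (u * z)\<bar> < eps\<^sup>2" using uz cuz eps(2) by (subst (asm) ln_less_cancel_iff) auto
  ultimately show ?thesis using uU uz cuz by (intro bexI[of _ u]) (auto simp: field_simps)
qed

text \<open>Passing from z to u z multiplies z / |con z| by u^2. Both quotients lie in [1, eps^2),
  so 1 / eps < u < eps, and the only power of \<open>eps\<close> in that range is 1.\<close>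

lemma unit_multiple_unique:
  assumes "z \<in> K" "z > 0" "\<bar>con z\<bar> \<le> z" "z < eps\<^sup>2 * \<bar>con z\<bar>"
    and "u \<in> Units (integer_ring p)" "u * z > 0"
    and "\<bar>con (u * z)\<bar> \<le> u * z" "u * z < eps\<^sup>2 * \<bar>con (u * z)\<bar>"
  shows "u = 1"
proof -
  have u0: "u > 0" using assms(2,6) by (simp add: zero_less_mult_iff)
  obtain n :: int where "u = eps powi n \<or> u = - (eps powi n)" using eps(3)[OF assms(5)] by blast
  moreover have pos: "eps powi k > 0" for k using eps(2) by (intro zero_less_power_int) auto
  ultimately have un: "u = eps powi n" using u0 pos[of n] by auto
  have uK: "u \<in> K" "\<bar>nrm u\<bar> = 1" using assms(5) OK_K unfolding Units_iff by auto
  have acu: "\<bar>con u\<bar> = inverse u"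
    using uK(2) u0 unfolding nrm_def abs_mult by (intro inverse_unique[symmetric]) simp
  have c: "\<bar>con (u * z)\<bar> = \<bar>con z\<bar> / u" using uK assms(1) K_mult acu by (simp add: abs_mult divide_inverse)
  have cz: "\<bar>con z\<bar> > 0" using assms(1,2) by simp
  have "u * z < eps\<^sup>2 * (z / u)" using assms(8,3) c u0 eps(2)
    by (smt (verit, best) divide_right_mono mult_left_mono zero_le_power2)
  hence "u\<^sup>2 < eps\<^sup>2" using u0 assms(2) by (simp add: field_simps power2_eq_square)
  hence "u < eps" using eps(2) by (intro power_less_imp_less_base[of u 2 eps]) auto
  have "\<bar>con z\<bar> / u \<le> u * z" using assms(7) c by simp
  also have "\<dots> < u * (eps\<^sup>2 * \<bar>con z\<bar>)" using assms(4) u0 by (intro mult_strict_left_mono)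
  finally have "\<bar>con z\<bar> < \<bar>con z\<bar> * (u * eps)\<^sup>2" using u0 by (simp add: field_simps power2_eq_square)
  hence "1 < (u * eps)\<^sup>2" using cz by simp
  hence ue: "1 < u * eps" using u0 eps(2) by (metis abs_of_pos abs_square_le_1 linorder_not_le mult_pos_pos order_less_trans zero_less_one)
  have "n < 1"
  proof (rule ccontr)
    assume "\<not> n < 1"
    hence "eps powi 1 \<le> eps powi n" using eps(2) by (intro power_int_increasing) auto
    thus False using un \<open>u < eps\<close> by simp
  qed
  moreover have "n > -1"
  proof (rule ccontr)
    assume "\<not> n > -1"
    hence "eps powi n \<le> eps powi (-1)" using eps(2) by (intro power_int_increasing) auto
    hence "u * eps \<le> inverse eps * eps" using un eps(2) by (intro mult_right_mono) (auto simp: power_int_minus)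
    thus False using ue eps(2) by simp
  qed
  ultimately have "n = 0" by simp
  thus ?thesis using un by simp
qed

text \<open>For \<open>J = \<int>a + \<int>(b + \<omega>)\<close>, the inverse ideal is \<open>(1/a) (\<int>a + \<int>(\<omega> - b - 1))\<close>; the ideals in the
  class of \<open>J\<close> are the multiples \<open>(\<delta>/a) J\<close> with \<open>\<delta>\<close> in the second factor, and \<open>\<delta>\<close> is unique up to units.\<close>
lemma bij_ideal_class:
  assumes "(1, a, b) \<in> triples"
  defines "J \<equiv> ideal_of (1, a, b)"
  defines "f \<equiv> \<lambda>(x, y). of_int x * of_int a + of_int y * (om - of_int b - 1)"
  defines "D \<equiv> {(x, y). 0 < f (x, y) \<and> \<bar>con (f (x, y))\<bar> \<le> f (x, y) \<and> f (x, y) < eps\<^sup>2 * \<bar>con (f (x, y))\<bar>}"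
  shows "bij_betw (\<lambda>xy. (*) (f xy / of_int a) ` J) D {I. (I, J) \<in> ideal_class_rel p}"
    "xy \<in> D \<Longrightarrow> Nm ((*) (f xy / of_int a) ` J) = \<bar>f xy * con (f xy)\<bar> / of_int a"
proof -
  have a: "a > 0" and dvd: "a dvd b\<^sup>2 + b - m4" using assms(1) unfolding triples_def by auto
  obtain n where n: "b\<^sup>2 + b - m4 = a * n" using dvd by (elim dvdE)
  have J: "J \<in> nonzero_ideals p" unfolding J_def by (rule ideal_of_nonzero_ideal[OF assms(1)])
  have JOK: "J \<subseteq> OK" and J0: "0 \<in> J" and Jmult: "\<And>c x. c \<in> OK \<Longrightarrow> x \<in> J \<Longrightarrow> c * x \<in> J"
    and Jadd: "\<And>x y. x \<in> J \<Longrightarrow> y \<in> J \<Longrightarrow> x + y \<in> J"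
    using J unfolding nonzero_ideals_def ideal_iff by blast+
  have f_el: "f (x, y) = el (x * a - y * (b + 1)) y" for x y unfolding f_def el_def by (simp add: algebra_simps)
  have fK: "f xy \<in> K" for xy using f_el[of "fst xy" "snd xy"] by simp
  have inj_f: "xy = xy'" if "f xy = f xy'" for xy xy'
    using that f_el[of "fst xy" "snd xy"] f_el[of "fst xy'" "snd xy'"] a
    by (auto simp: el_eq_iff prod_eq_iff)
  have J_el: "z \<in> J \<longleftrightarrow> (\<exists>s t. z = el (s * a + t * b) t)" for z
    unfolding J_def ideal_of_eq by auto
  \<comment> \<open>The two second basis elements multiply to (b + om) (om - b - 1) = m4 - b^2 - b =
    - a n, so a divides both coordinates of the product.\<close>
  have prod_OK: "f xy / of_int a * z \<in> OK" if zJ: "z \<in> J" for xy z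
  proof -
    obtain x y where xy: "xy = (x, y)" by fastforce
    obtain s t where z: "z = el (s * a + t * b) t" using zJ J_el by blast
    have m: "m4 = b\<^sup>2 + b - a * n" using n by simp
    have "f xy * z = of_int a * el (s * (x * a - y * (b + 1)) + x * t * b - y * t * n) (x * t + y * s)"
    proof -
      have "of_int a = el a 0" by (simp add: el_def)
      thus ?thesis unfolding xy f_el z el_mult
        by (simp add: el_mult el_eq_iff m algebra_simps power2_eq_square)
    qed
    thus ?thesis using a by simp
  qed
  have ideal: "(*) (f xy / of_int a) ` J \<in> nonzero_ideals p" if "f xy \<noteq> 0" for xy
  proof -
    have c0: "f xy / of_int a \<noteq> 0" using that a by simp
    have "ideal ((*) (f xy / of_int a) ` J) (integer_ring p)"
      unfolding ideal_iff
    proof (intro conjI ballI)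
      show "(*) (f xy / of_int a) ` J \<subseteq> OK" using prod_OK by blast
      show "0 \<in> (*) (f xy / of_int a) ` J" using J0 by (intro image_eqI[of _ _ 0]) auto
      show "s + t \<in> (*) (f xy / of_int a) ` J"
        if "s \<in> (*) (f xy / of_int a) ` J" "t \<in> (*) (f xy / of_int a) ` J" for s t
        using that Jadd by (auto simp: distrib_left[symmetric] simp del: times_divide_eq_left)
      show "c * t \<in> (*) (f xy / of_int a) ` J" if "c \<in> OK" "t \<in> (*) (f xy / of_int a) ` J" for c t
        using that Jmult by (auto simp: mult.left_commute[of c] simp del: times_divide_eq_left)
    qed
    moreover have "of_int a \<in> J" unfolding J_def ideal_of_def prod.case using latt_basis(1) by simp
    hence "f xy / of_int a * of_int a \<in> (*) (f xy / of_int a) ` J" by blast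
    hence "(*) (f xy / of_int a) ` J \<noteq> {0}" using that a by auto
    ultimately show ?thesis unfolding nonzero_ideals_def by blast
  qed
  \<comment> \<open>Testing c on the generators a and b + om of J: c a = x + y om is integral, and
    the om-coordinate of a c (b + om) gives x + y (b + 1) = a t. So c a lies in the lattice
    parametrised by f.\<close>
  have surj: "\<exists>xy. c = f xy / of_int a" if cK: "c \<in> K" and c: "(*) c ` J \<subseteq> OK" for c
  proof -
    have "of_int a \<in> J" unfolding J_def ideal_of_def prod.case using latt_basis(1) by simp
    hence "c * of_int a \<in> OK" using c by blast
    then obtain x y where xy: "c * of_int a = el x y" unfolding OK_iff by blast
    have "el b 1 \<in> J" unfolding J_el by (intro exI[of _ 0] exI[of _ 1]) simp
    hence "c * el b 1 \<in> OK" using c by blast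
    then obtain s t where st: "c * el b 1 = el s t" unfolding OK_iff by blast
    have "el x y * el b 1 = el a 0 * el s t"
      unfolding xy[symmetric] st[symmetric] by (simp add: el_def)
    hence "x + y * b + y = a * t" unfolding el_mult el_eq_iff by simp
    hence "t * a - y * (b + 1) = x" by (simp add: algebra_simps)
    hence "f (t, y) = c * of_int a" unfolding f_el xy by (simp only:)
    hence "c = f (t, y) / of_int a" using a by simp
    thus ?thesis by blast
  qed
  show "bij_betw (\<lambda>xy. (*) (f xy / of_int a) ` J) D {I. (I, J) \<in> ideal_class_rel p}"
    unfolding bij_betw_def
  proof
    show "inj_on (\<lambda>xy. (*) (f xy / of_int a) ` J) D"
    proof (rule inj_onI)
      fix s t assume st: "s \<in> D" "t \<in> D" "(*) (f s / of_int a) ` J = (*) (f t / of_int a) ` J"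
      have s0: "f s > 0" "f t > 0" using st unfolding D_def by auto
      \<comment> \<open>Equal images make the quotient u stabilise J, so u is a unit relating two
        points of the same fundamental domain.\<close>
      define u where "u = f t / f s"
      have us: "u * f s = f t" unfolding u_def using s0 by simp
      have uK: "u \<in> K" unfolding u_def by (intro K_divide fK)
      have "(*) u ` J = (*) (of_int a / f s) ` (*) (f t / of_int a) ` J"
        unfolding image_image u_def using a by (simp add: field_simps)
      also have "\<dots> = J" unfolding st(3)[symmetric] image_image using a s0 by simp
      finally have "u \<in> Units (integer_ring p)" using stabiliser_unit[OF J uK] s0 unfolding u_def by simp
      hence "u = 1" using unit_multiple_unique[of "f s" u] st(1,2) fK us unfolding D_def by auto
      thus "s = t" using us inj_f by simp
    qed
    show "(\<lambda>xy. (*) (f xy / of_int a) ` J) ` D = {I. (I, J) \<in> ideal_class_rel p}"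
    proof (intro equalityI subsetI)
      fix I assume "I \<in> (\<lambda>xy. (*) (f xy / of_int a) ` J) ` D"
      then obtain xy where xy: "xy \<in> D" "I = (*) (f xy / of_int a) ` J" by blast
      have "f xy \<noteq> 0" using xy unfolding D_def by auto
      moreover have "f xy / of_int a \<in> K - {0}"
        using \<open>f xy \<noteq> 0\<close> a K_divide(1)[OF fK K_of_int] by simp
      ultimately show "I \<in> {I. (I, J) \<in> ideal_class_rel p}"
        using ideal J xy unfolding ideal_class_rel_iff by blast
    next
      fix I assume "I \<in> {I. (I, J) \<in> ideal_class_rel p}"
      then obtain c where I: "I \<in> nonzero_ideals p" and c: "c \<in> K" "c \<noteq> 0" "I = (*) c ` J"
        unfolding ideal_class_rel_iff by blast
      have "c * of_int a \<in> K" "c * of_int a \<noteq> 0" using c a by (auto intro: K_mult)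
      then obtain u where u: "u \<in> Units (integer_ring p)" "u * (c * of_int a) > 0"
        "\<bar>con (u * (c * of_int a))\<bar> \<le> u * (c * of_int a)" "u * (c * of_int a) < eps\<^sup>2 * \<bar>con (u * (c * of_int a))\<bar>"
        using ex1_unit_multiple by blast
      have uI: "(*) (u * c) ` J = I"
      proof -
        have "(*) (u * c) ` J = (*) u ` I" unfolding c(3) image_image by (simp add: mult.assoc)
        thus ?thesis using unit_stabilises[OF I u(1)] by simp
      qed
      have "I \<subseteq> OK" using I unfolding nonzero_ideals_def ideal_iff by blast
      moreover have "u * c \<in> K" using u(1) OK_K c unfolding Units_iff by (auto intro: K_mult)
      ultimately obtain xy where xy: "u * c = f xy / of_int a" using surj[of "u * c"] uI by auto
      hence fxy: "f xy = u * (c * of_int a)" using a by (simp add: field_simps)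
      have "xy \<in> D" using u(2-4) unfolding D_def fxy[symmetric] by (cases xy) simp
      thus "I \<in> (\<lambda>xy. (*) (f xy / of_int a) ` J) ` D" using uI xy by (intro image_eqI[of _ _ xy]) auto
    qed
  qed
  assume "xy \<in> D"
  have "Nm ((*) (f xy / of_int a) ` J) = \<bar>nrm (f xy / of_int a)\<bar> * Nm J"
    by (rule Nm_mult[OF J]) (intro K_divide fK K_of_int)
  also have "Nm J = of_int a" unfolding J_def Nm_ideal_of[OF assms(1)] by simp
  also have "nrm (f xy / of_int a) = (f xy * con (f xy)) / (of_int a)\<^sup>2"
    unfolding nrm_def using K_divide(2)[OF fK K_of_int, of xy a] by (simp add: power2_eq_square)
  also have "\<bar>(f xy * con (f xy)) / (of_int a)\<^sup>2\<bar> * of_int a = \<bar>f xy * con (f xy)\<bar> / of_int a"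
    using a by (simp add: abs_mult power2_eq_square field_simps)
  finally show "Nm ((*) (f xy / of_int a) ` J) = \<bar>f xy * con (f xy)\<bar> / of_int a" .
qed

end

section \<open>The number of ideals of given norm\<close>

lemma prime_power_mult_dvd_iff:
  fixes q h m :: nat
  assumes "prime q" "\<not> q dvd h" "\<not> q dvd m"
  shows "q ^ i * h dvd q ^ k * m \<longleftrightarrow> i \<le> k \<and> h dvd m"
proof
  assume d: "q ^ i * h dvd q ^ k * m"
  have "coprime (q ^ i) m" "coprime h (q ^ k)"
    using assms by (metis coprime_commute coprime_power_left_iff prime_imp_coprime)+
  moreover have "q ^ i dvd q ^ k * m" "h dvd q ^ k * m" using d by (auto dest: dvd_mult_left dvd_mult_right)
  ultimately have "q ^ i dvd q ^ k" "h dvd m"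
    by (simp_all add: coprime_dvd_mult_left_iff coprime_dvd_mult_right_iff)
  thus "i \<le> k \<and> h dvd m" using power_dvd_imp_le prime_gt_1_nat assms(1) by blast
qed (auto intro: mult_dvd_mono le_imp_power_dvd)

lemma prime_power_decomp:
  fixes q n :: nat
  assumes "prime q" "n > 0" obtains j h where "n = q ^ j * h" "\<not> q dvd h"
proof -
  have "\<not> is_unit q" using assms(1) by (metis not_prime_unit)
  moreover have "n \<noteq> 0" using assms(2) by simp
  ultimately show ?thesis using multiplicity_decompose'[of n q] that by metis
qed

lemma prime_power_mult_inj:
  fixes q h h' :: nat
  assumes "prime q" "\<not> q dvd h" "\<not> q dvd h'" "q ^ j * h = q ^ j' * h'"
  shows "j = j' \<and> h = h'"
proof -
  have "q ^ j * h dvd q ^ j' * h'" "q ^ j' * h' dvd q ^ j * h" using assms(4) by auto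
  thus ?thesis using prime_power_mult_dvd_iff assms(1-3) by (metis dvd_antisym le_antisym)
qed

text \<open>Splitting off one prime, simultaneously for the two sums that are compared later: i = 1
  for sums over divisors, i = 2 for sums over g with g^2 dividing n.\<close>

lemma bij_betw_prime_power_divisors:
  fixes q m :: nat
  assumes "prime q" "\<not> q dvd m" and i: "i \<ge> 1"
  shows "bij_betw (\<lambda>(j, h). q ^ j * h) ({j. i * j \<le> k} \<times> {h. h ^ i dvd m}) {g. g ^ i dvd q ^ k * m}"
  unfolding bij_betw_def
proof
  have m0: "m > 0" using assms by (cases "m = 0") auto
  have nd: "\<not> q dvd h" if "h ^ i dvd m" for h
    using that assms(2) i by (meson dvd_power dvd_trans less_le_trans zero_less_one)
  have eq: "(q ^ j * h) ^ i = q ^ (i * j) * h ^ i" for j h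
    by (simp add: power_mult_distrib power_mult[symmetric] mult.commute)
  have ndp: "\<not> q dvd h ^ i" if "\<not> q dvd h" for h using that assms(1) prime_dvd_power by blast
  show "inj_on (\<lambda>(j, h). q ^ j * h) ({j. i * j \<le> k} \<times> {h. h ^ i dvd m})"
  proof (rule inj_onI)
    fix s t assume A: "s \<in> {j. i * j \<le> k} \<times> {h. h ^ i dvd m}" "t \<in> {j. i * j \<le> k} \<times> {h. h ^ i dvd m}"
      "(case s of (j, h) \<Rightarrow> q ^ j * h) = (case t of (j, h) \<Rightarrow> q ^ j * h)"
    obtain j h j' h' where st: "s = (j, h)" "t = (j', h')" by fastforce
    show "s = t" using prime_power_mult_inj[OF assms(1), of h h' j j'] A nd unfolding st by auto
  qed
  show "(\<lambda>(j, h). q ^ j * h) ` ({j. i * j \<le> k} \<times> {h. h ^ i dvd m}) = {g. g ^ i dvd q ^ k * m}"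
  proof (intro equalityI subsetI)
    fix g assume "g \<in> (\<lambda>(j, h). q ^ j * h) ` ({j. i * j \<le> k} \<times> {h. h ^ i dvd m})"
    then obtain j h where jh: "g = q ^ j * h" "i * j \<le> k" "h ^ i dvd m" by auto
    have "q ^ (i * j) * h ^ i dvd q ^ k * m" using jh by (intro mult_dvd_mono le_imp_power_dvd)
    thus "g \<in> {g. g ^ i dvd q ^ k * m}" unfolding jh(1) by (simp only: eq mem_Collect_eq)
  next
    fix g assume g: "g \<in> {g. g ^ i dvd q ^ k * m}"
    have "q > 0" using assms(1) prime_gt_0_nat by blast
    have "g > 0" using g m0 i \<open>q > 0\<close> by (cases "g = 0") (auto simp: power_0_left)
    then obtain j h where jh: "g = q ^ j * h" "\<not> q dvd h" using prime_power_decomp[OF assms(1)] by blast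
    have "q ^ (i * j) * h ^ i dvd q ^ k * m" using g unfolding jh(1) by (simp only: eq mem_Collect_eq)
    hence "i * j \<le> k \<and> h ^ i dvd m" using prime_power_mult_dvd_iff[OF assms(1) ndp[OF jh(2)] assms(2)] by blast
    thus "g \<in> (\<lambda>(j, h). q ^ j * h) ` ({j. i * j \<le> k} \<times> {h. h ^ i dvd m})"
      unfolding jh(1) by (intro image_eqI[of _ _ "(j, h)"]) auto
  qed
qed

section \<open>Roots of x^2 + x - m4 modulo n, and ideals of norm n\<close>

context prime_one_mod_four
begin

text \<open>The norm of x + om, a polynomial of discriminant p.\<close>

definition fq :: "int \<Rightarrow> int" where "fq x = x\<^sup>2 + x - m4"

definition roots :: "nat \<Rightarrow> int set" where "roots a = {x \<in> {0..<int a}. int a dvd fq x}"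

text \<open>Counts the triples (1, a, b), i.e. the ideals of norm a that have no rational integer
  factor g > 1.\<close>

definition rho :: "nat \<Rightarrow> nat" where "rho a = card (roots a)"

lemma finite_roots [simp]: "finite (roots a)"
  unfolding roots_def by (rule finite_subset[of _ "{0..<int a}"]) auto

lemma fq_diff: "fq x - fq y = (x - y) * (x + y + 1)"
  unfolding fq_def by (simp add: algebra_simps power2_eq_square)

lemma fq_sq: "(2 * x + 1)\<^sup>2 = 4 * fq x + int p"
  unfolding fq_def p_m4(2) by (simp add: algebra_simps power2_eq_square)

lemma fq_cong: "[x = y] (mod n) \<Longrightarrow> [fq x = fq y] (mod n)"
  unfolding fq_def by (intro cong_add cong_diff cong_pow cong_refl)

lemma dvd_fq_mod: "n dvd a \<Longrightarrow> n dvd fq (x mod a) \<longleftrightarrow> n dvd fq x"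
proof -
  assume "n dvd a"
  hence "[x mod a = x] (mod n)" by (metis cong_dvd_modulus cong_mod_left cong_refl)
  thus ?thesis by (intro cong_dvd_iff fq_cong)
qed

text \<open>The Chinese remainder theorem combines a root modulo a with a root modulo b.\<close>

lemma rho_mult:
  assumes "coprime a b" "a > 0" "b > 0" shows "rho (a * b) = rho a * rho b"
proof -
  have cop: "coprime (int a) (int b)" using assms by simp
  have "bij_betw (\<lambda>x. (x mod int a, x mod int b)) (roots (a * b)) (roots a \<times> roots b)"
    unfolding bij_betw_def
  proof
    show "inj_on (\<lambda>x. (x mod int a, x mod int b)) (roots (a * b))"
    proof (rule inj_onI)
      fix x y assume xy: "x \<in> roots (a * b)" "y \<in> roots (a * b)"
        "(x mod int a, x mod int b) = (y mod int a, y mod int b)"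
      hence "[x = y] (mod int a)" "[x = y] (mod int b)" by (auto simp: icong_def)
      hence "[x = y] (mod int a * int b)" using cop coprime_cong_mult by blast
      thus "x = y" using xy unfolding roots_def by (auto simp: icong_def)
    qed
    show "(\<lambda>x. (x mod int a, x mod int b)) ` roots (a * b) = roots a \<times> roots b"
    proof (intro equalityI subsetI)
      fix z assume "z \<in> (\<lambda>x. (x mod int a, x mod int b)) ` roots (a * b)"
      then obtain x where x: "int a * int b dvd fq x" "z = (x mod int a, x mod int b)"
        unfolding roots_def by auto
      have "int a dvd fq x" "int b dvd fq x" using x(1) by (auto dest: dvd_mult_left dvd_mult_right)
      thus "z \<in> roots a \<times> roots b" using x(2) assms unfolding roots_def by (auto simp: dvd_fq_mod)
    next
      fix z assume "z \<in> roots a \<times> roots b"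
      then obtain u v where z: "z = (u, v)" "u \<in> roots a" "v \<in> roots b" by auto
      obtain x where x: "[x = u] (mod int a)" "[x = v] (mod int b)"
        using binary_chinese_remainder_int[OF cop] by blast
      define y where "y = x mod int (a * b)"
      have yu: "[y = u] (mod int a)" "[y = v] (mod int b)"
        using x unfolding y_def by (simp_all add: icong_def mod_mod_cancel)
      have "int a dvd fq y" "int b dvd fq y"
        using z yu fq_cong cong_dvd_iff unfolding roots_def by blast+
      hence "int (a * b) dvd fq y" unfolding of_nat_mult using cop by (intro divides_mult)
      moreover have "0 \<le> y" "y < int (a * b)" using assms unfolding y_def by simp_all
      ultimately have "y \<in> roots (a * b)" unfolding roots_def by simp
      moreover have "(y mod int a, y mod int b) = z" using z yu unfolding roots_def by (auto simp: icong_def)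
      ultimately show "z \<in> (\<lambda>x. (x mod int a, x mod int b)) ` roots (a * b)" by blast
    qed
  qed
  hence "card (roots (a * b)) = card (roots a \<times> roots b)" by (rule bij_betw_same_card)
  thus ?thesis unfolding rho_def by (simp add: card_cartesian_product)
qed

text \<open>2x + 1 is the derivative of \<open>fq\<close>, and its square is congruent to the
  discriminant p modulo 4 fq x.\<close>

lemma derivative_unit:
  assumes "prime q" "q \<noteq> p" "int q dvd fq x" shows "\<not> int q dvd 2 * x + 1"
proof
  assume "int q dvd 2 * x + 1"
  hence "int q dvd (2 * x + 1)\<^sup>2" unfolding power2_eq_square by (rule dvd_mult)
  hence "int q dvd int p" unfolding fq_sq using assms(3) by (simp add: dvd_add_right_iff)
  hence "q dvd p" by simp
  thus False using assms(1,2) prime_p primes_dvd_imp_eq by blast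
qed

text \<open>Hensel lifting: all roots of \<open>x\<^sup>2 + x - m4\<close> modulo \<open>q \<noteq> p\<close> are simple.\<close>
lemma rho_prime_power_Suc:
  assumes q: "prime q" "q \<noteq> p" and k: "k \<ge> 1"
  shows "rho (q ^ Suc k) = rho (q ^ k)"
proof -
  define Q where "Q = int q"
  have Q: "Q > 1" "prime Q" unfolding Q_def using q prime_gt_1_nat by auto
  have pow: "Q ^ j > 0" for j using Q by simp
  have QS: "int (q ^ j) = Q ^ j" for j unfolding Q_def by simp
  have Qk: "Q dvd Q ^ k" using k by (simp add: dvd_power)
  have "bij_betw (\<lambda>x. x mod Q ^ k) (roots (q ^ Suc k)) (roots (q ^ k))"
    unfolding bij_betw_def
  proof
    show "inj_on (\<lambda>x. x mod Q ^ k) (roots (q ^ Suc k))"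
    proof (rule inj_onI)
      fix x y assume x: "x \<in> roots (q ^ Suc k)" and y: "y \<in> roots (q ^ Suc k)"
        and xy: "x mod Q ^ k = y mod Q ^ k"
      have fx: "Q ^ Suc k dvd fq x" "Q ^ Suc k dvd fq y" using x y unfolding roots_def QS by auto
      have "Q dvd fq x" using fx(1) by (metis dvd_mult_left power_Suc)
      hence nd: "\<not> Q dvd 2 * x + 1" using derivative_unit[OF q] unfolding Q_def by blast
      have "Q ^ k dvd x - y" using xy by (simp add: mod_eq_dvd_iff)
      hence "Q dvd x - y" using Qk dvd_trans by blast
      \<comment> \<open>Since x = y modulo Q, this factor is congruent to the derivative 2x + 1. The
        factorisation in \<open>fq_diff\<close> then puts the whole power of Q into x - y.\<close>
      have "\<not> Q dvd x + y + 1"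
      proof
        assume "Q dvd x + y + 1"
        hence "Q dvd (x + y + 1) + (x - y)" using \<open>Q dvd x - y\<close> by (rule dvd_add)
        thus False using nd by (simp add: algebra_simps)
      qed
      hence "coprime (Q ^ Suc k) (x + y + 1)" using Q(2)
        by (metis coprime_power_left_iff prime_imp_coprime)
      moreover have "Q ^ Suc k dvd (x - y) * (x + y + 1)"
        unfolding fq_diff[symmetric] using fx by (rule dvd_diff)
      ultimately have "Q ^ Suc k dvd x - y" by (simp add: coprime_dvd_mult_left_iff)
      hence "x mod Q ^ Suc k = y mod Q ^ Suc k" by (simp add: mod_eq_dvd_iff)
      thus "x = y" using x y unfolding roots_def QS by auto
    qed
    show "(\<lambda>x. x mod Q ^ k) ` roots (q ^ Suc k) = roots (q ^ k)"
    proof (intro equalityI subsetI)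
      fix z assume "z \<in> (\<lambda>x. x mod Q ^ k) ` roots (q ^ Suc k)"
      then obtain x where x: "Q ^ Suc k dvd fq x" "z = x mod Q ^ k" unfolding roots_def QS by auto
      have "Q ^ k dvd fq x" using x(1) by (metis dvd_mult_right power_Suc)
      thus "z \<in> roots (q ^ k)" unfolding x(2) roots_def QS using pow by (auto simp: dvd_fq_mod)
    next
      fix y assume "y \<in> roots (q ^ k)"
      hence y: "0 \<le> y" "y < Q ^ k" "Q ^ k dvd fq y" unfolding roots_def QS by auto
      obtain c where c: "fq y = Q ^ k * c" using y(3) by (elim dvdE)
      have "Q dvd fq y" using y(3) Qk dvd_trans by blast
      hence "\<not> Q dvd 2 * y + 1" using derivative_unit[OF q] unfolding Q_def by blast
      hence "coprime (2 * y + 1) Q" using Q(2) by (metis coprime_commute prime_imp_coprime)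
      then obtain i where i: "[(2 * y + 1) * i = 1] (mod Q)" using cong_solve_coprime_int by blast
      define t where "t = - (c * i)"
      define x where "x = y + Q ^ k * t"
      have "[(2 * y + 1) * i * c = 1 * c] (mod Q)" using i by (rule cong_mult) simp
      hence "Q dvd (2 * y + 1) * i * c - c" by (simp add: cong_iff_dvd_diff)
      hence "Q dvd - ((2 * y + 1) * i * c - c)" by (simp only: dvd_minus_iff)
      also have "- ((2 * y + 1) * i * c - c) = c + t * (2 * y + 1)" unfolding t_def by (simp add: algebra_simps)
      finally have d1: "Q ^ k * Q dvd Q ^ k * (c + t * (2 * y + 1))" by (rule mult_dvd_mono[OF dvd_refl])
      have d2: "Q ^ k * Q dvd Q ^ k * (Q ^ k * t\<^sup>2)" using Qk by (intro mult_dvd_mono dvd_refl) simp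
      have "fq x = Q ^ k * (c + t * (2 * y + 1)) + Q ^ k * (Q ^ k * t\<^sup>2)"
        using c unfolding x_def fq_def by (simp add: algebra_simps power2_eq_square)
      hence fx: "Q ^ Suc k dvd fq x" using dvd_add[OF d1 d2] by (simp add: mult.commute)
      have "x mod Q ^ Suc k mod Q ^ k = x mod Q ^ k" by (simp add: mod_mod_cancel)
      also have "\<dots> = y" using y unfolding x_def by simp
      finally have "x mod Q ^ Suc k mod Q ^ k = y" .
      moreover have "x mod Q ^ Suc k \<in> roots (q ^ Suc k)"
        unfolding roots_def QS using fx pow[of "Suc k"] by (auto simp: dvd_fq_mod simp del: power_Suc)
      ultimately show "y \<in> (\<lambda>x. x mod Q ^ k) ` roots (q ^ Suc k)" by blast
    qed
  qed
  thus ?thesis unfolding rho_def by (rule bij_betw_same_card)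
qed

text \<open>The reflection x -> -1 - x preserves \<open>fq\<close>; the reflected root differs from
  x0 because 2 x0 + 1 is a unit modulo q.\<close>

lemma rho_prime_root:
  assumes q: "prime q" "q \<noteq> p" "int q dvd fq x0" shows "rho q = 2"
proof -
  define Q where "Q = int q"
  have Q: "Q > 1" "prime Q" unfolding Q_def using q prime_gt_1_nat by auto
  have rf: "fq (-1 - x) = fq x" for x unfolding fq_def by (simp add: power2_eq_square algebra_simps)
  have "roots q = {x0 mod Q, (-1 - x0) mod Q}"
  proof (intro equalityI subsetI)
    fix x assume "x \<in> roots q"
    hence x: "0 \<le> x" "x < Q" "Q dvd fq x" unfolding roots_def Q_def by auto
    have "Q dvd (x - x0) * (x + x0 + 1)"
      unfolding fq_diff[symmetric] using x q(3) unfolding Q_def by (intro dvd_diff)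
    hence "Q dvd x - x0 \<or> Q dvd x + x0 + 1" using Q(2) prime_dvd_mult_iff by blast
    hence "Q dvd x - x0 \<or> Q dvd x - (-1 - x0)" by (simp add: algebra_simps)
    hence "x mod Q = x0 mod Q \<or> x mod Q = (-1 - x0) mod Q" by (auto simp: mod_eq_dvd_iff)
    thus "x \<in> {x0 mod Q, (-1 - x0) mod Q}" using x by simp
  next
    fix x assume "x \<in> {x0 mod Q, (-1 - x0) mod Q}"
    thus "x \<in> roots q" using q(3) Q unfolding roots_def Q_def[symmetric]
      by (auto simp: dvd_fq_mod rf)
  qed
  moreover have "x0 mod Q \<noteq> (-1 - x0) mod Q"
    using derivative_unit[OF q] unfolding mod_eq_dvd_iff Q_def by (simp add: algebra_simps)
  ultimately show ?thesis unfolding rho_def by simp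
qed

text \<open>For odd q, completing the square turns a root into a square root of p modulo q, and
  reciprocity applies. For q = 2 the term x^2 + x is always even, so a root exists iff m4 is even,
  which is the supplementary law for chi 2.\<close>

lemma ex_root_iff:
  assumes q: "prime q" "q \<noteq> p" shows "(\<exists>x. int q dvd fq x) \<longleftrightarrow> chi (int q) = 1"
proof (cases "q = 2")
  case True
  have "(\<exists>x. int q dvd fq x) \<longleftrightarrow> even m4"
    unfolding fq_def True by (auto simp: dvd_diff_commute)
  also have "\<dots> \<longleftrightarrow> even (p div 4)" unfolding m4_def by simp
  also have "\<dots> \<longleftrightarrow> chi (int q) = 1" unfolding True using chi_two by (auto simp: uminus_power_if)
  finally show ?thesis .
next
  case False
  have oq: "odd q" using q False by (metis prime_odd_nat prime_ge_2_nat le_neq_implies_less)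
  have nqp: "\<not> int q dvd int p" using q prime_p primes_dvd_imp_eq of_nat_dvd_iff by blast
  have cop: "coprime (int q) 4"
    using oq coprime_power_right_iff[of "int q" 2 2] by (simp add: coprime_right_2_iff_odd)
  have "(\<exists>x. int q dvd fq x) \<longleftrightarrow> QuadRes (int q) (int p)"
  proof
    assume "\<exists>x. int q dvd fq x"
    then obtain x where "int q dvd fq x" by blast
    hence "[(2 * x + 1)\<^sup>2 = int p] (mod int q)" unfolding fq_sq by (simp add: cong_iff_dvd_diff)
    thus "QuadRes (int q) (int p)" unfolding QuadRes_def by blast
  next
    assume "QuadRes (int q) (int p)"
    then obtain y where y: "[y\<^sup>2 = int p] (mod int q)" unfolding QuadRes_def by blast
    \<comment> \<open>Adding the odd number q if necessary makes the square root odd, hence of the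
      form 2x + 1.\<close>
    define z where "z = (if odd y then y else y + int q)"
    have "odd z" using oq unfolding z_def by auto
    then obtain x where x: "z = 2 * x + 1" by (elim oddE)
    have "[z = y] (mod int q)" unfolding z_def by (simp add: icong_def)
    hence "[z\<^sup>2 = int p] (mod int q)" using y cong_pow cong_trans by blast
    hence "int q dvd 4 * fq x" unfolding x fq_sq by (simp add: cong_iff_dvd_diff)
    hence "int q dvd fq x" using cop by (simp add: coprime_dvd_mult_right_iff)
    thus "\<exists>x. int q dvd fq x" by blast
  qed
  also have "\<dots> \<longleftrightarrow> Legendre (int p) (int q) = 1"
    unfolding Legendre_def using nqp by (auto simp: cong_0_iff)
  also have "\<dots> \<longleftrightarrow> chi (int q) = 1" using chi_reciprocity[OF q(1) False q(2)] by simp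
  finally show ?thesis .
qed

text \<open>Modulo p, 4 fq x is the square of 2x + 1, so the only root is (p - 1) / 2 = 2
  m4.\<close>

lemma rho_p: "rho p = 1"
proof -
  have "roots p = {2 * m4}"
  proof (intro equalityI subsetI)
    fix x assume "x \<in> roots p"
    hence x: "0 \<le> x" "x < int p" "int p dvd fq x" unfolding roots_def by auto
    hence "int p dvd (2 * x + 1)\<^sup>2" unfolding fq_sq by simp
    hence "int p dvd 2 * x + 1" using prime_int_p prime_dvd_power by blast
    then obtain k where k: "2 * x + 1 = int p * k" by (elim dvdE)
    have "0 < int p * k" "int p * k < int p * 2" unfolding k[symmetric] using x by linarith+
    hence "0 < k" by (simp add: zero_less_mult_iff)
    moreover have "k < 2" using \<open>int p * k < int p * 2\<close> mult_left_mono[of 2 k "int p"] by linarith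
    ultimately have "k = 1" by simp
    thus "x \<in> {2 * m4}" using k p_m4(2) by simp
  next
    fix x assume "x \<in> {2 * m4}"
    moreover have "fq (2 * m4) = int p * m4" unfolding fq_def p_m4(2) by (simp add: power2_eq_square algebra_simps)
    ultimately show "x \<in> roots p" using p_m4(2) p_ge_5 unfolding roots_def by auto
  qed
  thus ?thesis unfolding rho_def by simp
qed

text \<open>If p^2 divides fq x, then p divides 2x + 1, so p^2 divides (2x + 1)^2 - 4 fq x =
  p.\<close>

lemma rho_p_power: assumes "k \<ge> 2" shows "rho (p ^ k) = 0"
proof -
  have "roots (p ^ k) = {}"
  proof (rule ccontr)
    assume "roots (p ^ k) \<noteq> {}"
    then obtain x where "int p ^ k dvd fq x" unfolding roots_def by auto
    moreover have "int p ^ 2 dvd int p ^ k" using assms by (rule le_imp_power_dvd)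
    ultimately have d: "int p ^ 2 dvd fq x" by (rule dvd_trans[rotated])
    hence "int p dvd fq x" by (metis dvd_mult_left power2_eq_square)
    hence "int p dvd (2 * x + 1)\<^sup>2" unfolding fq_sq by simp
    hence "int p dvd 2 * x + 1" using prime_int_p prime_dvd_power by blast
    hence "int p ^ 2 dvd (2 * x + 1)\<^sup>2" by (rule dvd_power_same)
    hence "int p ^ 2 dvd int p" unfolding fq_sq using d by (simp add: dvd_add_right_iff)
    hence "int p * int p dvd int p * 1" by (simp add: power2_eq_square)
    hence "int p dvd 1" using p_ge_5 by simp
    thus False using p_ge_5 by simp
  qed
  thus ?thesis unfolding rho_def by simp
qed

text \<open>One formula for three cases: two liftable roots, no root, or q = p with one root that
  does not lift. The last case is covered because 0 ^ 0 = 1.\<close>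

lemma rho_prime_power:
  assumes "prime q" shows "int (rho (q ^ Suc k)) = chi (int q) ^ k * (1 + chi (int q))"
proof (cases "q = p")
  case True
  hence "chi (int q) = 0" using chi_eq_0_iff[of "int p"] by simp
  thus ?thesis using rho_p rho_p_power[of "Suc k"] True by (cases k) auto
next
  case False
  have r: "rho (q ^ Suc k) = rho q"
  proof (induction k)
    case (Suc k)
    thus ?case using rho_prime_power_Suc[OF assms False, of "Suc k"] by simp
  qed simp
  have "\<not> int p dvd int q" using assms prime_p False primes_dvd_imp_eq of_nat_dvd_iff by blast
  hence "chi (int q) = 1 \<or> chi (int q) = -1" using chi_cases[of "int q"] chi_eq_0_iff[of "int q"] by blast
  thus ?thesis
  proof
    assume c: "chi (int q) = 1"
    then obtain x where "int q dvd fq x" using ex_root_iff[OF assms False] by blast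
    thus ?thesis using r c rho_prime_root[OF assms False] by simp
  next
    assume c: "chi (int q) = -1"
    hence "\<nexists>x. int q dvd fq x" using ex_root_iff[OF assms False] by simp
    hence "roots q = {}" unfolding roots_def by blast
    thus ?thesis using r c unfolding rho_def by simp
  qed
qed

text \<open>The number of \<open>triples\<close> with g^2 a = n, sorted by g.\<close>

definition ideals_of_norm :: "nat \<Rightarrow> int" where
  "ideals_of_norm n = (\<Sum>g | g\<^sup>2 dvd n. int (rho (n div g\<^sup>2)))"

text \<open>The n-th Dirichlet coefficient of zeta(s) L(s, chi).\<close>

definition chi_divisor_sum :: "nat \<Rightarrow> int" where
  "chi_divisor_sum n = (\<Sum>d | d dvd n. chi (int d))"

lemma rho_one: "rho 1 = 1"
proof -
  have "roots 1 = {0}" unfolding roots_def by auto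
  thus ?thesis unfolding rho_def by simp
qed

lemma ideals_of_norm_prime_power_mult:
  assumes "prime q" "\<not> q dvd m"
  shows "ideals_of_norm (q ^ k * m) = (\<Sum>j | 2 * j \<le> k. int (rho (q ^ (k - 2 * j)))) * ideals_of_norm m"
proof -
  have m0: "m > 0" using assms by (cases "m = 0") auto
  have q0: "q > 0" using assms(1) prime_gt_0_nat by blast
  have "ideals_of_norm (q ^ k * m) =
    (\<Sum>(j, h)\<in>{j. 2 * j \<le> k} \<times> {h. h\<^sup>2 dvd m}. int (rho (q ^ k * m div (q ^ j * h)\<^sup>2)))"
    unfolding ideals_of_norm_def
    by (subst sum.reindex_bij_betw[OF bij_betw_prime_power_divisors[OF assms, of 2], symmetric])
       (auto simp: case_prod_unfold)
  also have "\<dots> = (\<Sum>(j, h)\<in>{j. 2 * j \<le> k} \<times> {h. h\<^sup>2 dvd m}. int (rho (q ^ (k - 2 * j))) * int (rho (m div h\<^sup>2)))"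
  proof (intro sum.cong refl, clarify)
    fix j h assume j: "2 * j \<le> k" and h: "h\<^sup>2 dvd m"
    then obtain c where c: "m = h\<^sup>2 * c" by (elim dvdE)
    have h0: "h\<^sup>2 > 0" and c0: "c > 0" using m0 c by auto
    have "q ^ k * m = (q ^ j * h)\<^sup>2 * (q ^ (k - 2 * j) * c)"
      using j unfolding c by (simp add: power_mult_distrib power_mult[symmetric] power_add[symmetric] mult_ac)
    hence "q ^ k * m div (q ^ j * h)\<^sup>2 = q ^ (k - 2 * j) * c" using h0 q0 by simp
    moreover have "\<not> q dvd c" using assms(2) c by auto
    hence "coprime (q ^ (k - 2 * j)) c" using assms(1) by (metis coprime_power_left_iff prime_imp_coprime)
    hence "rho (q ^ (k - 2 * j) * c) = rho (q ^ (k - 2 * j)) * rho c" using c0 q0 by (intro rho_mult) auto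
    moreover have "m div h\<^sup>2 = c" using c h0 by simp
    ultimately show "int (rho (q ^ k * m div (q ^ j * h)\<^sup>2)) = int (rho (q ^ (k - 2 * j))) * int (rho (m div h\<^sup>2))"
      by simp
  qed
  also have "\<dots> = (\<Sum>j | 2 * j \<le> k. int (rho (q ^ (k - 2 * j)))) * ideals_of_norm m"
    unfolding ideals_of_norm_def by (simp add: sum_product sum.cartesian_product)
  finally show ?thesis .
qed

lemma chi_divisor_sum_prime_power_mult:
  assumes "prime q" "\<not> q dvd m"
  shows "chi_divisor_sum (q ^ k * m) = (\<Sum>j\<le>k. chi (int q) ^ j) * chi_divisor_sum m"
proof -
  have "chi_divisor_sum (q ^ k * m) = (\<Sum>(j, h)\<in>{j. 1 * j \<le> k} \<times> {h. h ^ 1 dvd m}. chi (int (q ^ j * h)))"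
    unfolding chi_divisor_sum_def
    by (subst sum.reindex_bij_betw[OF bij_betw_prime_power_divisors[OF assms, of 1, unfolded power_one_right], symmetric])
       (auto simp: case_prod_unfold)
  also have "\<dots> = (\<Sum>(j, h)\<in>{..k} \<times> {h. h dvd m}. chi (int q) ^ j * chi (int h))"
    by (intro sum.cong) (auto simp: chi_mult chi_power)
  also have "\<dots> = (\<Sum>j\<le>k. chi (int q) ^ j) * chi_divisor_sum m"
    unfolding chi_divisor_sum_def by (simp add: sum_product sum.cartesian_product)
  finally show ?thesis .
qed

text \<open>Induction in steps of two: removing j = 0 and shifting leaves the sum for k - 2, and the
  removed term chi^(k-1) (1 + chi) supplies the two new powers.\<close>

lemma sum_rho_prime_power:
  assumes "prime q"
  shows "(\<Sum>j | 2 * j \<le> k. int (rho (q ^ (k - 2 * j)))) = (\<Sum>j\<le>k. chi (int q) ^ j)"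
proof (induction k rule: less_induct)
  case (less k)
  consider "k = 0" | "k = 1" | l where "k = Suc (Suc l)" by (metis One_nat_def not0_implies_Suc)
  thus ?case
  proof cases
    case 1
    have "{j :: nat. 2 * j \<le> 0} = {0}" by auto
    thus ?thesis using 1 rho_one by simp
  next
    case 2
    have "{j :: nat. 2 * j \<le> 1} = {0}" by auto
    thus ?thesis using 2 rho_prime_power[OF assms, of 0] by simp
  next
    case 3
    have s: "{j. 2 * j \<le> k} = insert 0 (Suc ` {j. 2 * j \<le> l})"
    proof (intro equalityI subsetI)
      fix j assume "j \<in> {j. 2 * j \<le> k}"
      thus "j \<in> insert 0 (Suc ` {j. 2 * j \<le> l})" using 3 by (cases j) auto
    qed (use 3 in auto)
    have fin: "finite {j. 2 * j \<le> l}" by (rule finite_subset[of _ "{..l}"]) auto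
    have "(\<Sum>j | 2 * j \<le> k. int (rho (q ^ (k - 2 * j)))) =
        int (rho (q ^ k)) + (\<Sum>j\<in>Suc ` {j. 2 * j \<le> l}. int (rho (q ^ (k - 2 * j))))"
      unfolding s using fin by (subst sum.insert) auto
    also have "(\<Sum>j\<in>Suc ` {j. 2 * j \<le> l}. int (rho (q ^ (k - 2 * j)))) = (\<Sum>j | 2 * j \<le> l. int (rho (q ^ (l - 2 * j))))"
      using 3 by (subst sum.reindex) auto
    also have "\<dots> = (\<Sum>j\<le>l. chi (int q) ^ j)" using less 3 by simp
    also have "int (rho (q ^ k)) = chi (int q) ^ Suc l * (1 + chi (int q))"
      unfolding 3 by (rule rho_prime_power[OF assms])
    finally show ?thesis unfolding 3 by (simp add: algebra_simps)
  qed
qed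

text \<open>The factorisation of the Dedekind zeta function as zeta(s) L(s, chi), coefficient by
  coefficient: both sides acquire the same factor when one prime is split off.\<close>

lemma ideals_of_norm_eq: "n > 0 \<Longrightarrow> ideals_of_norm n = chi_divisor_sum n"
proof (induction n rule: less_induct)
  case (less n)
  show ?case
  proof (cases "n = 1")
    case True
    have "{g :: nat. g\<^sup>2 dvd 1} = {1}" "{d :: nat. d dvd 1} = {1}" by (auto simp: power2_eq_square)
    thus ?thesis unfolding True ideals_of_norm_def chi_divisor_sum_def using rho_one by simp
  next
    case False
    then obtain q where q: "prime q" "q dvd n" using prime_factor_nat by blast
    obtain j h where jh: "n = q ^ j * h" "\<not> q dvd h" using prime_power_decomp[OF q(1) less.prems] .
    have "j > 0" using jh q by (cases j) auto
    hence "q ^ j > 1" using q(1) one_less_power prime_gt_1_nat by blast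
    moreover have "h > 0" using jh(2) by (cases "h = 0") auto
    ultimately have "h < n" unfolding jh(1) by simp
    thus ?thesis using less.IH[OF \<open>h < n\<close> \<open>h > 0\<close>] unfolding jh(1)
      by (simp only: ideals_of_norm_prime_power_mult[OF q(1) jh(2)]
        chi_divisor_sum_prime_power_mult[OF q(1) jh(2)] sum_rho_prime_power[OF q(1)])
  qed
qed

lemma card_triples_norm:
  assumes "n > 0"
  shows "finite {(g, a, b) \<in> triples. g\<^sup>2 * a = int n}"
    "int (card {(g, a, b) \<in> triples. g\<^sup>2 * a = int n}) = chi_divisor_sum n"
proof -
  let ?S = "SIGMA g:{g. g\<^sup>2 dvd n}. roots (n div g\<^sup>2)"
  let ?f = "\<lambda>(g :: nat, b :: int). (int g, int (n div g\<^sup>2), b)"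
  have fin: "finite {g :: nat. g\<^sup>2 dvd n}"
  proof (rule finite_subset)
    show "{g :: nat. g\<^sup>2 dvd n} \<subseteq> {..n}"
      using assms by (auto dest!: dvd_imp_le intro: order_trans[OF power2_nat_le_imp_le[OF order_refl]] simp: power2_eq_square intro: le_trans[OF le_square])
  qed simp
  have bij: "bij_betw ?f ?S {(g, a, b) \<in> triples. g\<^sup>2 * a = int n}"
    unfolding bij_betw_def
  proof
    show "inj_on ?f ?S" by (auto simp: inj_on_def)
    show "?f ` ?S = {(g, a, b) \<in> triples. g\<^sup>2 * a = int n}"
    proof (intro equalityI subsetI)
      fix t assume "t \<in> ?f ` ?S"
      then obtain g b where t: "t = (int g, int (n div g\<^sup>2), b)" "g\<^sup>2 dvd n" "b \<in> roots (n div g\<^sup>2)" by auto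
      obtain c where c: "n = g\<^sup>2 * c" using t(2) by (elim dvdE)
      have "g > 0" "c > 0" using c assms by auto
      hence "n div g\<^sup>2 = c" using c by simp
      thus "t \<in> {(g, a, b) \<in> triples. g\<^sup>2 * a = int n}"
        using t(1,3) c \<open>g > 0\<close> \<open>c > 0\<close> unfolding triples_def roots_def fq_def by auto
    next
      fix t assume "t \<in> {(g, a, b) \<in> triples. g\<^sup>2 * a = int n}"
      then obtain g a b where t: "t = (g, a, b)" "(g, a, b) \<in> triples" "g\<^sup>2 * a = int n" by auto
      have pos: "g > 0" "a > 0" using t unfolding triples_def by auto
      define g' where "g' = nat g" define a' where "a' = nat a"
      have ga: "g = int g'" "a = int a'" "g' > 0" using pos unfolding g'_def a'_def by auto
      have "int (g'\<^sup>2 * a') = int n" using t(3) ga by simp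
      hence n: "n = g'\<^sup>2 * a'" by linarith
      hence "n div g'\<^sup>2 = a'" using ga by simp
      thus "t \<in> ?f ` ?S" using t n ga unfolding triples_def roots_def fq_def
        by (intro image_eqI[of _ _ "(g', b)"]) auto
    qed
  qed
  show "finite {(g, a, b) \<in> triples. g\<^sup>2 * a = int n}"
    using bij_betw_finite[OF bij] fin by auto
  have "int (card {(g, a, b) \<in> triples. g\<^sup>2 * a = int n}) = int (card ?S)"
    using bij_betw_same_card[OF bij] by simp
  also have "\<dots> = ideals_of_norm n"
    unfolding ideals_of_norm_def rho_def using fin by (subst card_SigmaI) auto
  finally show "int (card {(g, a, b) \<in> triples. g\<^sup>2 * a = int n}) = chi_divisor_sum n"
    using ideals_of_norm_eq assms by simp
qed

end

section \<open>Lattice points in a sector between hyperbolas\<close>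

text \<open>The linear change of variables with determinant alpha (theta' - theta), carried out as
  two one-dimensional affine substitutions with Tonelli in between.\<close>

lemma nn_integral_linear_pair:
  fixes f :: "real \<times> real \<Rightarrow> ennreal" and \<alpha> \<theta> \<theta>' :: real
  assumes f[measurable]: "f \<in> borel_measurable borel" and "\<alpha> > 0" "\<theta> \<noteq> \<theta>'"
  shows "(\<integral>\<^sup>+z. f z \<partial>lborel) =
    ennreal (\<alpha> * \<bar>\<theta>' - \<theta>\<bar>) * (\<integral>\<^sup>+z. f (\<alpha> * fst z + \<theta> * snd z, \<alpha> * fst z + \<theta>' * snd z) \<partial>lborel)"
proof -
  have f'[measurable]: "f \<in> borel_measurable (borel \<Otimes>\<^sub>M borel)" using f by (simp add: borel_prod)
  define \<kappa> where "\<kappa> = \<theta>' - \<theta>"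
  have k: "\<kappa> \<noteq> 0" using assms(3) unfolding \<kappa>_def by simp
  have "(\<integral>\<^sup>+z. f z \<partial>lborel) = (\<integral>\<^sup>+u. \<integral>\<^sup>+v. f (u, v) \<partial>lborel \<partial>lborel)"
    unfolding lborel_prod[symmetric] by (subst lborel.nn_integral_fst[symmetric]) auto
  also have "\<dots> = (\<integral>\<^sup>+u. ennreal \<bar>\<kappa>\<bar> * (\<integral>\<^sup>+y. f (u, u + \<kappa> * y) \<partial>lborel) \<partial>lborel)"
    by (intro nn_integral_cong nn_integral_real_affine k) auto
  also have "\<dots> = ennreal \<bar>\<kappa>\<bar> * (\<integral>\<^sup>+u. \<integral>\<^sup>+y. f (u, u + \<kappa> * y) \<partial>lborel \<partial>lborel)"
    by (intro nn_integral_cmult) auto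
  also have "(\<integral>\<^sup>+u. \<integral>\<^sup>+y. f (u, u + \<kappa> * y) \<partial>lborel \<partial>lborel) =
      (\<integral>\<^sup>+y. \<integral>\<^sup>+u. f (u, u + \<kappa> * y) \<partial>lborel \<partial>lborel)"
    by (rule lborel_pair.Fubini'[symmetric]) auto
  also have "\<dots> = (\<integral>\<^sup>+y. ennreal \<bar>\<alpha>\<bar> * (\<integral>\<^sup>+x. f (\<theta> * y + \<alpha> * x, \<theta> * y + \<alpha> * x + \<kappa> * y) \<partial>lborel) \<partial>lborel)"
    using assms(2) by (intro nn_integral_cong nn_integral_real_affine) auto
  also have "\<dots> = ennreal \<bar>\<alpha>\<bar> * (\<integral>\<^sup>+y. \<integral>\<^sup>+x. f (\<theta> * y + \<alpha> * x, \<theta> * y + \<alpha> * x + \<kappa> * y) \<partial>lborel \<partial>lborel)"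
    by (intro nn_integral_cmult) auto
  also have "(\<integral>\<^sup>+y. \<integral>\<^sup>+x. f (\<theta> * y + \<alpha> * x, \<theta> * y + \<alpha> * x + \<kappa> * y) \<partial>lborel \<partial>lborel) =
     (\<integral>\<^sup>+z. f (\<alpha> * fst z + \<theta> * snd z, \<alpha> * fst z + \<theta>' * snd z) \<partial>(lborel \<Otimes>\<^sub>M lborel))"
    by (subst lborel_pair.nn_integral_snd[symmetric]) (auto simp: \<kappa>_def algebra_simps)
  finally show ?thesis
    using assms(2) by (simp add: lborel_prod \<kappa>_def ennreal_mult mult_ac)
qed

text \<open>Here u and v stand for the two conjugates of a number. The inequalities between u and
  |v| describe a fundamental domain for multiplication by units, and u |v| <= 1 bounds the
  norm.\<close>

definition hyp_sector :: "real \<Rightarrow> (real \<times> real) set" where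
  "hyp_sector e = {(u, v). 0 < u \<and> \<bar>v\<bar> \<le> u \<and> u < e\<^sup>2 * \<bar>v\<bar> \<and> u * \<bar>v\<bar> \<le> 1}"

lemma borel_hyp_sector [measurable]: "hyp_sector e \<in> sets borel"
proof -
  have "hyp_sector e = {z. 0 < fst z} \<inter> {z. \<bar>snd z\<bar> \<le> fst z} \<inter> {z. fst z < e\<^sup>2 * \<bar>snd z\<bar>} \<inter> {z. fst z * \<bar>snd z\<bar> \<le> 1}"
    unfolding hyp_sector_def by auto
  also have "\<dots> \<in> sets borel"
    by (intro sets.Int borel_open[OF open_Collect_less] borel_closed[OF closed_Collect_le] continuous_intros)
  finally show ?thesis .
qed

lemma emeasure_symmetric_interval:
  fixes s t :: real
  assumes "0 \<le> s" "s \<le> t"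
  shows "emeasure lborel {v. s < \<bar>v\<bar> \<and> \<bar>v\<bar> \<le> t} = ennreal (2 * (t - s))"
proof -
  have "{v. s < \<bar>v\<bar> \<and> \<bar>v\<bar> \<le> t} = {s<..t} \<union> {-t..<-s}" using assms by auto
  also have "emeasure lborel \<dots> = emeasure lborel {s<..t} + emeasure lborel {-t..<-s}"
    using assms by (intro plus_emeasure[symmetric]) auto
  also have "\<dots> = ennreal (2 * (t - s))"
    using assms by (simp add: ennreal_plus[symmetric] del: ennreal_plus)
  finally show ?thesis .
qed

text \<open>The slice at u consists of the v with |v| between u / e^2 and the smaller of u and 1 /
  u. The range 0 <= u <= 1 contributes 1 - 1 / e^2, the range 1 <= u <= e contributes 2 ln e - 1 + 1
  / e^2.\<close>

lemma emeasure_hyp_sector: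
  assumes "e > 1" shows "emeasure lborel (hyp_sector e) = ennreal (2 * ln e)"
proof -
  have e2: "e\<^sup>2 > 1" using assms by (simp add: power2_eq_square less_1_mult)
  have dl: "u / e\<^sup>2 < w \<longleftrightarrow> u < e\<^sup>2 * w" for u w
  proof -
    have "0 < e\<^sup>2" using assms by simp
    thus ?thesis using pos_divide_less_eq[of "e\<^sup>2" u w] by (simp only: mult.commute)
  qed
  have dr: "w \<le> 1 / u \<longleftrightarrow> u * w \<le> 1" if "u > 0" for u w :: real
    using that by (simp add: pos_le_divide_eq mult.commute)
  let ?f1 = "\<lambda>u. 2 * (u - u / e\<^sup>2)" and ?f2 = "\<lambda>u. 2 * (1 / u - u / e\<^sup>2)"
  \<comment> \<open>At u = 1 both indicators are 1, so the identity fails there; a single point does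
    not affect the integral.\<close>
  have slice: "emeasure lborel (Pair u -` hyp_sector e) =
      ennreal (?f1 u) * indicator {0..1} u + ennreal (?f2 u) * indicator {1..e} u" if "u \<noteq> 1" for u
  proof -
    consider "u \<le> 0" | "0 < u" "u < 1" | "1 < u" "u \<le> e" | "e < u" using \<open>u \<noteq> 1\<close> by linarith
    thus ?thesis
    proof cases
      case 1
      hence "Pair u -` hyp_sector e = {}" unfolding hyp_sector_def by auto
      thus ?thesis using 1 assms by (cases "u = 0") auto
    next
      case 2
      have "u * \<bar>v\<bar> \<le> 1" if "\<bar>v\<bar> \<le> u" for v
        using mult_mono[of u 1 "\<bar>v\<bar>" 1] 2 that by auto
      hence "Pair u -` hyp_sector e = {v. u / e\<^sup>2 < \<bar>v\<bar> \<and> \<bar>v\<bar> \<le> u}"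
        unfolding hyp_sector_def dl using 2 by auto
      moreover have "u / e\<^sup>2 \<le> u" using 2 e2 assms divide_left_mono[of 1 "e\<^sup>2" u] by simp
      ultimately show ?thesis using emeasure_symmetric_interval[of "u / e\<^sup>2" u] 2 by simp
    next
      case 3
      have "\<bar>v\<bar> \<le> u" if "u * \<bar>v\<bar> \<le> 1" for v
      proof -
        have "1 * \<bar>v\<bar> \<le> u * \<bar>v\<bar>" using 3 by (intro mult_right_mono) auto
        thus ?thesis using that 3 by linarith
      qed
      hence "Pair u -` hyp_sector e = {v. u / e\<^sup>2 < \<bar>v\<bar> \<and> \<bar>v\<bar> \<le> 1 / u}"
        unfolding hyp_sector_def dl using 3 dr[of u] by auto
      moreover have "u * u \<le> e\<^sup>2" unfolding power2_eq_square using 3 by (intro mult_mono) auto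
      hence "u / e\<^sup>2 \<le> 1 / u" using 3 e2 by (simp add: field_simps)
      ultimately show ?thesis using emeasure_symmetric_interval[of "u / e\<^sup>2" "1 / u"] 3 by simp
    next
      case 4
      have "\<not> (u < e\<^sup>2 * \<bar>v\<bar> \<and> u * \<bar>v\<bar> \<le> 1)" for v
      proof
        assume v: "u < e\<^sup>2 * \<bar>v\<bar> \<and> u * \<bar>v\<bar> \<le> 1"
        have "e * e < u * u" using 4 assms by (intro mult_strict_mono) auto
        also have "u * u < u * (e\<^sup>2 * \<bar>v\<bar>)" using v 4 assms by (intro mult_strict_left_mono) auto
        also have "\<dots> = e\<^sup>2 * (u * \<bar>v\<bar>)" by simp
        also have "\<dots> \<le> e\<^sup>2 * 1" using v by (intro mult_left_mono) auto
        finally show False by (simp add: power2_eq_square)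
      qed
      hence "Pair u -` hyp_sector e = {}" unfolding hyp_sector_def by auto
      thus ?thesis using 4 assms by simp
    qed
  qed
  have "emeasure lborel (hyp_sector e) = (\<integral>\<^sup>+u. emeasure lborel (Pair u -` hyp_sector e) \<partial>lborel)"
    unfolding lborel_prod[symmetric]
    by (rule lborel.emeasure_pair_measure_alt) (simp only: lborel_prod sets_lborel borel_hyp_sector)
  also have "\<dots> = (\<integral>\<^sup>+u. ennreal (?f1 u) * indicator {0..1} u + ennreal (?f2 u) * indicator {1..e} u \<partial>lborel)"
    using slice by (intro nn_integral_cong_AE AE_mp[OF AE_lborel_singleton[of 1] AE_I2]) auto
  also have "\<dots> = (\<integral>\<^sup>+u. ennreal (?f1 u) * indicator {0..1} u \<partial>lborel) +
      (\<integral>\<^sup>+u. ennreal (?f2 u) * indicator {1..e} u \<partial>lborel)"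
    by (intro nn_integral_add) auto
  also have "(\<integral>\<^sup>+u. ennreal (?f1 u) * indicator {0..1} u \<partial>lborel) =
      ennreal ((1\<^sup>2 - 1\<^sup>2 / e\<^sup>2) - (0\<^sup>2 - 0\<^sup>2 / e\<^sup>2))"
  proof (rule nn_integral_FTC_Icc[where F = "\<lambda>u. u\<^sup>2 - u\<^sup>2 / e\<^sup>2"])
    show "((\<lambda>u. u\<^sup>2 - u\<^sup>2 / e\<^sup>2) has_real_derivative ?f1 x) (at x)" if "x \<in> {0..1}" for x
      using assms by (auto intro!: derivative_eq_intros simp: field_simps power2_eq_square)
    show "0 \<le> ?f1 x" if "x \<in> {0..1}" for x
      using that e2 assms divide_left_mono[of 1 "e\<^sup>2" x] by simp
  qed auto
  also have "(\<integral>\<^sup>+u. ennreal (?f2 u) * indicator {1..e} u \<partial>lborel) =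
      ennreal ((2 * ln e - e\<^sup>2 / e\<^sup>2) - (2 * ln 1 - 1\<^sup>2 / e\<^sup>2))"
  proof (rule nn_integral_FTC_Icc[where F = "\<lambda>u. 2 * ln u - u\<^sup>2 / e\<^sup>2"])
    show "((\<lambda>u. 2 * ln u - u\<^sup>2 / e\<^sup>2) has_real_derivative ?f2 x) (at x)" if "x \<in> {1..e}" for x
      using that assms by (auto intro!: derivative_eq_intros simp: field_simps power2_eq_square)
    show "0 \<le> ?f2 x" if "x \<in> {1..e}" for x
    proof -
      have "x * x \<le> e\<^sup>2" unfolding power2_eq_square using that by (intro mult_mono) auto
      hence "x * (x / e\<^sup>2) \<le> 1" using assms by simp
      hence "x / e\<^sup>2 \<le> 1 / x" using dr[of x] that by simp
      thus ?thesis by simp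
    qed
  qed (use assms in auto)
  also have "ennreal ((1\<^sup>2 - 1\<^sup>2 / e\<^sup>2) - (0\<^sup>2 - 0\<^sup>2 / e\<^sup>2)) +
      ennreal ((2 * ln e - e\<^sup>2 / e\<^sup>2) - (2 * ln 1 - 1\<^sup>2 / e\<^sup>2)) = ennreal (2 * ln e)"
  \<comment> \<open>Addition of \<open>ennreal\<close> values needs both summands nonnegative; for
    the second this follows from ln e >= 1 - 1 / e.\<close>
  proof (subst ennreal_plus[symmetric])
    have "ln e \<ge> 1 - 1 / e"
      using ln_le_minus_one[of "1 / e"] assms by (simp add: ln_div)
    moreover have "0 \<le> (1 - 1 / e) * (1 - 1 / e)" by simp
    hence "2 * (1 - 1 / e) \<ge> 1 - 1 / e\<^sup>2" by (simp add: power2_eq_square algebra_simps)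
    ultimately show "0 \<le> (2 * ln e - e\<^sup>2 / e\<^sup>2) - (2 * ln 1 - 1\<^sup>2 / e\<^sup>2)" using assms by simp
  qed (use assms e2 in auto)
  finally show ?thesis .
qed

text \<open>Where one of the four inequalities of \<open>hyp_sector\<close> is an equality. Off this
  set membership in the sector is locally constant, as the convergence of lattice counts
  requires.\<close>

definition hyp_boundary :: "real \<Rightarrow> (real \<times> real) set" where
  "hyp_boundary e = {(u, v). u = 0 \<or> \<bar>v\<bar> = u \<or> u = e\<^sup>2 * \<bar>v\<bar> \<or> u * \<bar>v\<bar> = 1}"

lemma borel_hyp_boundary [measurable]: "hyp_boundary e \<in> sets borel"
proof -
  have "hyp_boundary e = {z. fst z = 0} \<union> {z. \<bar>snd z\<bar> = fst z} \<union> {z. fst z = e\<^sup>2 * \<bar>snd z\<bar>} \<union> {z. fst z * \<bar>snd z\<bar> = 1}"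
    unfolding hyp_boundary_def by auto
  also have "\<dots> \<in> sets borel"
    by (intro sets.Un borel_closed[OF closed_Collect_eq] continuous_intros)
  finally show ?thesis .
qed

text \<open>For u different from 0 the slice is finite.\<close>

lemma emeasure_hyp_boundary:
  assumes "e > 1" shows "emeasure lborel (hyp_boundary e) = 0"
proof -
  have "emeasure lborel (Pair u -` hyp_boundary e) = 0" if "u \<noteq> 0" for u
  proof -
    have "Pair u -` hyp_boundary e \<subseteq> {u, -u, u / e\<^sup>2, - (u / e\<^sup>2), 1 / u, - (1 / u)}"
    proof
      fix v assume "v \<in> Pair u -` hyp_boundary e"
      hence "\<bar>v\<bar> = u \<or> \<bar>v\<bar> = u / e\<^sup>2 \<or> \<bar>v\<bar> = 1 / u"
      proof -
        have "u = 0 \<or> \<bar>v\<bar> = u \<or> u = e\<^sup>2 * \<bar>v\<bar> \<or> u * \<bar>v\<bar> = 1"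
          using \<open>v \<in> _\<close> unfolding hyp_boundary_def by simp
        moreover have "\<bar>v\<bar> = u / e\<^sup>2" if "u = e\<^sup>2 * \<bar>v\<bar>" using that assms by simp
        moreover have "\<bar>v\<bar> = 1 / u" if "u * \<bar>v\<bar> = 1" using that \<open>u \<noteq> 0\<close> by (simp add: eq_divide_eq mult.commute)
        ultimately show ?thesis using \<open>u \<noteq> 0\<close> by blast
      qed
      moreover have "v = \<bar>v\<bar> \<or> v = - \<bar>v\<bar>" by linarith
      ultimately show "v \<in> {u, -u, u / e\<^sup>2, - (u / e\<^sup>2), 1 / u, - (1 / u)}"
        by (metis insert_iff)
    qed
    hence "finite (Pair u -` hyp_boundary e)" by (rule finite_subset) simp
    hence "countable (Pair u -` hyp_boundary e)" by (rule countable_finite)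
    thus ?thesis by (rule emeasure_lborel_countable)
  qed
  hence ae: "AE u in lborel. emeasure lborel (Pair u -` hyp_boundary e) = 0"
    using AE_lborel_singleton[of 0] by (auto elim: AE_mp)
  have "emeasure lborel (hyp_boundary e) = (\<integral>\<^sup>+u. emeasure lborel (Pair u -` hyp_boundary e) \<partial>lborel)"
    unfolding lborel_prod[symmetric]
    by (rule lborel.emeasure_pair_measure_alt) (simp only: lborel_prod sets_lborel borel_hyp_boundary)
  also have "\<dots> = (\<integral>\<^sup>+u. 0 \<partial>(lborel :: real measure))" using ae by (intro nn_integral_cong_AE)
  finally show ?thesis by simp
qed

lemma floor_div_tendsto:
  fixes t :: "nat \<Rightarrow> real"
  assumes "filterlim t at_top sequentially"
  shows "(\<lambda>n. of_int \<lfloor>t n * x\<rfloor> / t n) \<longlonglongrightarrow> x"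
proof (rule Lim_null_comparison[THEN LIM_zero_cancel])
  show "\<forall>\<^sub>F n in sequentially. norm (of_int \<lfloor>t n * x\<rfloor> / t n - x) \<le> 1 / t n"
    using filterlim_at_top_dense[THEN iffD1, OF assms, rule_format, of 0]
  proof eventually_elim
    case (elim n)
    have "\<bar>of_int \<lfloor>t n * x\<rfloor> - t n * x\<bar> \<le> 1" by linarith
    hence "\<bar>of_int \<lfloor>t n * x\<rfloor> - t n * x\<bar> / t n \<le> 1 / t n" using elim by (intro divide_right_mono) auto
    moreover have "of_int \<lfloor>t n * x\<rfloor> / t n - x = (of_int \<lfloor>t n * x\<rfloor> - t n * x) / t n"
      using elim by (simp add: field_simps)
    ultimately show ?case using elim by (simp add: abs_divide)
  qed
  show "(\<lambda>n. 1 / t n) \<longlonglongrightarrow> 0"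
    using tendsto_divide_0[OF tendsto_const filterlim_at_top_imp_at_infinity[OF assms]] by simp
qed

text \<open>The number of lattice points in \<open>t D\<close>, divided by \<open>t\<^sup>2\<close>, is the integral of the indicator of \<open>D\<close>
  at \<open>(\<lfloor>t x\<rfloor> / t, \<lfloor>t y\<rfloor> / t)\<close>; dominated convergence applies off the boundary of \<open>D\<close>.\<close>
lemma lattice_points_asymp:
  fixes D :: "(real \<times> real) set" and t :: "nat \<Rightarrow> real"
  assumes D: "D \<subseteq> {-B..B} \<times> {-B..B}" "D \<in> sets borel"
    and U: "open U" "U \<subseteq> D" and V: "open V" "V \<inter> D = {}"
    and N: "emeasure lborel (- (U \<union> V)) = 0"
    and t: "filterlim t at_top sequentially" "\<And>n. t n \<ge> 1"
  defines "P \<equiv> \<lambda>n. {(i :: int, j :: int). (of_int i / t n, of_int j / t n) \<in> D}"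
  shows "finite (P n)" "(\<lambda>n. real (card (P n)) / (t n)\<^sup>2) \<longlonglongrightarrow> measure lborel D"
proof -
  have tpos: "t n > 0" for n using t(2)[of n] by simp
  have fin: "finite (P n)" for n
  proof (rule finite_subset)
    show "P n \<subseteq> {- \<lceil>B * t n\<rceil>..\<lceil>B * t n\<rceil>} \<times> {- \<lceil>B * t n\<rceil>..\<lceil>B * t n\<rceil>}"
    proof
      fix ij assume "ij \<in> P n"
      then obtain i j where ij: "ij = (i, j)" "(of_int i / t n, of_int j / t n) \<in> D"
        unfolding P_def by auto
      have "- B \<le> of_int i / t n" "of_int i / t n \<le> B" "- B \<le> of_int j / t n" "of_int j / t n \<le> B"
        using ij(2) D(1) by auto
      hence "- (B * t n) \<le> of_int i" "of_int i \<le> B * t n" "- (B * t n) \<le> of_int j" "of_int j \<le> B * t n"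
        using tpos[of n] by (simp_all add: field_simps)
      thus "ij \<in> {- \<lceil>B * t n\<rceil>..\<lceil>B * t n\<rceil>} \<times> {- \<lceil>B * t n\<rceil>..\<lceil>B * t n\<rceil>}"
        unfolding ij(1) by (auto; linarith)
    qed
  qed auto
  thus "finite (P n)" .
  \<comment> \<open>Cells of the scaled lattice, labelled by a corner and half open, so that each
    point lies in exactly one cell, found by taking floors. Their area 1 / t^2 turns the count into
    an integral.\<close>
  define C where "C = (\<lambda>n (i :: int, j :: int). {of_int i / t n..<(of_int i + 1) / t n} \<times> {of_int j / t n..<(of_int j + 1) / t n})"
  have C_iff: "(x, y) \<in> C n (i, j) \<longleftrightarrow> \<lfloor>t n * x\<rfloor> = i \<and> \<lfloor>t n * y\<rfloor> = j" for x y n i j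
    using tpos[of n] unfolding C_def by (auto simp: floor_eq_iff field_simps)
  define E where "E = (\<lambda>n. \<Union>ij\<in>P n. C n ij)"
  have E_iff: "(x, y) \<in> E n \<longleftrightarrow> (of_int \<lfloor>t n * x\<rfloor> / t n, of_int \<lfloor>t n * y\<rfloor> / t n) \<in> D" for x y n
  proof
    assume "(x, y) \<in> E n"
    then obtain i j where ij: "(i, j) \<in> P n" "(x, y) \<in> C n (i, j)" unfolding E_def by auto
    thus "(of_int \<lfloor>t n * x\<rfloor> / t n, of_int \<lfloor>t n * y\<rfloor> / t n) \<in> D" unfolding C_iff P_def by auto
  next
    assume "(of_int \<lfloor>t n * x\<rfloor> / t n, of_int \<lfloor>t n * y\<rfloor> / t n) \<in> D"
    hence "(\<lfloor>t n * x\<rfloor>, \<lfloor>t n * y\<rfloor>) \<in> P n" unfolding P_def by simp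
    moreover have "(x, y) \<in> C n (\<lfloor>t n * x\<rfloor>, \<lfloor>t n * y\<rfloor>)" unfolding C_iff by simp
    ultimately show "(x, y) \<in> E n" unfolding E_def by blast
  qed
  have C_sets: "C n ij \<in> sets lborel" for n ij
    unfolding C_def borel_prod[symmetric] sets_lborel by (cases ij) auto
  have C_meas: "emeasure lborel (C n ij) = ennreal (1 / (t n)\<^sup>2)" for n ij
  proof -
    obtain i j where ij: "ij = (i, j)" by fastforce
    have "emeasure lborel {of_int i / t n..<(of_int i + 1) / t n} = ennreal (1 / t n)" for i :: int
      using tpos[of n] by (subst emeasure_lborel_Ico) (auto simp: field_simps)
    hence "emeasure (lborel \<Otimes>\<^sub>M lborel) (C n ij) = ennreal (1 / t n) * ennreal (1 / t n)"
      unfolding C_def ij prod.case by (subst lborel.emeasure_pair_measure_Times) auto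
    thus ?thesis using tpos[of n] unfolding lborel_prod
      by (simp add: ennreal_mult[symmetric] power2_eq_square)
  qed
  have "emeasure lborel (E n) = (\<Sum>ij\<in>P n. emeasure lborel (C n ij))" for n
    unfolding E_def
  proof (rule sum_emeasure[symmetric])
    show "disjoint_family_on (C n) (P n)"
      unfolding disjoint_family_on_def
    proof (intro ballI impI, rule ccontr)
      fix s r assume "s \<noteq> r" "C n s \<inter> C n r \<noteq> {}"
      then obtain x y where "(x, y) \<in> C n s" "(x, y) \<in> C n r" by auto
      thus False using \<open>s \<noteq> r\<close> C_iff by (cases s; cases r) auto
    qed
  qed (use fin C_sets in auto)
  hence E_meas: "measure lborel (E n) = real (card (P n)) / (t n)\<^sup>2" for n
    unfolding measure_def C_meas by (simp add: ennreal_of_nat_eq_real_of_nat ennreal_mult[symmetric])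
  have E_sets: "E n \<in> sets lborel" for n unfolding E_def using fin C_sets by (intro sets.finite_UN) auto
  have "(\<lambda>n. integral\<^sup>L lborel (indicat_real (E n))) \<longlonglongrightarrow> integral\<^sup>L lborel (indicat_real D)"
  proof (rule integral_dominated_convergence)
    \<comment> \<open>The box is enlarged by 1 because rounding moves a coordinate by at most 1 / t
      <= 1.\<close>
    let ?w = "indicat_real (cbox (- B - 1, - B - 1) (B + 1, B + 1))"
    show "indicat_real D \<in> borel_measurable lborel" using D(2) by simp
    show "indicat_real (E n) \<in> borel_measurable lborel" for n using E_sets by simp
    show "integrable lborel ?w"
      by (rule integrable_real_indicator[OF _ emeasure_lborel_cbox_finite]) simp
    show "AE z in lborel. norm (indicat_real (E n) z) \<le> ?w z" for n
    proof (rule AE_I2)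
      fix z :: "real \<times> real"
      obtain x y where z: "z = (x, y)" by fastforce
      have "z \<in> cbox (- B - 1, - B - 1) (B + 1, B + 1)" if "z \<in> E n"
      proof -
        have *: "- B - 1 \<le> x \<and> x \<le> B + 1" if "- B \<le> of_int \<lfloor>t n * x\<rfloor> / t n" "of_int \<lfloor>t n * x\<rfloor> / t n \<le> B" for x
        proof -
          have "- (B * t n) \<le> of_int \<lfloor>t n * x\<rfloor>" "of_int \<lfloor>t n * x\<rfloor> \<le> B * t n"
            using that tpos[of n] by (simp_all add: field_simps)
          hence "- (B * t n) \<le> t n * x" "t n * x \<le> B * t n + 1" by linarith+
          hence "t n * (- B) \<le> t n * x" "t n * x \<le> t n * (B + 1)" using t(2)[of n] by (simp_all add: algebra_simps)
          hence "- B \<le> x" "x \<le> B + 1" using tpos[of n] mult_le_cancel_left_pos by blast+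
          thus ?thesis by simp
        qed
        show ?thesis using that D(1) * unfolding z E_iff by (auto simp: cbox_Pair_eq)
      qed
      thus "norm (indicat_real (E n) z) \<le> ?w z" by (simp add: indicator_def)
    qed
    have N': "- (U \<union> V) \<in> null_sets lborel" using N U V by (intro null_setsI) auto
    show "AE z in lborel. (\<lambda>n. indicat_real (E n) z) \<longlonglongrightarrow> indicat_real D z"
    proof (rule AE_I'[OF N'], rule subsetI, rule ccontr)
      fix z assume z: "z \<in> {z \<in> space lborel. \<not> (\<lambda>n. indicat_real (E n) z) \<longlonglongrightarrow> indicat_real D z}"
        and "z \<notin> - (U \<union> V)"
      obtain x y where xy: "z = (x, y)" by fastforce
      have lim: "(\<lambda>n. (of_int \<lfloor>t n * x\<rfloor> / t n, of_int \<lfloor>t n * y\<rfloor> / t n)) \<longlonglongrightarrow> (x, y)"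
        by (intro tendsto_Pair floor_div_tendsto t)
      have "z \<in> U \<or> z \<in> V" using \<open>z \<notin> _\<close> by blast
      hence "\<forall>\<^sub>F n in sequentially. indicat_real (E n) z = indicat_real D z"
      proof
        assume "z \<in> U"
        hence "\<forall>\<^sub>F n in sequentially. (of_int \<lfloor>t n * x\<rfloor> / t n, of_int \<lfloor>t n * y\<rfloor> / t n) \<in> U"
          using topological_tendstoD[OF lim U(1)] xy by simp
        thus ?thesis
          by eventually_elim (use \<open>z \<in> U\<close> U(2) xy E_iff in \<open>auto simp: indicator_def\<close>)
      next
        assume "z \<in> V"
        hence "\<forall>\<^sub>F n in sequentially. (of_int \<lfloor>t n * x\<rfloor> / t n, of_int \<lfloor>t n * y\<rfloor> / t n) \<in> V"
          using topological_tendstoD[OF lim V(1)] xy by simp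
        thus ?thesis
          by eventually_elim (use \<open>z \<in> V\<close> V(2) xy E_iff in \<open>auto simp: indicator_def\<close>)
      qed
      hence "(\<lambda>n. indicat_real (E n) z) \<longlonglongrightarrow> indicat_real D z" by (rule tendsto_eventually)
      thus False using z by blast
    qed
  qed
  thus "(\<lambda>n. real (card (P n)) / (t n)\<^sup>2) \<longlonglongrightarrow> measure lborel D"
    using E_meas by simp
qed

text \<open>The form in which one ideal class is counted: (alpha, theta) is a lattice basis and
  (alpha, theta') its conjugate, so u and v are the two conjugates of a lattice point.\<close>

lemma hyperbola_lattice_count:
  fixes \<alpha> \<theta> \<theta>' e :: real and Y :: "nat \<Rightarrow> real"
  assumes "\<alpha> > 0" "\<theta> \<noteq> \<theta>'" "e > 1" and Y: "filterlim Y at_top sequentially" "\<And>n. Y n \<ge> 1"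
  defines "P \<equiv> \<lambda>n. {(i :: int, j :: int). let u = \<alpha> * of_int i + \<theta> * of_int j; v = \<alpha> * of_int i + \<theta>' * of_int j
     in 0 < u \<and> \<bar>v\<bar> \<le> u \<and> u < e\<^sup>2 * \<bar>v\<bar> \<and> u * \<bar>v\<bar> \<le> Y n}"
  shows "finite (P n)" "(\<lambda>n. real (card (P n)) / Y n) \<longlonglongrightarrow> 2 * ln e / (\<alpha> * \<bar>\<theta>' - \<theta>\<bar>)"
proof -
  define L where "L = (\<lambda>z. (\<alpha> * fst z + \<theta> * snd z, \<alpha> * fst z + \<theta>' * snd z))"
  define D where "D = L -` hyp_sector e"
  define U where "U = {z. 0 < fst z} \<inter> {z. \<bar>snd z\<bar> < fst z} \<inter> {z. fst z < e\<^sup>2 * \<bar>snd z\<bar>} \<inter> {z. fst z * \<bar>snd z\<bar> < (1 :: real)}"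
  define V where "V = {z. fst z < 0} \<union> {z. fst z < \<bar>snd z\<bar>} \<union> {z. e\<^sup>2 * \<bar>snd z\<bar> < fst z} \<union> {z. (1 :: real) < fst z * \<bar>snd z\<bar>}"
  have contL: "continuous_on UNIV L" unfolding L_def by (intro continuous_intros)
  have Lm[measurable]: "L \<in> borel_measurable borel" using contL by (rule borel_measurable_continuous_onI)
  have oU: "open U" unfolding U_def by (intro open_Int open_Collect_less continuous_intros)
  have oV: "open V" unfolding V_def by (intro open_Un open_Collect_less continuous_intros)
  have emL: "emeasure lborel A = ennreal (\<alpha> * \<bar>\<theta>' - \<theta>\<bar>) * emeasure lborel (L -` A)"
    if A: "A \<in> sets borel" for A
  proof -
    have LA: "L -` A \<in> sets borel" using measurable_sets[OF Lm A] by simp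
    have "emeasure lborel A = (\<integral>\<^sup>+z. indicator A z \<partial>lborel)" using A by simp
    also have "\<dots> = ennreal (\<alpha> * \<bar>\<theta>' - \<theta>\<bar>) * (\<integral>\<^sup>+z. indicator A (L z) \<partial>lborel)"
      unfolding L_def using assms A by (intro nn_integral_linear_pair) auto
    also have "(\<integral>\<^sup>+z. indicator A (L z) \<partial>lborel) = (\<integral>\<^sup>+z. indicator (L -` A) z \<partial>lborel)"
      by (intro nn_integral_cong) (simp add: indicator_def)
    also have "\<dots> = emeasure lborel (L -` A)" using LA by simp
    finally show ?thesis .
  qed
  have c0: "\<alpha> * \<bar>\<theta>' - \<theta>\<bar> > 0" using assms by simp
  have "emeasure lborel (L -` hyp_boundary e) = 0"
    using emL[OF borel_hyp_boundary, of e] emeasure_hyp_boundary[OF assms(3)] assms(1,2) by auto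
  moreover have "- (L -` U \<union> L -` V) \<subseteq> L -` hyp_boundary e"
    unfolding U_def V_def hyp_boundary_def by auto
  moreover have "L -` hyp_boundary e \<in> sets lborel" using measurable_sets[OF Lm borel_hyp_boundary] by simp
  ultimately have N: "emeasure lborel (- (L -` U \<union> L -` V)) = 0"
    by (metis emeasure_mono le_zero_eq)
  have mD: "measure lborel D = 2 * ln e / (\<alpha> * \<bar>\<theta>' - \<theta>\<bar>)"
  proof -
    have "ennreal (2 * ln e) = ennreal (\<alpha> * \<bar>\<theta>' - \<theta>\<bar>) * emeasure lborel D"
      unfolding D_def emeasure_hyp_sector[OF assms(3), symmetric] by (rule emL) simp
    hence "enn2real (ennreal (2 * ln e)) = enn2real (ennreal (\<alpha> * \<bar>\<theta>' - \<theta>\<bar>) * emeasure lborel D)" by simp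
    moreover have "enn2real (ennreal (2 * ln e)) = 2 * ln e"
      using assms(3) by (intro enn2real_ennreal) simp
    moreover have "enn2real (ennreal (\<alpha> * \<bar>\<theta>' - \<theta>\<bar>)) = \<alpha> * \<bar>\<theta>' - \<theta>\<bar>"
      using c0 by (intro enn2real_ennreal) simp
    ultimately have "2 * ln e = \<alpha> * \<bar>\<theta>' - \<theta>\<bar> * measure lborel D"
      unfolding measure_def by (simp only: enn2real_mult)
    thus ?thesis using c0 by (metis nonzero_mult_div_cancel_left less_irrefl)
  qed
  \<comment> \<open>The norm u |v| is homogeneous of degree 2, so a norm bound Y means dilation by
    sqrt Y.\<close>
  define t where "t = (\<lambda>n. sqrt (Y n))"
  have t: "filterlim t at_top sequentially" unfolding t_def by (rule filterlim_compose[OF sqrt_at_top Y(1)])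
  have t1: "t n \<ge> 1" for n unfolding t_def using Y(2)[of n] by simp
  have t2: "(t n)\<^sup>2 = Y n" for n unfolding t_def using Y(2)[of n] by simp
  \<comment> \<open>From u^2 < e^2 u |v| <= e^2 it follows that u < e, so |v - u| <= 2 e bounds the
    second coordinate; u then bounds the first.\<close>
  define B1 where "B1 = 2 * e / \<bar>\<theta>' - \<theta>\<bar>"
  define B where "B = max B1 ((e + \<bar>\<theta>\<bar> * B1) / \<alpha>)"
  have DB: "D \<subseteq> {-B..B} \<times> {-B..B}"
  proof
    fix z assume "z \<in> D"
    define u where "u = \<alpha> * fst z + \<theta> * snd z"
    define v where "v = \<alpha> * fst z + \<theta>' * snd z"
    have uv: "0 < u" "\<bar>v\<bar> \<le> u" "u < e\<^sup>2 * \<bar>v\<bar>" "u * \<bar>v\<bar> \<le> 1"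
      using \<open>z \<in> D\<close> unfolding D_def L_def hyp_sector_def u_def v_def by auto
    have "u * u < u * (e\<^sup>2 * \<bar>v\<bar>)" using uv by (intro mult_strict_left_mono)
    also have "\<dots> = e\<^sup>2 * (u * \<bar>v\<bar>)" by simp
    also have "\<dots> \<le> e\<^sup>2 * 1" using uv by (intro mult_left_mono) auto
    finally have "u\<^sup>2 < e\<^sup>2" by (simp add: power2_eq_square)
    hence ue: "u < e" using assms(3) by (intro power_less_imp_less_base[of u 2 e]) auto
    have "\<bar>\<theta>' - \<theta>\<bar> * \<bar>snd z\<bar> = \<bar>v - u\<bar>" unfolding u_def v_def abs_mult[symmetric] by (simp add: algebra_simps)
    also have "\<dots> \<le> 2 * e" using uv ue by linarith
    finally have y: "\<bar>snd z\<bar> \<le> B1" unfolding B1_def using assms(2) by (simp add: field_simps)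
    have "\<alpha> * \<bar>fst z\<bar> = \<bar>u - \<theta> * snd z\<bar>" unfolding u_def using assms(1) by (simp add: abs_mult)
    also have "\<dots> \<le> e + \<bar>\<theta>\<bar> * \<bar>snd z\<bar>" using uv ue by (simp add: abs_mult[symmetric]) 
    also have "\<dots> \<le> e + \<bar>\<theta>\<bar> * B1" using y by (intro add_left_mono mult_left_mono) auto
    finally have x: "\<bar>fst z\<bar> \<le> (e + \<bar>\<theta>\<bar> * B1) / \<alpha>" using assms(1) by (simp add: field_simps)
    have "\<bar>fst z\<bar> \<le> B" "\<bar>snd z\<bar> \<le> B" using x y unfolding B_def by auto
    thus "z \<in> {-B..B} \<times> {-B..B}" by (cases z) auto
  qed
  have Peq: "P n = {(i :: int, j :: int). (of_int i / t n, of_int j / t n) \<in> D}" for n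
  proof -
    have tp: "t n > 0" using t1[of n] by simp
    have "(of_int i / t n, of_int j / t n) \<in> D \<longleftrightarrow> (i, j) \<in> P n" for i j :: int
    proof -
      define u where "u = \<alpha> * of_int i + \<theta> * of_int j"
      define v where "v = \<alpha> * of_int i + \<theta>' * of_int j"
      have "L (of_int i / t n, of_int j / t n) = (u / t n, v / t n)"
        unfolding L_def u_def v_def by (simp add: add_divide_distrib)
      hence "(of_int i / t n, of_int j / t n) \<in> D \<longleftrightarrow>
         0 < u / t n \<and> \<bar>v / t n\<bar> \<le> u / t n \<and> u / t n < e\<^sup>2 * \<bar>v / t n\<bar> \<and> (u / t n) * \<bar>v / t n\<bar> \<le> 1"
        unfolding D_def hyp_sector_def by (simp only: vimage_eq mem_Collect_eq prod.case)
      also have "\<bar>v / t n\<bar> = \<bar>v\<bar> / t n" using tp by simp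
      also have "0 < u / t n \<longleftrightarrow> 0 < u" using tp by (simp add: zero_less_divide_iff)
      also have "\<bar>v\<bar> / t n \<le> u / t n \<longleftrightarrow> \<bar>v\<bar> \<le> u" using tp by (simp add: divide_le_cancel)
      also have "u / t n < e\<^sup>2 * (\<bar>v\<bar> / t n) \<longleftrightarrow> u < e\<^sup>2 * \<bar>v\<bar>"
        using tp by (simp add: divide_less_cancel)
      also have "(u / t n) * (\<bar>v\<bar> / t n) \<le> 1 \<longleftrightarrow> u * \<bar>v\<bar> \<le> Y n"
        unfolding t2[symmetric] using tp by (simp add: field_simps power2_eq_square)
      finally show ?thesis unfolding P_def Let_def u_def v_def by simp
    qed
    thus ?thesis by auto
  qed
  have *: "open (L -` U)" "L -` U \<subseteq> D" "open (L -` V)" "L -` V \<inter> D = {}" "D \<in> sets borel"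
  proof -
    show "open (L -` U)" "open (L -` V)" using contL oU oV by (auto intro: open_vimage simp: continuous_on_eq_continuous_at)
    show "D \<in> sets borel" unfolding D_def using measurable_sets[OF Lm borel_hyp_sector] by simp
  qed (auto simp: U_def V_def D_def hyp_sector_def)
  show "finite (P n)" unfolding Peq
    by (rule lattice_points_asymp(1)[OF DB *(5) *(1,2,3,4) N t t1])
  show "(\<lambda>n. real (card (P n)) / Y n) \<longlonglongrightarrow> 2 * ln e / (\<alpha> * \<bar>\<theta>' - \<theta>\<bar>)"
    using lattice_points_asymp(2)[OF DB *(5) *(1,2,3,4) N t t1] unfolding Peq mD t2 .
qed

section \<open>The value \<open>L(1, \<chi>)\<close>\<close>

text \<open>Vector valued, since it serves real character sums and, for the sign of the Gauss sum,
  complex exponentials.\<close>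

lemma Abel_summation_bound:
  fixes f :: "nat \<Rightarrow> 'a :: real_normed_vector" and c :: "nat \<Rightarrow> real"
  assumes "M \<le> n" "\<And>k. M \<le> k \<Longrightarrow> k \<le> n \<Longrightarrow> norm (\<Sum>i\<in>{M..<k}. f i) \<le> B"
    and c: "\<And>i. M \<le> i \<Longrightarrow> i < n \<Longrightarrow> c (Suc i) \<le> c i" "c n \<ge> 0"
  shows "norm (\<Sum>i\<in>{M..<n}. c i *\<^sub>R f i) \<le> B * c M"
proof -
  define S where "S k = (\<Sum>i\<in>{M..<k}. f i)" for k
  have abel: "(\<Sum>i\<in>{M..<k}. c i *\<^sub>R f i) = (\<Sum>i\<in>{M..<k}. (c i - c (Suc i)) *\<^sub>R S (Suc i)) + c k *\<^sub>R S k"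
    if "M \<le> k" for k
    using that
  proof (induction k rule: dec_induct)
    case (step k)
    have "S (Suc k) = S k + f k" unfolding S_def using step by simp
    thus ?case using step by (simp add: algebra_simps)
  qed (simp add: S_def)
  have SB: "norm (S k) \<le> B" if "M \<le> k" "k \<le> n" for k unfolding S_def using assms(2) that by blast
  have "norm (\<Sum>i\<in>{M..<n}. (c i - c (Suc i)) *\<^sub>R S (Suc i)) \<le> (\<Sum>i\<in>{M..<n}. (c i - c (Suc i)) * B)"
    using c(1) SB by (intro sum_norm_le) (auto intro!: mult_left_mono)
  also have "\<dots> = (c M - c n) * B"
    using assms(1) by (simp add: sum_distrib_right[symmetric] sum_Suc_diff'[of M n "\<lambda>i. - c i", simplified])
  finally have 1: "norm (\<Sum>i\<in>{M..<n}. (c i - c (Suc i)) *\<^sub>R S (Suc i)) \<le> (c M - c n) * B" .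
  have 2: "norm (c n *\<^sub>R S n) \<le> c n * B" using SB[of n] assms(1) c(2) by (simp add: mult_left_mono)
  have "norm (\<Sum>i\<in>{M..<n}. c i *\<^sub>R f i) \<le> (c M - c n) * B + c n * B"
    unfolding abel[OF assms(1)] using norm_triangle_le[OF add_mono[OF 1 2]] .
  thus ?thesis by (simp add: algebra_simps)
qed

lemma sum_atLeastLessThan_div:
  fixes f :: "nat \<Rightarrow> int"
  shows "(\<Sum>n\<in>{1..N}. \<Sum>d | d dvd n. f d) = (\<Sum>d\<in>{1..N}. f d * int (N div d))"
proof -
  have "(\<Sum>n\<in>{1..N}. \<Sum>d | d dvd n. f d) = (\<Sum>n\<in>{1..N}. \<Sum>d\<in>{1..N}. if d dvd n then f d else 0)"
  proof (rule sum.cong[OF refl])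
    fix n assume n: "n \<in> {1..N}"
    have "{d. d dvd n} = {d \<in> {1..N}. d dvd n}" using n by (auto dest: dvd_imp_le intro: Suc_leI dvd_pos_nat)
    show "(\<Sum>d | d dvd n. f d) = (\<Sum>d\<in>{1..N}. if d dvd n then f d else 0)"
      unfolding \<open>{d. d dvd n} = _\<close> by (rule sum.inter_filter) simp
  qed
  also have "\<dots> = (\<Sum>d\<in>{1..N}. \<Sum>n\<in>{1..N}. if d dvd n then f d else 0)" by (rule sum.swap)
  also have "\<dots> = (\<Sum>d\<in>{1..N}. f d * int (N div d))"
  proof (intro sum.cong refl)
    fix d assume d: "d \<in> {1..N}"
    have "{n \<in> {1..N}. d dvd n} = (\<lambda>k. d * k) ` {1..N div d}"
    proof (intro equalityI subsetI)
      fix n assume "n \<in> {n \<in> {1..N}. d dvd n}"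
      then obtain k where "n = d * k" "1 \<le> n" "n \<le> N" by auto
      thus "n \<in> (\<lambda>k. d * k) ` {1..N div d}" using d
        by (intro image_eqI[of _ _ k]) (auto simp: less_eq_div_iff_mult_less_eq mult.commute Suc_le_eq)
    next
      fix n assume "n \<in> (\<lambda>k. d * k) ` {1..N div d}"
      then obtain k where "n = d * k" "k \<in> {1..N div d}" by blast
      hence k: "n = d * k" "1 \<le> k" "k \<le> N div d" by auto
      hence "d * k \<le> N" using d by (simp add: less_eq_div_iff_mult_less_eq mult.commute)
      thus "n \<in> {n \<in> {1..N}. d dvd n}" using k d by auto
    qed
    hence "card {n \<in> {1..N}. d dvd n} = N div d"
      using d by (simp add: card_image inj_on_def)
    thus "(\<Sum>n\<in>{1..N}. if d dvd n then f d else 0) = f d * int (N div d)"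
      by (simp add: sum.inter_filter[symmetric])
  qed
  finally show ?thesis .
qed

context prime_one_mod_four
begin

lemma sum_chi_nat: "(\<Sum>i<p. chi (int i)) = 0"
proof -
  have "(\<Sum>i<p. chi (int i)) = (\<Sum>i\<in>{0..<int p}. chi i)"
    by (rule sum.reindex_bij_witness[of _ nat int]) auto
  thus ?thesis using sum_chi by simp
qed

text \<open>Complete periods contribute 0; fewer than p terms remain.\<close>

lemma abs_sum_chi_le: "\<bar>\<Sum>i<k. chi (int i)\<bar> \<le> int p"
proof -
  have *: "(\<Sum>i\<in>{p * q..<p * q + r}. chi (int i)) = (\<Sum>i<r. chi (int i))" for q r
  proof -
    have "(\<Sum>i\<in>{0 + p * q..<r + p * q}. chi (int i)) = (\<Sum>i\<in>{0..<r}. chi (int (i + p * q)))"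
      by (rule sum.shift_bounds_nat_ivl)
    also have "\<dots> = (\<Sum>i\<in>{0..<r}. chi (int i))"
      by (intro sum.cong refl chi_cong) (simp add: icong_def)
    finally show ?thesis by (simp add: add.commute atLeast0LessThan)
  qed
  have z: "(\<Sum>i<p * q. chi (int i)) = 0" for q
  proof (induction q)
    case (Suc q)
    have "(\<Sum>i<p * Suc q. chi (int i)) = (\<Sum>i<p * q. chi (int i)) + (\<Sum>i\<in>{p * q..<p * q + p}. chi (int i))"
      by (simp add: lessThan_atLeast0 sum.atLeastLessThan_concat add.commute)
    thus ?case using Suc * sum_chi_nat by simp
  qed simp
  define q r where "q = k div p" and "r = k mod p"
  have k: "k = p * q + r" unfolding q_def r_def by simp
  have "r \<le> p" unfolding r_def using p_ge_5 by (simp add: less_imp_le)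
  have "(\<Sum>i<k. chi (int i)) = (\<Sum>i<p * q. chi (int i)) + (\<Sum>i\<in>{p * q..<p * q + r}. chi (int i))"
    unfolding k by (simp add: lessThan_atLeast0 sum.atLeastLessThan_concat)
  hence "\<bar>\<Sum>i<k. chi (int i)\<bar> = \<bar>\<Sum>i<r. chi (int i)\<bar>" using z * by simp
  also have "\<dots> \<le> (\<Sum>i<r. \<bar>chi (int i)\<bar>)" by (rule sum_abs)
  also have "\<dots> \<le> (\<Sum>i<r. 1)" by (intro sum_mono abs_chi_le)
  also have "\<dots> \<le> int p" using \<open>r \<le> p\<close> by simp
  finally show ?thesis .
qed

lemma abs_sum_chi_interval_le: assumes "M \<le> k" shows "\<bar>\<Sum>i\<in>{M..<k}. real_of_int (chi (int i))\<bar> \<le> 2 * real p"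
proof -
  have "(\<Sum>i<k. chi (int i)) = (\<Sum>i<M. chi (int i)) + (\<Sum>i\<in>{M..<k}. chi (int i))"
    using assms by (simp add: lessThan_atLeast0 sum.atLeastLessThan_concat)
  hence "\<bar>\<Sum>i\<in>{M..<k}. chi (int i)\<bar> \<le> 2 * int p" using abs_sum_chi_le[of k] abs_sum_chi_le[of M] by linarith
  hence "real_of_int \<bar>\<Sum>i\<in>{M..<k}. chi (int i)\<bar> \<le> real_of_int (2 * int p)" by (simp only: of_int_le_iff)
  thus ?thesis by simp
qed

lemma chi_weighted_sum_bound:
  fixes c :: "nat \<Rightarrow> real"
  assumes "M \<le> n" "\<And>i. M \<le> i \<Longrightarrow> i < n \<Longrightarrow> c (Suc i) \<le> c i" "c n \<ge> (0 :: real)"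
  shows "\<bar>\<Sum>i\<in>{M..<n}. chi (int i) * c i\<bar> \<le> 2 * real p * c M"
proof -
  have "norm (\<Sum>i\<in>{M..<n}. c i *\<^sub>R real_of_int (chi (int i))) \<le> 2 * real p * c M"
    by (rule Abel_summation_bound[OF assms(1) _ assms(2,3)]) (use abs_sum_chi_interval_le in auto)
  thus ?thesis by (simp add: mult.commute)
qed

text \<open>L(1, chi); the term with n = 0 is 0.\<close>

definition L1 :: real where "L1 = (\<Sum>n. chi (int n) / real n)"

text \<open>The bound is independent of x up to and including x = 1: it yields convergence there and
  the uniformity behind the Abel limit.\<close>

lemma chi_power_sum_bound:
  assumes "0 < M" "M \<le> n" "0 \<le> x" "x \<le> 1"
  shows "\<bar>\<Sum>i\<in>{M..<n}. chi (int i) / real i * x ^ i\<bar> \<le> 2 * real p / real M"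
proof -
  have "\<bar>\<Sum>i\<in>{M..<n}. chi (int i) * (x ^ i / real i)\<bar> \<le> 2 * real p * (x ^ M / real M)"
  proof (rule chi_weighted_sum_bound[OF assms(2)])
    show "x ^ Suc i / real (Suc i) \<le> x ^ i / real i" if "M \<le> i" "i < n" for i
    proof -
      have "x ^ Suc i \<le> x ^ i" using assms by (intro power_decreasing) auto
      thus ?thesis using that assms by (intro frac_le) auto
    qed
  qed (use assms in auto)
  also have "\<dots> \<le> 2 * real p * (1 / real M)"
    using assms by (intro mult_left_mono divide_right_mono power_le_one) auto
  finally show ?thesis by simp
qed

lemma summable_chi_power:
  assumes "0 \<le> x" "x \<le> 1" shows "summable (\<lambda>n. chi (int n) / real n * x ^ n)"
  unfolding summable_Cauchy
proof (intro allI impI)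
  fix e :: real assume e: "e > 0"
  obtain N :: nat where N: "real N > 2 * real p / e" using reals_Archimedean2 by blast
  have "norm (\<Sum>i\<in>{m..<n}. chi (int i) / real i * x ^ i) < e" if "m \<ge> Suc N" for m n
  proof (cases "m \<le> n")
    case True
    have "norm (\<Sum>i\<in>{m..<n}. chi (int i) / real i * x ^ i) \<le> 2 * real p / real m"
      using chi_power_sum_bound[of m n x] that True assms by simp
    also have "\<dots> < e"
    proof -
      have "2 * real p / e < real m" using N that by linarith
      thus ?thesis using e that by (simp add: field_simps)
    qed
    finally show ?thesis .
  qed (use e in auto)
  thus "\<exists>N. \<forall>m\<ge>N. \<forall>n. norm (\<Sum>i\<in>{m..<n}. chi (int i) / real i * x ^ i) < e" by blast
qed

lemma chi_power_tail_bound: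
  assumes "0 < M" "0 \<le> x" "x \<le> 1"
  shows "\<bar>(\<Sum>n. chi (int n) / real n * x ^ n) - (\<Sum>i<M. chi (int i) / real i * x ^ i)\<bar> \<le> 2 * real p / real M"
proof (rule LIMSEQ_le_const2)
  show "(\<lambda>k. \<bar>(\<Sum>i<k. chi (int i) / real i * x ^ i) - (\<Sum>i<M. chi (int i) / real i * x ^ i)\<bar>)
      \<longlonglongrightarrow> \<bar>(\<Sum>n. chi (int n) / real n * x ^ n) - (\<Sum>i<M. chi (int i) / real i * x ^ i)\<bar>"
    by (intro tendsto_intros summable_LIMSEQ summable_chi_power assms)
  show "\<exists>N. \<forall>n\<ge>N. \<bar>(\<Sum>i<n. chi (int i) / real i * x ^ i) - (\<Sum>i<M. chi (int i) / real i * x ^ i)\<bar> \<le> 2 * real p / real M"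
  proof (intro exI allI impI)
    fix n assume "n \<ge> M"
    hence "(\<Sum>i<n. chi (int i) / real i * x ^ i) =
      (\<Sum>i<M. chi (int i) / real i * x ^ i) + (\<Sum>i\<in>{M..<n}. chi (int i) / real i * x ^ i)"
      by (simp add: lessThan_atLeast0 sum.atLeastLessThan_concat)
    thus "\<bar>(\<Sum>i<n. chi (int i) / real i * x ^ i) - (\<Sum>i<M. chi (int i) / real i * x ^ i)\<bar> \<le> 2 * real p / real M"
      using chi_power_sum_bound[OF assms(1) \<open>n \<ge> M\<close> assms(2,3)] by simp
  qed
qed

text \<open>Needed because the logarithmic series is summed for x < 1, where no question of
  convergence on the unit circle arises.\<close>

lemma L1_Abel_limit:
  "((\<lambda>x. \<Sum>n. chi (int n) / real n * x ^ n) \<longlongrightarrow> L1) (at_left 1)"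
proof -
  let ?s = "\<lambda>M x. \<Sum>i<M. chi (int i) / real i * x ^ i"
  let ?f = "\<lambda>x. \<Sum>n. chi (int n) / real n * x ^ n"
  have "uniform_limit {0..1} ?s ?f sequentially"
  proof (rule uniform_limitI)
    fix e :: real assume e: "e > 0"
    obtain N :: nat where N: "real N > 2 * real p / e" using reals_Archimedean2 by blast
    show "\<forall>\<^sub>F M in sequentially. \<forall>x\<in>{0..1}. dist (?s M x) (?f x) < e"
      using eventually_gt_at_top[of N]
    proof eventually_elim
      case (elim M)
      have "2 * real p / e < real M" using N elim by linarith
      hence "2 * real p / real M < e" using e elim by (simp add: field_simps)
      moreover have "dist (?s M x) (?f x) \<le> 2 * real p / real M" if "x \<in> {0..1}" for x
        using chi_power_tail_bound[of M x] that elim by (simp add: dist_real_def abs_minus_commute)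
      ultimately show ?case by fastforce
    qed
  qed
  hence "continuous_on {0..1} ?f"
  proof (rule uniform_limit_theorem[rotated])
    show "\<forall>\<^sub>F M in sequentially. continuous_on {0..1} (?s M)"
      by (intro always_eventually allI continuous_on_sum continuous_on_mult continuous_on_const
        continuous_on_power continuous_on_id)
  qed simp
  hence "\<forall>x\<in>{0..1}. (?f \<longlongrightarrow> ?f x) (at x within {0..1})" unfolding continuous_on_def .
  hence "(?f \<longlongrightarrow> ?f 1) (at 1 within {0..1})" by (rule bspec) simp
  moreover have "at 1 within {0..1} = at_left (1 :: real)" by (rule at_within_Icc_at_left) simp
  ultimately show ?thesis unfolding L1_def by simp
qed

text \<open>The double sum equals the sum of chi d * (N div d). Up to a fixed D the floor is
  replaced by N / d, with total error at most D; beyond D the factor N div d is decreasing, and Abel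
  summation leaves a term of order N / D.\<close>

lemma chi_divisor_sums_limit:
  "(\<lambda>N. (\<Sum>n\<in>{1..N}. \<Sum>d | d dvd n. chi (int d)) / real N) \<longlonglongrightarrow> L1"
proof (rule LIMSEQ_I)
  fix e :: real assume e: "e > 0"
  \<comment> \<open>Two errors of size 2 p / (D + 1) occur, from the divisors beyond D and from the
    tail of the series; together they must stay below e / 2.\<close>
  obtain D :: nat where D: "real D > 8 * real p / e" using reals_Archimedean2 by blast
  have D0: "real D > 0" by (rule le_less_trans[OF _ D]) (use e in simp)
  have D8: "4 * real p / real (Suc D) < e / 2"
  proof -
    have "8 * real p < e * real D" using D e by (simp add: field_simps)
    also have "\<dots> \<le> e * real (Suc D)" using e by (intro mult_left_mono) auto
    finally show ?thesis by (simp add: field_simps)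
  qed
  obtain N0 :: nat where N0: "real N0 > 2 * real D / e" using reals_Archimedean2 by blast
  show "\<exists>no. \<forall>n\<ge>no. norm (real_of_int (\<Sum>n\<in>{1..n}. \<Sum>d | d dvd n. chi (int d)) / real n - L1) < e"
  proof (intro exI allI impI)
    fix N assume "N \<ge> max N0 (Suc D)"
    hence N: "N \<ge> N0" "N > D" by auto
    hence Npos: "real N > 0" by simp
    have split: "{1..N} = {1..<Suc D} \<union> {Suc D..<Suc N}" "{1..<Suc D} \<inter> {Suc D..<Suc N} = {}" using N by auto
    have "real_of_int (\<Sum>n\<in>{1..N}. \<Sum>d | d dvd n. chi (int d)) = (\<Sum>d\<in>{1..N}. chi (int d) * real (N div d))"
      unfolding sum_atLeastLessThan_div by simp
    also have "\<dots> = (\<Sum>d\<in>{1..<Suc D}. chi (int d) * real (N div d)) + (\<Sum>d\<in>{Suc D..<Suc N}. chi (int d) * real (N div d))"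
      unfolding split(1) by (rule sum.union_disjoint) (use split(2) in auto)
    finally have T: "real_of_int (\<Sum>n\<in>{1..N}. \<Sum>d | d dvd n. chi (int d)) =
      (\<Sum>d\<in>{1..<Suc D}. chi (int d) * real (N div d)) + (\<Sum>d\<in>{Suc D..<Suc N}. chi (int d) * real (N div d))" .
    have "\<bar>\<Sum>d\<in>{Suc D..<Suc N}. chi (int d) * real (N div d)\<bar> \<le> 2 * real p * real (N div Suc D)"
      using N by (intro chi_weighted_sum_bound) (auto intro: div_le_mono2)
    also have "\<dots> \<le> 2 * real p * (real N / real (Suc D))"
      by (intro mult_left_mono of_nat_div_le_of_nat) auto
    finally have a: "\<bar>\<Sum>d\<in>{Suc D..<Suc N}. chi (int d) * real (N div d)\<bar> \<le> 2 * real p * (real N / real (Suc D))" .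
    have "\<bar>(\<Sum>d\<in>{1..<Suc D}. chi (int d) * real (N div d)) - real N * (\<Sum>d\<in>{1..<Suc D}. chi (int d) / real d)\<bar>
        = \<bar>\<Sum>d\<in>{1..<Suc D}. chi (int d) * (real (N div d) - real N / real d)\<bar>"
      unfolding sum_distrib_left sum_subtractf[symmetric]
      by (intro arg_cong[of _ _ abs] sum.cong refl) (simp add: right_diff_distrib)
    also have "\<dots> \<le> (\<Sum>d\<in>{1..<Suc D}. 1)"
    proof (intro order_trans[OF sum_abs] sum_mono)
      fix d assume d: "d \<in> {1..<Suc D}"
      have "real (N div d) \<le> real N / real d" by (rule of_nat_div_le_of_nat)
      moreover have "\<lfloor>real N / real d\<rfloor> = int (N div d)" by (rule floor_divide_of_nat_eq)
      hence "real N / real d - real (N div d) \<le> 1" by linarith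
      ultimately have "\<bar>real (N div d) - real N / real d\<bar> \<le> 1" by linarith
      moreover have "\<bar>real_of_int (chi (int d))\<bar> \<le> 1" using abs_chi_le[of "int d"] by linarith
      ultimately show "\<bar>chi (int d) * (real (N div d) - real N / real d)\<bar> \<le> 1"
        unfolding abs_mult by (intro mult_le_one) auto
    qed
    finally have b: "\<bar>(\<Sum>d\<in>{1..<Suc D}. chi (int d) * real (N div d)) - real N * (\<Sum>d\<in>{1..<Suc D}. chi (int d) / real d)\<bar> \<le> real D"
      by simp
    have "(\<Sum>i<Suc D. chi (int i) / real i) = (\<Sum>d\<in>{1..<Suc D}. chi (int d) / real d)"
      by (rule sum.mono_neutral_right) (auto simp: Suc_le_eq)
    hence c: "\<bar>L1 - (\<Sum>d\<in>{1..<Suc D}. chi (int d) / real d)\<bar> \<le> 2 * real p / real (Suc D)"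
      using chi_power_tail_bound[of "Suc D" 1] unfolding L1_def by simp
    define u where "u = (\<Sum>d\<in>{1..<Suc D}. chi (int d) / real d)"
    define v where "v = (\<Sum>d\<in>{1..<Suc D}. chi (int d) * real (N div d))"
    define w where "w = (\<Sum>d\<in>{Suc D..<Suc N}. chi (int d) * real (N div d))"
    have "norm (real_of_int (\<Sum>n\<in>{1..N}. \<Sum>d | d dvd n. chi (int d)) / real N - L1) =
        \<bar>(v - real N * u) / real N + w / real N - (L1 - u)\<bar>"
      unfolding T v_def[symmetric] w_def[symmetric] using Npos by (simp add: field_simps)
    also have "\<dots> \<le> \<bar>v - real N * u\<bar> / real N + \<bar>w\<bar> / real N + \<bar>L1 - u\<bar>"
    proof -
      have "\<bar>x / real N\<bar> = \<bar>x\<bar> / real N" for x using Npos by simp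
      thus ?thesis by (metis (no_types, lifting) abs_triangle_ineq abs_triangle_ineq4 add_right_mono order_trans)
    qed
    also have "\<dots> \<le> real D / real N + 2 * real p * (real N / real (Suc D)) / real N + 2 * real p / real (Suc D)"
      using a b c Npos unfolding u_def[symmetric] v_def[symmetric] w_def[symmetric]
      by (intro add_mono divide_right_mono) auto
    also have "\<dots> = real D / real N + 4 * real p / real (Suc D)" using Npos by simp
    also have "\<dots> < e / 2 + e / 2"
    proof (rule add_strict_mono)
      have "2 * real D / e < real N" using N0 N by linarith
      thus "real D / real N < e / 2" using e Npos by (simp add: field_simps)
    qed (rule D8)
    finally show "norm (real_of_int (\<Sum>n\<in>{1..N}. \<Sum>d | d dvd n. chi (int d)) / real N - L1) < e" by simp
  qed
qed

section \<open>The class number formula\<close>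

definition ideals_upto :: "nat \<Rightarrow> real set set" where
  "ideals_upto n = {I \<in> nonzero_ideals p. Nm I \<le> real n}"

lemma ideals_upto_card:
  "finite (ideals_upto N)" "int (card (ideals_upto N)) = (\<Sum>n\<in>{1..N}. chi_divisor_sum n)"
proof -
  let ?S = "\<lambda>n. {(g, a, b) \<in> triples. g\<^sup>2 * a = int n}"
  have eq: "ideals_upto N = ideal_of ` (\<Union>n\<in>{1..N}. ?S n)"
  proof (intro equalityI subsetI)
    fix I assume "I \<in> ideals_upto N"
    hence I: "I \<in> nonzero_ideals p" "Nm I \<le> real N" unfolding ideals_upto_def by auto
    obtain g a b where gab: "(g, a, b) \<in> triples" "I = ideal_of (g, a, b)"
      using nonzero_ideal_triple[OF I(1)] .
    have pos: "g > 0" "a > 0" using gab unfolding triples_def by auto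
    have "real_of_int (g\<^sup>2 * a) \<le> real_of_int (int N)" using I(2) Nm_ideal_of[OF gab(1)] gab(2) by simp
    hence le: "g\<^sup>2 * a \<le> int N" by (simp only: of_int_le_iff)
    moreover have gp: "g\<^sup>2 * a > 0" using pos by simp
    ultimately have "nat (g\<^sup>2 * a) \<in> {1..N}" by auto
    moreover have "(g, a, b) \<in> ?S (nat (g\<^sup>2 * a))" using gab(1) gp by simp
    ultimately show "I \<in> ideal_of ` (\<Union>n\<in>{1..N}. ?S n)" using gab(2) by blast
  next
    fix I assume "I \<in> ideal_of ` (\<Union>n\<in>{1..N}. ?S n)"
    then obtain g a b n where gab: "(g, a, b) \<in> triples" "I = ideal_of (g, a, b)" "g\<^sup>2 * a = int n" "n \<le> N"
      by auto
    have "Nm I = real n" unfolding gab(2) Nm_ideal_of[OF gab(1)] gab(3) by simp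
    thus "I \<in> ideals_upto N" using gab ideal_of_nonzero_ideal unfolding ideals_upto_def by simp
  qed
  have fin: "finite (\<Union>n\<in>{1..N}. ?S n)" by (intro finite_UN_I card_triples_norm(1)) auto
  thus "finite (ideals_upto N)" unfolding eq by (rule finite_imageI)
  have "inj_on ideal_of (\<Union>n\<in>{1..N}. ?S n)"
    using bij_ideal_of unfolding bij_betw_def by (elim conjE inj_on_subset) auto
  hence "card (ideals_upto N) = card (\<Union>n\<in>{1..N}. ?S n)" unfolding eq by (rule card_image)
  also have "\<dots> = (\<Sum>n\<in>{1..N}. card (?S n))"
    by (intro card_UN_disjoint ballI impI card_triples_norm(1)) auto
  finally have "int (card (ideals_upto N)) = (\<Sum>n\<in>{1..N}. int (card (?S n)))" by simp
  also have "\<dots> = (\<Sum>n\<in>{1..N}. chi_divisor_sum n)" by (intro sum.cong refl card_triples_norm(2)) auto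
  finally show "int (card (ideals_upto N)) = (\<Sum>n\<in>{1..N}. chi_divisor_sum n)" .
qed

lemma ideals_upto_limit: "(\<lambda>n. real (card (ideals_upto (Suc n))) / real (Suc n)) \<longlonglongrightarrow> L1"
proof -
  have "real (card (ideals_upto N)) = (\<Sum>n\<in>{1..N}. \<Sum>d | d dvd n. chi (int d))" for N
    using ideals_upto_card(2)[of N] unfolding chi_divisor_sum_def by (metis of_int_of_nat_eq)
  thus ?thesis using LIMSEQ_Suc[OF chi_divisor_sums_limit] by simp
qed

definition class_density :: real where "class_density = 2 * ln eps / rt"

lemma class_density_pos: "class_density > 0"
  unfolding class_density_def using eps(2) rt_pos by simp

text \<open>For a representative of norm a, ideals of norm at most X correspond to lattice points
  with u |v| <= a X in a lattice of covolume a rt. The factor a cancels, so every class has the same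
  density. The shift to \<open>Suc n\<close> keeps the norm bound at least 1.\<close>

lemma class_count_limit:
  assumes "Q \<in> nonzero_ideals p // ideal_class_rel p"
  shows "(\<lambda>n. real (card (Q \<inter> ideals_upto (Suc n))) / real (Suc n)) \<longlonglongrightarrow> class_density"
proof -
  obtain J0 where J0: "J0 \<in> nonzero_ideals p" "Q = ideal_class_rel p `` {J0}"
    using assms by (elim quotientE)
  obtain a b where ab: "(1, a, b) \<in> triples" "(J0, ideal_of (1, a, b)) \<in> ideal_class_rel p"
    using ideal_class_primitive_rep[OF J0(1)] .
  define J where "J = ideal_of (1, a, b)"
  have sym: "sym (ideal_class_rel p)" using equiv_ideal_class_rel unfolding equiv_def by blast
  have "Q = ideal_class_rel p `` {J}"
    unfolding J0(2) J_def using equiv_class_eq[OF equiv_ideal_class_rel ab(2)] .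
  hence Q: "Q = {I. (I, J) \<in> ideal_class_rel p}" using sym by (auto dest: symD)
  have a0: "a > 0" using ab(1) unfolding triples_def by simp
  define f where "f = (\<lambda>(x, y). real_of_int x * of_int a + of_int y * (om - of_int b - 1))"
  define D where "D = {(x, y). 0 < f (x, y) \<and> \<bar>con (f (x, y))\<bar> \<le> f (x, y) \<and> f (x, y) < eps\<^sup>2 * \<bar>con (f (x, y))\<bar>}"
  define F where "F = (\<lambda>xy. (*) (f xy / of_int a) ` J)"
  have bij: "bij_betw F D Q" and Nm: "\<And>xy. xy \<in> D \<Longrightarrow> Nm (F xy) = \<bar>f xy * con (f xy)\<bar> / of_int a"
    using bij_ideal_class[OF ab(1)] unfolding Q F_def f_def D_def J_def by auto
  have conf: "con (f (x, y)) = of_int a * of_int x + (- om - of_int b) * of_int y" for x y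
  proof -
    have "f (x, y) = el (x * a - y * (b + 1)) y" unfolding f_def el_def by (simp add: algebra_simps)
    thus ?thesis by (simp add: con_el algebra_simps)
  qed
  have feq: "f (x, y) = of_int a * of_int x + (om - of_int b - 1) * of_int y" for x y
    unfolding f_def by (simp add: algebra_simps)
  define P where "P n = {(i :: int, j :: int). let u = of_int a * of_int i + (om - of_int b - 1) * of_int j;
      v = of_int a * of_int i + (- om - of_int b) * of_int j
     in 0 < u \<and> \<bar>v\<bar> \<le> u \<and> u < eps\<^sup>2 * \<bar>v\<bar> \<and> u * \<bar>v\<bar> \<le> of_int a * real (Suc n)}" for n
  have card: "card (Q \<inter> ideals_upto (Suc n)) = card (P n)" for n
  proof -
    have P: "P n = {xy \<in> D. Nm (F xy) \<le> real (Suc n)}"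
    proof (unfold set_eq_iff, rule allI)
      fix xy :: "int \<times> int"
      obtain x y where xy: "xy = (x, y)" by fastforce
      define u v where "u = f xy" and "v = con (f xy)"
      have "xy \<in> P n \<longleftrightarrow> 0 < u \<and> \<bar>v\<bar> \<le> u \<and> u < eps\<^sup>2 * \<bar>v\<bar> \<and> u * \<bar>v\<bar> \<le> of_int a * real (Suc n)"
        unfolding P_def xy u_def v_def conf unfolding feq Let_def by simp
      also have "\<dots> \<longleftrightarrow> xy \<in> D \<and> \<bar>u * v\<bar> / of_int a \<le> real (Suc n)"
        using a0 unfolding D_def xy u_def v_def by (auto simp: abs_mult field_simps)
      finally show "xy \<in> P n \<longleftrightarrow> xy \<in> {xy \<in> D. Nm (F xy) \<le> real (Suc n)}"
        using Nm[of xy] unfolding u_def v_def by auto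
    qed
    have "Q \<inter> ideals_upto (Suc n) = {I \<in> Q. Nm I \<le> real (Suc n)}"
      unfolding ideals_upto_def Q ideal_class_rel_iff by auto
    also have "\<dots> = F ` {xy \<in> D. Nm (F xy) \<le> real (Suc n)}"
      using bij unfolding bij_betw_def by auto
    also have "card \<dots> = card {xy \<in> D. Nm (F xy) \<le> real (Suc n)}"
      using bij unfolding bij_betw_def by (intro card_image) (auto elim: inj_on_subset)
    finally show ?thesis unfolding P .
  qed
  have "(\<lambda>n. real (card (P n)) / (of_int a * real (Suc n))) \<longlonglongrightarrow>
      2 * ln eps / (of_int a * \<bar>(- om - of_int b) - (om - of_int b - 1)\<bar>)"
    unfolding P_def
  proof (rule hyperbola_lattice_count(2))
    have "om > 1" unfolding om_def using rt_gt_2 by simp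
    thus "om - of_int b - 1 \<noteq> - om - of_int b" by simp
    show "filterlim (\<lambda>n. of_int a * real (Suc n)) at_top sequentially"
      using a0 by (intro filterlim_tendsto_pos_mult_at_top[OF tendsto_const]
          filterlim_compose[OF filterlim_real_sequentially filterlim_Suc]) auto
    show "1 \<le> real_of_int a * real (Suc n)" for n
    proof -
      have "1 * 1 \<le> real_of_int a * real (Suc n)" using a0 by (intro mult_mono) auto
      thus ?thesis by simp
    qed
  qed (use a0 eps(2) in auto)
  also have "(- om - of_int b) - (om - of_int b - 1) = - rt" unfolding om_def by (simp add: field_simps)
  finally have "(\<lambda>n. of_int a * (real (card (P n)) / (of_int a * real (Suc n)))) \<longlonglongrightarrow>
      of_int a * (2 * ln eps / (of_int a * \<bar>- rt\<bar>))" by (intro tendsto_mult_left)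
  moreover have "of_int a * (2 * ln eps / (of_int a * \<bar>- rt\<bar>)) = class_density"
    unfolding class_density_def using a0 rt_pos by simp
  moreover have "of_int a * (real (card (P n)) / (of_int a * real (Suc n))) =
      real (card (Q \<inter> ideals_upto (Suc n))) / real (Suc n)" for n
    unfolding card using a0 by (simp del: of_nat_Suc)
  ultimately show ?thesis by simp
qed

text \<open>Two evaluations of the density of all ideals ordered by norm: as a sum of equal class
  densities, and as the mean value of the divisor sums of chi.\<close>

theorem class_number_formula: "class_number p * class_density = L1"
proof -
  let ?C = "nonzero_ideals p // ideal_class_rel p"
  let ?c = "\<lambda>Q n. real (card (Q \<inter> ideals_upto (Suc n))) / real (Suc n)"
  have disj: "(Q \<inter> ideals_upto n) \<inter> (Q' \<inter> ideals_upto n) = {}" if "Q \<in> ?C" "Q' \<in> ?C" "Q \<noteq> Q'" for Q Q' n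
    using quotient_disj[OF equiv_ideal_class_rel that(1,2)] that(3) by blast
  have card_UN: "card (\<Union>Q\<in>F. Q \<inter> ideals_upto n) = (\<Sum>Q\<in>F. card (Q \<inter> ideals_upto n))"
    if "finite F" "F \<subseteq> ?C" for F n
  proof (intro card_UN_disjoint ballI impI)
    show "finite F" by (rule that(1))
    show "finite (Q \<inter> ideals_upto n)" for Q using ideals_upto_card(1) by blast
    show "(Q \<inter> ideals_upto n) \<inter> (Q' \<inter> ideals_upto n) = {}" if "Q \<in> F" "Q' \<in> F" "Q \<noteq> Q'" for Q Q'
      using disj[of Q Q' n] that \<open>F \<subseteq> ?C\<close> by blast
  qed
  have lim: "(\<lambda>n. \<Sum>Q\<in>F. ?c Q n) \<longlonglongrightarrow> real (card F) * class_density" if "F \<subseteq> ?C" for F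
  proof -
    have "(\<lambda>n. \<Sum>Q\<in>F. ?c Q n) \<longlonglongrightarrow> (\<Sum>Q\<in>F. class_density)"
      using that by (intro tendsto_sum class_count_limit) auto
    thus ?thesis by simp
  qed
  have le: "real (card F) * class_density \<le> L1" if F: "finite F" "F \<subseteq> ?C" for F
  proof (rule LIMSEQ_le[OF lim[OF F(2)] ideals_upto_limit])
    show "\<exists>N. \<forall>n\<ge>N. (\<Sum>Q\<in>F. ?c Q n) \<le> real (card (ideals_upto (Suc n))) / real (Suc n)"
    proof (intro exI allI impI)
      fix n :: nat
      have "card (\<Union>Q\<in>F. Q \<inter> ideals_upto (Suc n)) \<le> card (ideals_upto (Suc n))"
        by (intro card_mono ideals_upto_card(1)) auto
      hence "real (\<Sum>Q\<in>F. card (Q \<inter> ideals_upto (Suc n))) \<le> real (card (ideals_upto (Suc n)))"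
        unfolding card_UN[OF F] by (simp only: of_nat_le_iff)
      hence "real (\<Sum>Q\<in>F. card (Q \<inter> ideals_upto (Suc n))) / real (Suc n) \<le> real (card (ideals_upto (Suc n))) / real (Suc n)"
        by (intro divide_right_mono) auto
      thus "(\<Sum>Q\<in>F. ?c Q n) \<le> real (card (ideals_upto (Suc n))) / real (Suc n)"
        by (simp add: sum_divide_distrib)
    qed
  qed
  \<comment> \<open>Finiteness of the class group: disjoint classes of equal positive density fit
    only boundedly often into the total density L1.\<close>
  have "card F \<le> nat \<lfloor>L1 / class_density\<rfloor>" if "finite F" "F \<subseteq> ?C" for F
  proof -
    have "real (card F) \<le> L1 / class_density" using le[OF that] class_density_pos by (simp add: field_simps)
    thus ?thesis by (simp add: le_nat_floor)
  qed
  hence fin: "finite ?C" by (intro conjunct1[OF finite_if_finite_subsets_card_bdd]) blast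
  have U: "(\<Union>Q\<in>?C. Q \<inter> ideals_upto n) = ideals_upto n" for n
  proof -
    have "ideals_upto n \<subseteq> \<Union> ?C"
      unfolding Union_quotient[OF equiv_ideal_class_rel] ideals_upto_def by auto
    thus ?thesis by blast
  qed
  have "(\<Sum>Q\<in>?C. ?c Q n) = real (card (ideals_upto (Suc n))) / real (Suc n)" for n
  proof -
    have "real (\<Sum>Q\<in>?C. card (Q \<inter> ideals_upto (Suc n))) / real (Suc n) = real (card (ideals_upto (Suc n))) / real (Suc n)"
      using card_UN[OF fin order_refl, of "Suc n"] unfolding U by simp
    thus ?thesis by (simp add: sum_divide_distrib)
  qed
  hence "(\<lambda>n. real (card (ideals_upto (Suc n))) / real (Suc n)) \<longlonglongrightarrow> real (card ?C) * class_density"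
    using lim[OF order_refl] by simp
  thus ?thesis unfolding class_number_def by (rule LIMSEQ_unique[OF _ ideals_upto_limit])
qed

section \<open>The Gauss sum\<close>

definition ez :: "int \<Rightarrow> complex" where "ez k = cis (2 * pi * of_int k / real p)"

lemma ez_add: "ez (a + b) = ez a * ez b"
  unfolding ez_def cis_mult by (simp add: add_divide_distrib algebra_simps)

lemma ez_0 [simp]: "ez 0 = 1" unfolding ez_def by simp

lemma ez_mult_p [simp]: "ez (int p * k) = 1"
proof -
  have "2 * pi * of_int (int p * k) / real p = 2 * pi * of_int k" using p_ge_5 by simp
  thus ?thesis unfolding ez_def by (simp only:) (simp add: cis_multiple_2pi)
qed

lemma ez_cong: assumes "[a = b] (mod int p)" shows "ez a = ez b"
proof -
  obtain k where "a - b = int p * k" using assms unfolding cong_iff_dvd_diff by (elim dvdE)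
  hence "a = b + int p * k" by simp
  thus ?thesis using ez_add[of b "int p * k"] by simp
qed

lemma ez_mod [simp]: "ez (a mod int p) = ez a" by (rule ez_cong) simp

lemma ez_mult_mod [simp]: "ez (a * (b mod int p)) = ez (a * b)" "ez ((b mod int p) * a) = ez (b * a)"
  by (rule ez_cong; simp add: icong_def mod_simps)+

lemma ez_minus: "ez (- a) = cnj (ez a)" unfolding ez_def by (simp add: cis_cnj)

lemma norm_ez [simp]: "norm (ez a) = 1" unfolding ez_def by simp

lemma ez_eq_1_iff: "ez a = 1 \<longleftrightarrow> int p dvd a"
proof
  assume "ez a = 1"
  hence "cos (2 * pi * of_int a / real p) = 1" unfolding ez_def by (simp add: complex_eq_iff)
  then obtain n :: int where "2 * pi * of_int a / real p = of_int n * 2 * pi"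
    unfolding cos_one_2pi_int by blast
  hence "real_of_int a = of_int (int p * n)" using p_ge_5 by (simp add: field_simps)
  hence "a = int p * n" by (simp only: of_int_eq_iff)
  thus "int p dvd a" by simp
next
  assume "int p dvd a"
  thus "ez a = 1" by (elim dvdE) simp
qed

lemma ez_power: "ez a ^ k = ez (a * int k)"
  by (induction k) (auto simp: ez_add[symmetric] algebra_simps)

lemma sum_ez: "(\<Sum>k\<in>{0..<int p}. ez (a * k)) = (if int p dvd a then of_nat p else 0)"
proof -
  have e: "(\<Sum>k\<in>{0..<int p}. ez (a * k)) = (\<Sum>k<p. ez a ^ k)"
    by (rule sum.reindex_bij_witness[of _ int nat]) (auto simp: ez_power)
  show ?thesis
  proof (cases "int p dvd a")
    case True
    hence "ez a = 1" using ez_eq_1_iff by blast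
    thus ?thesis using e True by simp
  next
    case False
    hence "ez a \<noteq> 1" using ez_eq_1_iff by blast
    moreover have "ez a ^ p = 1" using ez_mult_p[of a] by (simp add: ez_power mult.commute)
    ultimately show ?thesis using e False by (simp add: geometric_sum)
  qed
qed

definition tau :: complex where "tau = (\<Sum>b\<in>{0..<int p}. of_int (chi b) * ez b)"

lemma gauss_sum_twist: "(\<Sum>b\<in>{0..<int p}. of_int (chi b) * ez (b * n)) = of_int (chi n) * tau"
proof (cases "int p dvd n")
  case True
  hence "ez (b * n) = 1" for b using ez_eq_1_iff by simp
  hence "(\<Sum>b\<in>{0..<int p}. of_int (chi b) * ez (b * n)) = of_int (\<Sum>b\<in>{0..<int p}. chi b)" by simp
  thus ?thesis using sum_chi True chi_eq_0_iff[of n] by simp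
next
  case False
  hence cn: "chi n * chi n = 1" using chi_cases[of n] chi_eq_0_iff[of n] by auto
  have "tau = (\<Sum>b\<in>{0..<int p}. of_int (chi (n * b mod int p)) * ez (n * b mod int p))"
    unfolding tau_def by (rule sum.reindex_bij_betw[OF bij_betw_mult_mod[OF False], symmetric])
  also have "\<dots> = (\<Sum>b\<in>{0..<int p}. of_int (chi n) * (of_int (chi b) * ez (b * n)))"
    by (intro sum.cong refl) (simp add: chi_mult mult.commute)
  also have "\<dots> = of_int (chi n) * (\<Sum>b\<in>{0..<int p}. of_int (chi b) * ez (b * n))"
    by (simp add: sum_distrib_left)
  finally have "of_int (chi n) * tau = of_int (chi n * chi n) * (\<Sum>b\<in>{0..<int p}. of_int (chi b) * ez (b * n))"
    by (simp add: mult.assoc)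
  thus ?thesis unfolding cn by simp
qed

text \<open>Summing the squares of all twisted sums in two ways: the twist formula gives (p - 1)
  tau^2, and orthogonality of the exponentials, which keeps only c = -b, gives (p - 1) p.\<close>

lemma tau_square: "tau * tau = of_nat p"
proof -
  have cc: "(\<Sum>b\<in>{0..<int p}. chi b * chi b) = int p - 1"
  proof -
    have "(\<Sum>b\<in>{0..<int p}. chi b * chi b) = (\<Sum>b\<in>{0..<int p} - {0}. chi b * chi b)"
      using chi_eq_0_iff[of 0] p_ge_5 by (intro sum.mono_neutral_right) auto
    also have "\<dots> = (\<Sum>b\<in>{0..<int p} - {0}. 1)"
    proof (intro sum.cong refl)
      fix b assume "b \<in> {0..<int p} - {0}"
      hence "\<not> int p dvd b" by (auto dest: zdvd_imp_le)
      thus "chi b * chi b = 1" using chi_cases[of b] chi_eq_0_iff[of b] by auto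
    qed
    also have "\<dots> = int p - 1" using p_ge_5 by (simp add: of_nat_diff)
    finally show ?thesis .
  qed
  have "of_int (\<Sum>b\<in>{0..<int p}. chi b * chi b) * (tau * tau) =
      (\<Sum>n\<in>{0..<int p}. (of_int (chi n) * tau) * (of_int (chi n) * tau))"
    unfolding of_int_sum sum_distrib_right by (intro sum.cong refl) (simp add: mult_ac)
  also have "(\<Sum>n\<in>{0..<int p}. (of_int (chi n) * tau) * (of_int (chi n) * tau)) =
    (\<Sum>n\<in>{0..<int p}. (\<Sum>b\<in>{0..<int p}. of_int (chi b) * ez (b * n)) * (\<Sum>c\<in>{0..<int p}. of_int (chi c) * ez (c * n)))"
    by (simp only: gauss_sum_twist)
  also have "\<dots> = (\<Sum>n\<in>{0..<int p}. \<Sum>b\<in>{0..<int p}. \<Sum>c\<in>{0..<int p}. of_int (chi b * chi c) * ez ((b + c) * n))"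
    by (simp add: sum_product ez_add[symmetric] algebra_simps)
  also have "\<dots> = (\<Sum>b\<in>{0..<int p}. \<Sum>c\<in>{0..<int p}. of_int (chi b * chi c) * (\<Sum>n\<in>{0..<int p}. ez ((b + c) * n)))"
  proof -
    let ?F = "\<lambda>n b c. of_int (chi b * chi c) * ez ((b + c) * n)"
    have "(\<Sum>n\<in>{0..<int p}. \<Sum>b\<in>{0..<int p}. \<Sum>c\<in>{0..<int p}. ?F n b c) =
        (\<Sum>b\<in>{0..<int p}. \<Sum>n\<in>{0..<int p}. \<Sum>c\<in>{0..<int p}. ?F n b c)" by (rule sum.swap)
    also have "\<dots> = (\<Sum>b\<in>{0..<int p}. \<Sum>c\<in>{0..<int p}. \<Sum>n\<in>{0..<int p}. ?F n b c)"
      by (intro sum.cong refl sum.swap)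
    finally show ?thesis by (simp only: sum_distrib_left)
  qed
  also have "\<dots> = (\<Sum>b\<in>{0..<int p}. \<Sum>c\<in>{0..<int p}. of_int (chi b * chi c) * (if c = (- b) mod int p then of_nat p else 0))"
  proof (intro sum.cong refl)
    fix b c assume bc: "b \<in> {0..<int p}" "c \<in> {0..<int p}"
    have "int p dvd b + c \<longleftrightarrow> c mod int p = (- b) mod int p"
      unfolding mod_eq_dvd_iff by (simp add: add.commute)
    hence "int p dvd b + c \<longleftrightarrow> c = (- b) mod int p" using bc by simp
    thus "of_int (chi b * chi c) * (\<Sum>n\<in>{0..<int p}. ez ((b + c) * n)) =
      of_int (chi b * chi c) * (if c = (- b) mod int p then of_nat p else (0 :: complex))"
      unfolding sum_ez by simp
  qed
  also have "\<dots> = (\<Sum>b\<in>{0..<int p}. of_int (chi b * chi b) * of_nat p)"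
  proof (intro sum.cong refl)
    fix b :: int
    have "(- b) mod int p \<in> {0..<int p}" using p_ge_5 by simp
    thus "(\<Sum>c\<in>{0..<int p}. of_int (chi b * chi c) * (if c = (- b) mod int p then of_nat p else 0)) =
        (of_int (chi b * chi b) * of_nat p :: complex)"
      by (simp add: if_distrib[of "\<lambda>x. _ * x"] sum.delta cong: if_cong)
  qed
  also have "\<dots> = of_int (\<Sum>b\<in>{0..<int p}. chi b * chi b) * of_nat p" by (simp add: sum_distrib_right)
  finally have "of_int (\<Sum>b\<in>{0..<int p}. chi b * chi b) * (tau * tau) =
      of_int (\<Sum>b\<in>{0..<int p}. chi b * chi b) * (of_nat p :: complex)" .
  moreover have "of_int (int p - 1) \<noteq> (0 :: complex)" using p_ge_5 by (simp only: of_int_eq_0_iff)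
  ultimately show ?thesis unfolding cc by simp
qed

lemma tau_real: "cnj tau = tau"
proof -
  have "cnj tau = (\<Sum>b\<in>{0..<int p}. of_int (chi b) * ez (b * (-1)))"
    unfolding tau_def by (simp add: ez_minus)
  thus ?thesis unfolding gauss_sum_twist by simp
qed

lemma tau_eq_Re: "tau = of_real (Re tau)" "(Re tau)\<^sup>2 = real p"
proof -
  have "Im tau = 0" using tau_real by (simp add: complex_eq_iff)
  thus t: "tau = of_real (Re tau)" by (simp add: complex_eq_iff)
  have "of_real ((Re tau)\<^sup>2) = (of_real (real p) :: complex)"
    using tau_square t by (metis of_real_mult of_real_of_nat_eq power2_eq_square)
  thus "(Re tau)\<^sup>2 = real p" by (simp only: of_real_eq_iff)
qed

lemma sum_ez_squares:
  assumes "\<not> int p dvd s" shows "(\<Sum>k\<in>{0..<int p}. ez (s * k\<^sup>2)) = of_int (chi s) * tau"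
proof -
  have "periodic (\<lambda>x. ez (s * x))"
    unfolding periodic_def by (intro allI impI ez_cong cong_mult cong_refl)
  from sum_periodic_squares[OF this]
  have "(\<Sum>k\<in>{0..<int p}. ez (s * k\<^sup>2)) =
      (\<Sum>a\<in>{0..<int p}. ez (s * a)) + (\<Sum>a\<in>{0..<int p}. of_int (chi a) * ez (a * s))"
    by (simp add: sum.distrib algebra_simps)
  thus ?thesis using assms unfolding sum_ez gauss_sum_twist by simp
qed

end

section \<open>The sign of the Gauss sum\<close>

lemma jordan_sine_bound:
  fixes x :: real
  assumes "0 \<le> x" "x \<le> pi / 2" shows "2 / pi * x \<le> sin x"
proof -
  have "concave_on {0..pi / 2} sin"
  proof (rule f''_le0_imp_concave)
    show "DERIV sin y :> cos y" "DERIV cos y :> - sin y" for y :: real by (rule DERIV_sin, rule DERIV_cos)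
    show "- sin y \<le> 0" if "y \<in> {0..pi / 2}" for y :: real
      using that by (simp add: sin_ge_zero)
  qed simp
  hence "sin ((1 - 2 / pi * x) *\<^sub>R 0 + (2 / pi * x) *\<^sub>R (pi / 2)) \<ge>
      (1 - 2 / pi * x) * sin 0 + (2 / pi * x) * sin (pi / 2)"
    by (rule concave_onD) (use assms in \<open>auto simp: field_simps\<close>)
  thus ?thesis by simp
qed

context prime_one_mod_four
begin

text \<open>Summing \<open>\<zeta>\<^bsup>s k^2\<^esup>\<close> with \<open>s = 1/2\<close> modulo \<open>p\<close> gives, for \<open>p \<equiv> 5\<close> modulo \<open>8\<close>, a trigonometric sum with a
  single stationary point, at \<open>2 k = p\<close>.\<close>
lemma tau_cos_sum:
  assumes "p mod 8 = 5"
  shows "Re tau = (\<Sum>k\<in>{1..p}. cos (pi * (2 * real k - real p)\<^sup>2 / (4 * real p) - pi / 4))"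
proof -
  \<comment> \<open>An inverse of 2 modulo p, so chi s = chi 2 = -1. It changes the phase 2 pi s k^2
    / p into pi k^2 / p + k^2 pi, of half the frequency.\<close>
  define s where "s = (int p + 1) div 2"
  have s2: "2 * s = int p + 1" unfolding s_def using odd_p by presburger
  have "odd (p div 4)" using assms by presburger
  hence c2: "chi 2 = -1" using chi_two by simp
  have "chi (2 * s) = 1" unfolding s2 using chi_cong[of "int p + 1" 1] by (simp add: icong_def)
  hence cs: "chi s = -1" using c2 by (simp add: chi_mult)
  hence nd: "\<not> int p dvd s" using chi_eq_0_iff[of s] by simp
  obtain j where j: "p = 8 * j + 5" using assms by (metis div_mult_mod_eq mult.commute)
  have trm: "Re (ez (s * (int k)\<^sup>2)) = - cos (pi * (2 * real k - real p)\<^sup>2 / (4 * real p) - pi / 4)" for k :: nat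
  proof -
    have p0: "real p > 0" using p_ge_5 by simp
    have "real_of_int (2 * s) = real_of_int (int p + 1)" unfolding s2 ..
    hence s': "real_of_int s = (real p + 1) / 2" by simp
    have a: "2 * pi * of_int (s * (int k)\<^sup>2) / real p = pi * (real k)\<^sup>2 / real p + of_nat (k\<^sup>2) * pi"
      using p0 by (simp add: s' field_simps)
    have parity: "even (k\<^sup>2) = even k" by simp
    \<comment> \<open>Completing the square about k = p / 2 shifts the phase by k pi and by (p - 1)
      pi / 4; with p = 8 j + 5 the latter is an odd multiple of pi. The resulting sign cancels chi s
      = -1.\<close>
    have b: "pi * (2 * real k - real p)\<^sup>2 / (4 * real p) - pi / 4 = (pi * (real k)\<^sup>2 / real p - of_nat k * pi) + of_nat (2 * j + 1) * pi"
    proof -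
      have "pi * (2 * real k - real p)\<^sup>2 / (4 * real p) = pi * (real k)\<^sup>2 / real p - real k * pi + real p * pi / 4"
        using p0 by (simp add: field_simps power2_eq_square)
      moreover have "real p * pi / 4 - pi / 4 = of_nat (2 * j + 1) * pi" unfolding j by (simp add: field_simps)
      ultimately show ?thesis by linarith
    qed
    have sh: "cos (x + of_nat m * pi) = (-1) ^ m * cos x" for x :: real and m :: nat
      by (simp add: cos_add)
    have sh': "cos (x - of_nat m * pi) = (-1) ^ m * cos x" for x :: real and m :: nat
      by (simp add: cos_diff)
    have "Re (ez (s * (int k)\<^sup>2)) = (-1) ^ (k\<^sup>2) * cos (pi * (real k)\<^sup>2 / real p)"
      unfolding ez_def cis.sel a sh ..
    moreover have "cos (pi * (2 * real k - real p)\<^sup>2 / (4 * real p) - pi / 4) = - ((-1) ^ k * cos (pi * (real k)\<^sup>2 / real p))"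
      unfolding b sh sh' by simp
    moreover have "(-1 :: real) ^ (k\<^sup>2) = (-1) ^ k" using parity by (simp add: uminus_power_if)
    ultimately show ?thesis by simp
  qed
  have "of_int (chi s) * tau = (\<Sum>k\<in>{0..<int p}. ez (s * k\<^sup>2))" using sum_ez_squares[OF nd] by simp
  \<comment> \<open>The residue 0 is represented by p, so that k = 1, ..., p - 1 is symmetric about
    p / 2.\<close>
  also have "\<dots> = (\<Sum>k\<in>{1..p}. ez (s * (int k)\<^sup>2))"
  proof (rule sum.reindex_bij_witness[of _ "\<lambda>k. int k mod int p" "\<lambda>k. if k = 0 then p else nat k"])
    fix k assume "k \<in> {0..<int p}"
    have "s * (int p)\<^sup>2 = int p * (s * int p)" by (simp add: power2_eq_square)
    hence "ez (s * (int p)\<^sup>2) = 1" by (simp only: ez_mult_p)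
    thus "ez (s * (int (if k = 0 then p else nat k))\<^sup>2) = ez (s * k\<^sup>2)"
      using \<open>k \<in> _\<close> by (cases "k = 0") simp_all
  next
    fix b assume b: "b \<in> {1..p}"
    show "(if int b mod int p = 0 then p else nat (int b mod int p)) = b"
      using b by (cases "b = p") auto
  qed (use p_ge_5 in \<open>auto simp: nat_le_iff zmod_int[symmetric]\<close>)
  finally have "- tau = (\<Sum>k\<in>{1..p}. ez (s * (int k)\<^sup>2))" unfolding cs by simp
  hence "Re (- tau) = Re (\<Sum>k\<in>{1..p}. ez (s * (int k)\<^sup>2))" by simp
  hence "- Re tau = (\<Sum>k\<in>{1..p}. - cos (pi * (2 * real k - real p)\<^sup>2 / (4 * real p) - pi / 4))"
    by (simp only: Re_sum trm uminus_complex.sel)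
  thus ?thesis by (simp add: sum_negf)
qed

text \<open>The phase where 2 k - p is 2 i + 1 or its negative, i.e. at distance i + 1/2 from the
  stationary point p / 2.\<close>

definition gphase :: "nat \<Rightarrow> real" where
  "gphase i = pi * (2 * real i + 1)\<^sup>2 / (4 * real p) - pi / 4"

lemma tau_cos_half_sum:
  assumes "p mod 8 = 5"
  shows "Re tau = -1 + 2 * (\<Sum>i<(p - 1) div 2. cos (gphase i))"
proof -
  define n where "n = (p - 1) div 2"
  have p: "p = 2 * n + 1" unfolding n_def using odd_p by (auto elim: oddE)
  obtain j where j: "p = 8 * j + 5" using assms by (metis div_mult_mod_eq mult.commute)
  let ?c = "\<lambda>k :: nat. cos (pi * (2 * real k - real p)\<^sup>2 / (4 * real p) - pi / 4)"
  have set: "{1..p} = {1..n} \<union> {n + 1..2 * n} \<union> {p}" using p by auto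
  have "(\<Sum>k\<in>{1..p}. ?c k) = (\<Sum>k\<in>{1..n}. ?c k) + (\<Sum>k\<in>{n + 1..2 * n}. ?c k) + ?c p"
    unfolding set using p by (subst sum.union_disjoint, simp, simp, force, subst sum.union_disjoint) auto
  also have "(\<Sum>k\<in>{1..n}. ?c k) = (\<Sum>i<n. cos (gphase i))"
  proof (rule sum.reindex_bij_witness[of _ "\<lambda>i. n - i" "\<lambda>k. n - k"])
    fix k assume k: "k \<in> {1..n}"
    have "(2 * real k - real p)\<^sup>2 = (2 * real (n - k) + 1)\<^sup>2"
      using k p by (simp add: of_nat_diff power2_eq_square algebra_simps)
    thus "cos (gphase (n - k)) = ?c k" unfolding gphase_def by simp
  qed auto
  also have "(\<Sum>k\<in>{n + 1..2 * n}. ?c k) = (\<Sum>i<n. cos (gphase i))"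
  proof (rule sum.reindex_bij_witness[of _ "\<lambda>i. n + 1 + i" "\<lambda>k. k - (n + 1)"])
    fix k assume k: "k \<in> {n + 1..2 * n}"
    have "(2 * real k - real p)\<^sup>2 = (2 * real (k - (n + 1)) + 1)\<^sup>2"
      using k p by (simp add: of_nat_diff power2_eq_square algebra_simps)
    thus "cos (gphase (k - (n + 1))) = ?c k" unfolding gphase_def by simp
  qed auto
  \<comment> \<open>The unpaired term: its phase is (p - 1) pi / 4, an odd multiple of pi.\<close>
  also have "?c p = -1"
  proof -
    have "pi * (2 * real p - real p)\<^sup>2 / (4 * real p) - pi / 4 = real (2 * j + 1) * pi"
      unfolding j by (simp add: field_simps power2_eq_square)
    thus ?thesis by (simp only: cos_npi) simp
  qed
  finally show ?thesis unfolding tau_cos_sum[OF assms] n_def by simp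
qed

text \<open>A discrete first-derivative test: up to a constant of modulus 1, each term is c i times
  a difference of consecutive unimodular numbers \<open>E\<close>. The c i decrease, and the
  differences telescope to norm at most 2; Jordan's inequality estimates c M.\<close>

lemma gphase_tail_bound:
  assumes "M \<le> (p - 1) div 2"
  shows "\<bar>\<Sum>i\<in>{M..<(p - 1) div 2}. cos (gphase i)\<bar> \<le> real p / (2 * real M + 1)"
proof -
  define n where "n = (p - 1) div 2"
  have p: "p = 2 * n + 1" unfolding n_def using odd_p by (auto elim: oddE)
  have p0: "real p > 0" using p_ge_5 by simp
  define \<phi> where "\<phi> = pi / (4 * real p)"
  define E where "E i = cis (\<phi> * (2 * real i)\<^sup>2)" for i :: nat
  define c where "c i = 1 / (2 * sin (2 * \<phi> * (2 * real i + 1)))" for i :: nat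
  have ang: "0 < 2 * \<phi> * (2 * real i + 1)" "2 * \<phi> * (2 * real i + 1) \<le> pi / 2" if "i \<le> n" for i
  proof -
    show "0 < 2 * \<phi> * (2 * real i + 1)" unfolding \<phi>_def using p0 by simp
    have "2 * real i + 1 \<le> real p" using that p by simp
    hence "2 * \<phi> * (2 * real i + 1) \<le> 2 * \<phi> * real p" unfolding \<phi>_def using p0 by (intro mult_left_mono) auto
    also have "\<dots> = pi / 2" unfolding \<phi>_def using p0 by simp
    finally show "2 * \<phi> * (2 * real i + 1) \<le> pi / 2" .
  qed
  have sinpos: "sin (2 * \<phi> * (2 * real i + 1)) > 0" if "i \<le> n" for i
    using ang[OF that] by (intro sin_gt_zero) (auto intro: le_less_trans[of _ "pi / 2"])
  have step: "cis (gphase i) = (c i *\<^sub>R (E (Suc i) - E i)) * (cis (- \<phi> - pi / 4) / \<i>)" if "i \<le> n" for i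
  proof -
    \<comment> \<open>The odd square is the midpoint of two even ones: (2 i + 2)^2 and (2 i)^2 are
      (2 i + 1)^2 + 1 plus and minus 2 (2 i + 1). So the difference of \<open>E\<close> has the
      phase of term i up to a constant, and modulus twice the sine in c i.\<close>
    have e: "\<phi> * (2 * real (Suc i))\<^sup>2 = \<phi> * ((2 * real i + 1)\<^sup>2 + 1) + 2 * \<phi> * (2 * real i + 1)"
      "\<phi> * (2 * real i)\<^sup>2 = \<phi> * ((2 * real i + 1)\<^sup>2 + 1) + - (2 * \<phi> * (2 * real i + 1))"
      by (simp_all add: power2_eq_square algebra_simps)
    have ii: "a * \<i> * (b / \<i>) = a * b" for a b :: complex
    proof -
      have "a * \<i> * (b / \<i>) = \<i> * (a * b) / \<i>" by (simp only: times_divide_eq_right mult_ac)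
      thus ?thesis by (simp only: nonzero_mult_div_cancel_left[OF complex_i_not_zero])
    qed
    have cd: "cis x - cis (- x) = of_real (2 * sin x) * \<i>" for x by (simp add: complex_eq_iff)
    have "E (Suc i) - E i = cis (\<phi> * ((2 * real i + 1)\<^sup>2 + 1)) * (of_real (2 * sin (2 * \<phi> * (2 * real i + 1))) * \<i>)"
      unfolding E_def e cis_mult[symmetric] cd[symmetric] by (simp add: algebra_simps)
    hence "c i *\<^sub>R (E (Suc i) - E i) = cis (\<phi> * ((2 * real i + 1)\<^sup>2 + 1)) * \<i>"
      using sinpos[OF that] unfolding c_def by (simp add: scaleR_conv_of_real)
    hence "(c i *\<^sub>R (E (Suc i) - E i)) * (cis (- \<phi> - pi / 4) / \<i>) = cis (\<phi> * ((2 * real i + 1)\<^sup>2 + 1)) * cis (- \<phi> - pi / 4)"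
      by (simp only: ii)
    also have "\<dots> = cis (gphase i)" unfolding cis_mult gphase_def \<phi>_def by (simp add: algebra_simps add_divide_distrib)
    finally show ?thesis by simp
  qed
  have "norm (\<Sum>i\<in>{M..<n}. c i *\<^sub>R (E (Suc i) - E i)) \<le> 2 * c M"
  proof (rule Abel_summation_bound)
    show "M \<le> n" using assms unfolding n_def .
    show "norm (\<Sum>i\<in>{M..<k}. E (Suc i) - E i) \<le> 2" if "M \<le> k" "k \<le> n" for k
    proof -
      have "norm (E k - E M) \<le> norm (E k) + norm (E M)" by (rule norm_triangle_ineq4)
      thus ?thesis using sum_Suc_diff'[OF that(1), of E] unfolding E_def by simp
    qed
    show "c (Suc i) \<le> c i" if "M \<le> i" "i < n" for i
    proof -
      have "sin (2 * \<phi> * (2 * real i + 1)) \<le> sin (2 * \<phi> * (2 * real (Suc i) + 1))"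
      proof (rule sin_monotone_2pi_le)
        show "- (pi / 2) \<le> 2 * \<phi> * (2 * real i + 1)" using ang(1)[of i] that pi_gt_zero by linarith
        show "2 * \<phi> * (2 * real i + 1) \<le> 2 * \<phi> * (2 * real (Suc i) + 1)"
          unfolding \<phi>_def using p0 by (intro mult_left_mono) auto
        show "2 * \<phi> * (2 * real (Suc i) + 1) \<le> pi / 2" using ang(2)[of "Suc i"] that by simp
      qed
      thus ?thesis unfolding c_def using sinpos[of i] that by (intro divide_left_mono mult_left_mono) (auto intro!: mult_pos_pos sinpos)
    qed
    show "c n \<ge> 0" unfolding c_def using sinpos[of n] by simp
  qed
  also have "2 * c M \<le> real p / (2 * real M + 1)"
  proof -
    have Mn: "M \<le> n" using assms unfolding n_def .
    have "2 / pi * (2 * \<phi> * (2 * real M + 1)) \<le> sin (2 * \<phi> * (2 * real M + 1))"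
      using ang[OF Mn] jordan_sine_bound[of "2 * \<phi> * (2 * real M + 1)"] by simp
    moreover have "2 / pi * (2 * \<phi> * (2 * real M + 1)) = (2 * real M + 1) / real p"
      unfolding \<phi>_def using p0 by (simp add: field_simps)
    ultimately have "(2 * real M + 1) / real p \<le> sin (2 * \<phi> * (2 * real M + 1))" by simp
    hence "1 / sin (2 * \<phi> * (2 * real M + 1)) \<le> 1 / ((2 * real M + 1) / real p)"
      using p0 sinpos[OF Mn] by (intro divide_left_mono) auto
    thus ?thesis unfolding c_def by simp
  qed
  finally have b: "norm (\<Sum>i\<in>{M..<n}. c i *\<^sub>R (E (Suc i) - E i)) \<le> real p / (2 * real M + 1)" .
  have "(\<Sum>i\<in>{M..<n}. cis (gphase i)) = (\<Sum>i\<in>{M..<n}. c i *\<^sub>R (E (Suc i) - E i)) * (cis (- \<phi> - pi / 4) / \<i>)"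
    unfolding sum_distrib_right using step by (intro sum.cong refl) auto
  hence "norm (\<Sum>i\<in>{M..<n}. cis (gphase i)) \<le> real p / (2 * real M + 1)"
    using b by (simp add: norm_mult norm_divide)
  moreover have "(\<Sum>i\<in>{M..<n}. cos (gphase i)) = Re (\<Sum>i\<in>{M..<n}. cis (gphase i))" by simp
  ultimately show ?thesis unfolding n_def[symmetric] using abs_Re_le_cmod order_trans by metis
qed

text \<open>Since \<open>Re \<tau> = \<plusminus>\<surd>p\<close>, it suffices to show \<open>Re \<tau> > - \<surd>p\<close>. Terms with \<open>(2i+1)\<^sup>2 \<le> 2p\<close> are at least
  \<open>\<surd>2 / 2\<close>, those with \<open>(2i+1)\<^sup>2 \<le> 3p\<close> are nonnegative, and the rest is bounded by Abel summation.\<close>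
lemma tau_eq:
  assumes "p mod 8 = 5" shows "tau = of_real (sqrt (real p))"
proof -
  define n where "n = (p - 1) div 2"
  have p: "p = 2 * n + 1" unfolding n_def using odd_p by (auto elim: oddE)
  have p0: "real p > 0" and p5: "real p \<ge> 5" using p_ge_5 by simp_all
  define M where "M = (LEAST i. 3 * p < (2 * i + 1)\<^sup>2)"
  define q where "q = (LEAST i. 2 * p < (2 * i + 1)\<^sup>2)"
  have n3: "3 * p < (2 * n + 1)\<^sup>2" unfolding p[symmetric] power2_eq_square using p_ge_5 by simp
  have Mn: "M \<le> n" unfolding M_def by (rule Least_le) (rule n3)
  have M: "3 * p < (2 * M + 1)\<^sup>2" unfolding M_def by (rule LeastI) (rule n3)
  have Mlt: "(2 * i + 1)\<^sup>2 \<le> 3 * p" if "i < M" for i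
    using not_less_Least[of i "\<lambda>i. 3 * p < (2 * i + 1)\<^sup>2"] that unfolding M_def by simp
  have "2 * p < (2 * M + 1)\<^sup>2" using M by simp
  hence qM: "q \<le> M" unfolding q_def by (rule Least_le)
  have q: "2 * p < (2 * q + 1)\<^sup>2" unfolding q_def by (rule LeastI) (rule \<open>2 * p < (2 * M + 1)\<^sup>2\<close>)
  have qlt: "(2 * i + 1)\<^sup>2 \<le> 2 * p" if "i < q" for i
    using not_less_Least[of i "\<lambda>i. 2 * p < (2 * i + 1)\<^sup>2"] that unfolding q_def by simp
  have ph: "- (pi / 4) \<le> gphase i" for i unfolding gphase_def using p0 by simp
  have phle: "gphase i \<le> pi / 4 * (real k - 1)" if "(2 * i + 1)\<^sup>2 \<le> k * p" for i k
  proof -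
    have "(2 * real i + 1)\<^sup>2 \<le> real k * real p"    proof -
      have "real ((2 * i + 1)\<^sup>2) \<le> real (k * p)" using that by (simp only: of_nat_le_iff)
      thus ?thesis by (simp add: add.commute)
    qed
    hence "pi * (2 * real i + 1)\<^sup>2 \<le> pi * (real k * real p)" by (intro mult_left_mono) auto
    thus ?thesis unfolding gphase_def using p0 by (simp add: field_simps)
  qed
  have big: "cos (gphase i) \<ge> sqrt 2 / 2" if "i < q" for i
  proof -
    have "\<bar>gphase i\<bar> \<le> pi / 4" using ph[of i] phle[of i 2] qlt[OF that] by simp
    hence "cos (pi / 4) \<le> cos \<bar>gphase i\<bar>" by (intro cos_monotone_0_pi_le) auto
    thus ?thesis by (simp add: cos_45)
  qed
  have nonneg: "cos (gphase i) \<ge> 0" if "i < M" for i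
    using ph[of i] phle[of i 3] Mlt[OF that] by (intro cos_ge_zero) auto
  have split: "(\<Sum>i<n. cos (gphase i)) = (\<Sum>i<q. cos (gphase i)) + (\<Sum>i\<in>{q..<M}. cos (gphase i)) + (\<Sum>i\<in>{M..<n}. cos (gphase i))"
    using qM Mn by (simp add: lessThan_atLeast0 sum.atLeastLessThan_concat)
  have "(\<Sum>i<q. sqrt 2 / 2) \<le> (\<Sum>i<q. cos (gphase i))" using big by (intro sum_mono) auto
  hence s1: "real q * (sqrt 2 / 2) \<le> (\<Sum>i<q. cos (gphase i))" by simp
  have s2: "0 \<le> (\<Sum>i\<in>{q..<M}. cos (gphase i))" using nonneg by (intro sum_nonneg) auto
  have s3: "- (real p / (2 * real M + 1)) \<le> (\<Sum>i\<in>{M..<n}. cos (gphase i))"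
    using gphase_tail_bound[of M] Mn unfolding n_def by linarith
  define r where "r = sqrt (real p)"
  have r2: "r * r = real p" and rpos: "r > 0" unfolding r_def using p0 by simp_all
  have r5: "r \<ge> 2.236" unfolding r_def by (rule real_le_rsqrt) (use p5 in \<open>simp add: power2_eq_square\<close>)
  have sq2: "sqrt 2 * sqrt 2 = 2" "sqrt 2 < 1.42" by (simp, rule real_less_lsqrt) (auto simp: power2_eq_square)
  have "real (2 * p) < real ((2 * q + 1)\<^sup>2)" using q by (simp only: of_nat_less_iff)
  hence "(sqrt 2 * r)\<^sup>2 < (2 * real q + 1)\<^sup>2" using r2 by (simp add: power_mult_distrib power2_eq_square[of r] add.commute)
  hence "sqrt 2 * r < 2 * real q + 1" by (rule power_less_imp_less_base) simp
  hence "sqrt 2 * (sqrt 2 * r) < sqrt 2 * (2 * real q + 1)" by (rule mult_strict_left_mono) simp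
  moreover have "sqrt 2 * (sqrt 2 * r) = 2 * r" unfolding mult.assoc[symmetric] sq2(1) ..
  moreover have "sqrt 2 * (2 * real q + 1) = 2 * (real q * sqrt 2) + sqrt 2" by (simp add: algebra_simps)
  ultimately have q': "2 * r < 2 * (real q * sqrt 2) + sqrt 2" by linarith
  have "real (3 * p) < real ((2 * M + 1)\<^sup>2)" using M by (simp only: of_nat_less_iff)
  hence "(1.73 * r)\<^sup>2 < (2 * real M + 1)\<^sup>2" using r2 p0 by (simp add: power2_eq_square algebra_simps)
  hence "1.73 * r < 2 * real M + 1" by (rule power_less_imp_less_base) simp
  hence "real p / (2 * real M + 1) \<le> real p / (1.73 * r)" using rpos p0 by (intro divide_left_mono) auto
  also have "\<dots> = r / 1.73" using rpos r2[symmetric] by (simp add: field_simps)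
  finally have M': "real p / (2 * real M + 1) \<le> r / 1.73" .
  have "Re tau = -1 + 2 * ((\<Sum>i<q. cos (gphase i)) + (\<Sum>i\<in>{q..<M}. cos (gphase i)) + (\<Sum>i\<in>{M..<n}. cos (gphase i)))"
    using tau_cos_half_sum[OF assms] split unfolding n_def by simp
  also have "\<dots> \<ge> -1 + 2 * (real q * (sqrt 2 / 2) + 0 + (- (real p / (2 * real M + 1))))"
    using s1 s2 s3 by (intro add_left_mono mult_left_mono add_mono) auto
  finally have "Re tau \<ge> -1 + real q * sqrt 2 - 2 * (r / 1.73)" using M' by simp
  \<comment> \<open>By q' the lower bound exceeds (1 - 2 / 1.73) r - 1.71, which is above - r as
    soon as r > 2.03; p >= 5 gives r >= 2.236.\<close>
  hence "Re tau > - r" using q' sq2(2) r5 by (simp add: field_simps)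
  moreover have "\<bar>Re tau\<bar> = r" unfolding r_def using tau_eq_Re(2) by (metis real_sqrt_abs)
  ultimately have "Re tau = r" by linarith
  thus ?thesis using tau_eq_Re(1) unfolding r_def by simp
qed

text \<open>Expand Ln (1 - x zeta^b) for x < 1 and sum over b with weight chi b: the inner sums are
  twisted Gauss sums chi n * tau. Real parts turn Ln into ln of the norm.\<close>

lemma L1_series:
  assumes "0 \<le> x" "x < 1"
  shows "(\<Sum>n. chi (int n) / real n * x ^ n) * Re tau =
    - (\<Sum>b\<in>{0..<int p}. chi b * ln (norm (1 - ez b * of_real x)))"
proof -
  have s: "(\<lambda>n. - ((ez b * of_real x) ^ n) / of_nat n) sums Ln (1 - ez b * of_real x)" for b
    using Ln_series'[of "- (ez b * of_real x)"] assms by (simp add: norm_mult)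
  have ne: "1 - ez b * of_real x \<noteq> 0" for b
  proof
    assume "1 - ez b * of_real x = 0"
    hence "ez b * of_real x = 1" by simp
    hence "norm (ez b * of_real x) = 1" by simp
    thus False using assms by (simp add: norm_mult)
  qed
  have "(\<lambda>n. \<Sum>b\<in>{0..<int p}. of_int (chi b) * (- ((ez b * of_real x) ^ n) / of_nat n)) sums
      (\<Sum>b\<in>{0..<int p}. of_int (chi b) * Ln (1 - ez b * of_real x))"
    by (intro sums_sum sums_mult s)
  moreover have "(\<Sum>b\<in>{0..<int p}. of_int (chi b) * (- ((ez b * of_real x) ^ n) / of_nat n)) =
      - (of_real (chi (int n) / real n * x ^ n) * tau)" for n
  proof -
    have "(\<Sum>b\<in>{0..<int p}. of_int (chi b) * (- ((ez b * of_real x) ^ n) / of_nat n)) =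
        (\<Sum>b\<in>{0..<int p}. (of_int (chi b) * ez (b * int n)) * (- (of_real x ^ n / of_nat n)))"
      by (intro sum.cong refl) (simp add: power_mult_distrib ez_power)
    also have "\<dots> = (of_int (chi (int n)) * tau) * (- (of_real x ^ n / of_nat n))"
      unfolding sum_distrib_right[symmetric] gauss_sum_twist ..
    finally show ?thesis by simp
  qed
  ultimately have "(\<lambda>n. - (of_real (chi (int n) / real n * x ^ n) * tau)) sums
      (\<Sum>b\<in>{0..<int p}. of_int (chi b) * Ln (1 - ez b * of_real x))" by simp
  from sums_Re[OF this] have "(\<lambda>n. - (chi (int n) / real n * x ^ n * Re tau)) sums
      (\<Sum>b\<in>{0..<int p}. chi b * ln (norm (1 - ez b * of_real x)))"
    using ne by simp
  hence "(\<lambda>n. chi (int n) / real n * x ^ n * Re tau) sums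
      - (\<Sum>b\<in>{0..<int p}. chi b * ln (norm (1 - ez b * of_real x)))"
    using sums_minus by fastforce
  moreover have "(\<lambda>n. chi (int n) / real n * x ^ n * Re tau) sums
      ((\<Sum>n. chi (int n) / real n * x ^ n) * Re tau)"
    using summable_chi_power[of x] assms by (intro sums_mult2 summable_sums) auto
  ultimately show ?thesis by (rule sums_unique2[symmetric])
qed

lemma L1_formula: "L1 * Re tau = - (\<Sum>b\<in>{0..<int p}. chi b * ln (norm (1 - ez b)))"
proof (rule tendsto_unique)
  show "at_left (1 :: real) \<noteq> bot" by simp
  show "((\<lambda>x. (\<Sum>n. chi (int n) / real n * x ^ n) * Re tau) \<longlongrightarrow> L1 * Re tau) (at_left 1)"
    by (intro tendsto_mult_right L1_Abel_limit)
  have "((\<lambda>x. - (\<Sum>b\<in>{0..<int p}. chi b * ln (norm (1 - ez b * complex_of_real x)))) \<longlongrightarrow>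
      - (\<Sum>b\<in>{0..<int p}. chi b * ln (norm (1 - ez b * complex_of_real 1)))) (at_left 1)"
  proof (intro tendsto_minus tendsto_sum)
    fix b assume b: "b \<in> {0..<int p}"
    show "((\<lambda>x. chi b * ln (norm (1 - ez b * complex_of_real x))) \<longlongrightarrow>
      chi b * ln (norm (1 - ez b * complex_of_real 1))) (at_left 1)"
    proof (cases "b = 0")
      \<comment> \<open>At b = 0 the logarithm diverges as x tends to 1, but its coefficient chi 0
        is 0.\<close>
      case True
      thus ?thesis using chi_eq_0_iff[of 0] by simp
    next
      case False
      hence "\<not> int p dvd b" using b by (auto dest: zdvd_imp_le)
      hence "ez b \<noteq> 1" using ez_eq_1_iff by blast
      thus ?thesis by (intro tendsto_intros) auto
    qed
  qed
  moreover have "\<forall>\<^sub>F x in at_left (1 :: real). x \<in> {0<..<1}" by (rule eventually_at_left_real) simp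
  hence "\<forall>\<^sub>F x in at_left 1. - (\<Sum>b\<in>{0..<int p}. chi b * ln (norm (1 - ez b * complex_of_real x))) =
      (\<Sum>n. chi (int n) / real n * x ^ n) * Re tau"
  proof eventually_elim
    case (elim x)
    thus ?case by (subst L1_series) auto
  qed
  ultimately show "((\<lambda>x. (\<Sum>n. chi (int n) / real n * x ^ n) * Re tau) \<longlongrightarrow>
      - (\<Sum>b\<in>{0..<int p}. chi b * ln (norm (1 - ez b)))) (at_left 1)"
    by (simp add: tendsto_cong)
qed

end

section \<open>Products of sums of roots of unity\<close>

definition upper_pairs :: "nat \<Rightarrow> (nat \<times> nat) set" where
  "upper_pairs n = {(j, k). 1 \<le> j \<and> j < k \<and> k \<le> n}"

lemma finite_upper_pairs [simp]: "finite (upper_pairs n)"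
  by (rule finite_subset[of _ "{..n} \<times> {..n}"]) (auto simp: upper_pairs_def)

lemma sum_square_upper_pairs:
  fixes f :: "nat \<Rightarrow> nat \<Rightarrow> 'a :: comm_semiring_1"
  assumes "\<And>j k. f j k = f k j"
  shows "(\<Sum>j\<in>{1..n}. \<Sum>k\<in>{1..n}. f j k) = (\<Sum>j\<in>{1..n}. f j j) + 2 * (\<Sum>(j, k)\<in>upper_pairs n. f j k)"
proof -
  let ?D = "(\<lambda>j. (j, j)) ` {1..n}" and ?L = "prod.swap ` upper_pairs n"
  have eq: "{1..n} \<times> {1..n} = ?D \<union> (upper_pairs n \<union> ?L)"
  proof (intro equalityI subsetI)
    fix z assume "z \<in> {1..n} \<times> {1..n}"
    then obtain j k where z: "z = (j, k)" "1 \<le> j" "j \<le> n" "1 \<le> k" "k \<le> n" by auto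
    consider "j = k" | "j < k" | "k < j" by linarith
    thus "z \<in> ?D \<union> (upper_pairs n \<union> ?L)"
    proof cases
      case 3
      hence "(k, j) \<in> upper_pairs n" using z unfolding upper_pairs_def by simp
      hence "prod.swap (k, j) \<in> ?L" by blast
      thus ?thesis using z by simp
    qed (use z in \<open>auto simp: upper_pairs_def\<close>)
  qed (auto simp: upper_pairs_def)
  have "(\<Sum>j\<in>{1..n}. \<Sum>k\<in>{1..n}. f j k) = (\<Sum>(j, k)\<in>{1..n} \<times> {1..n}. f j k)"
    by (simp add: sum.cartesian_product)
  also have "\<dots> = (\<Sum>(j, k)\<in>?D. f j k) + (\<Sum>(j, k)\<in>upper_pairs n \<union> ?L. f j k)"
    unfolding eq by (intro sum.union_disjoint finite_UnI finite_imageI finite_upper_pairs)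
      (auto simp: upper_pairs_def)
  also have "(\<Sum>(j, k)\<in>upper_pairs n \<union> ?L. f j k) = (\<Sum>(j, k)\<in>upper_pairs n. f j k) + (\<Sum>(j, k)\<in>?L. f j k)"
    by (intro sum.union_disjoint finite_imageI finite_upper_pairs) (auto simp: upper_pairs_def)
  also have "(\<Sum>(j, k)\<in>?D. f j k) = (\<Sum>j\<in>{1..n}. f j j)" by (subst sum.reindex) (auto simp: inj_on_def)
  also have "(\<Sum>(j, k)\<in>?L. f j k) = (\<Sum>(j, k)\<in>upper_pairs n. f j k)"
    using assms by (subst sum.reindex) (auto simp: case_prod_unfold intro!: sum.cong)
  finally show ?thesis by (simp add: mult_2)
qed

section \<open>Even periodic functions summed over differences of squares\<close>

context prime_one_mod_four
begin

definition half :: nat where "half = (p - 1) div 2"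

lemma p_half: "p = 2 * half + 1" unfolding half_def using odd_p by (auto elim: oddE)

lemma sum_periodic_shift:
  assumes "periodic \<phi>" shows "(\<Sum>x\<in>{0..<int p}. \<phi> (x + c)) = (\<Sum>x\<in>{0..<int p}. \<phi> x)"
proof -
  have "(\<Sum>x\<in>{0..<int p}. \<phi> x) = (\<Sum>x\<in>{0..<int p}. \<phi> ((x + c) mod int p))"
    by (rule sum.reindex_bij_witness[of _ "\<lambda>x. (x + c) mod int p" "\<lambda>x. (x - c) mod int p"])
      (use p_ge_5 in \<open>auto simp: mod_simps\<close>)
  thus ?thesis using periodic_mod[OF assms] by simp
qed

lemma sum_periodic_mult:
  assumes "periodic \<phi>" "\<not> int p dvd a" shows "(\<Sum>x\<in>{0..<int p}. \<phi> (a * x)) = (\<Sum>x\<in>{0..<int p}. \<phi> x)"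
  using sum.reindex_bij_betw[OF bij_betw_mult_mod[OF assms(2)], of \<phi>] periodic_mod[OF assms(1)] by simp

lemma sum_periodic_even:
  fixes \<phi> :: "int \<Rightarrow> real"
  assumes "periodic \<phi>" "\<And>x. \<phi> (- x) = \<phi> x"
  shows "(\<Sum>x\<in>{0..<int p}. \<phi> x) = \<phi> 0 + 2 * (\<Sum>x\<in>{1..half}. \<phi> (int x))"
proof -
  have set: "{0..<int p} = {0} \<union> (int ` {1..half} \<union> (\<lambda>x. int p - int x) ` {1..half})"
  proof (intro equalityI subsetI)
    fix x assume x: "x \<in> {0..<int p}"
    consider "x = 0" | "1 \<le> x" "x \<le> int half" | "int half < x" using x by fastforce
    thus "x \<in> {0} \<union> (int ` {1..half} \<union> (\<lambda>x. int p - int x) ` {1..half})"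
    proof cases
      case 2
      hence "x = int (nat x)" "nat x \<in> {1..half}" by auto
      thus ?thesis by blast
    next
      case 3
      hence "x = int p - int (nat (int p - x))" "nat (int p - x) \<in> {1..half}" using x p_half by auto
      thus ?thesis by blast
    qed simp
  qed (use p_half in auto)
  have "(\<Sum>x\<in>{0..<int p}. \<phi> x) = \<phi> 0 + (\<Sum>x\<in>int ` {1..half} \<union> (\<lambda>x. int p - int x) ` {1..half}. \<phi> x)"
    unfolding set using p_half by (subst sum.union_disjoint) auto
  also have "(\<Sum>x\<in>int ` {1..half} \<union> (\<lambda>x. int p - int x) ` {1..half}. \<phi> x) =
      (\<Sum>x\<in>int ` {1..half}. \<phi> x) + (\<Sum>x\<in>(\<lambda>x. int p - int x) ` {1..half}. \<phi> x)"
    using p_half by (intro sum.union_disjoint) auto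
  also have "(\<Sum>x\<in>int ` {1..half}. \<phi> x) = (\<Sum>x\<in>{1..half}. \<phi> (int x))" by (subst sum.reindex) auto
  also have "(\<Sum>x\<in>(\<lambda>x. int p - int x) ` {1..half}. \<phi> x) = (\<Sum>x\<in>{1..half}. \<phi> (int p - int x))"
    by (subst sum.reindex) (auto simp: inj_on_def)
  also have "\<dots> = (\<Sum>x\<in>{1..half}. \<phi> (int x))"
  proof (intro sum.cong refl)
    fix x :: nat
    have "\<phi> (int p - int x) = \<phi> (- int x)" by (rule periodicD[OF assms(1)]) (simp add: cong_iff_dvd_diff)
    thus "\<phi> (int p - int x) = \<phi> (int x)" using assms(2) by simp
  qed
  finally show ?thesis by simp
qed

text \<open>The substitution \<open>u = x - y\<close>, \<open>v = x + y\<close> turns \<open>\<phi> (x\<^sup>2 - y\<^sup>2)\<close> into \<open>\<phi> (u v)\<close>.\<close>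
lemma sum_difference_of_squares:
  fixes \<phi> :: "int \<Rightarrow> real"
  assumes per: "periodic \<phi>" and \<phi>0: "\<phi> 0 = 0"
  shows "(\<Sum>y\<in>{0..<int p}. \<Sum>x\<in>{0..<int p}. \<phi> (x\<^sup>2 - y\<^sup>2)) = (real p - 1) * (\<Sum>x\<in>{0..<int p}. \<phi> x)"
proof -
  have per': "periodic (\<lambda>x. \<phi> (g x))" if "\<And>x y. [x = y] (mod int p) \<Longrightarrow> [g x = g y] (mod int p)" for g
    unfolding periodic_def using periodicD[OF per] that by blast
  have "(\<Sum>y\<in>{0..<int p}. \<Sum>x\<in>{0..<int p}. \<phi> (x\<^sup>2 - y\<^sup>2)) =
      (\<Sum>y\<in>{0..<int p}. \<Sum>u\<in>{0..<int p}. \<phi> ((u + y)\<^sup>2 - y\<^sup>2))"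
  proof (rule sum.cong[OF refl])
    fix y :: int
    have "periodic (\<lambda>x. \<phi> (x\<^sup>2 - y\<^sup>2))" by (intro per' cong_diff cong_pow cong_refl)
    from sum_periodic_shift[OF this, of y]
    show "(\<Sum>x\<in>{0..<int p}. \<phi> (x\<^sup>2 - y\<^sup>2)) = (\<Sum>u\<in>{0..<int p}. \<phi> ((u + y)\<^sup>2 - y\<^sup>2))" by simp
  qed
  also have "\<dots> = (\<Sum>u\<in>{0..<int p}. \<Sum>y\<in>{0..<int p}. \<phi> ((u + y)\<^sup>2 - y\<^sup>2))" by (rule sum.swap)
  also have "\<dots> = (\<Sum>u\<in>{0..<int p}. if u = 0 then 0 else (\<Sum>x\<in>{0..<int p}. \<phi> x))"
  proof (intro sum.cong refl)
    fix u assume u: "u \<in> {0..<int p}"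
    show "(\<Sum>y\<in>{0..<int p}. \<phi> ((u + y)\<^sup>2 - y\<^sup>2)) = (if u = 0 then 0 else (\<Sum>x\<in>{0..<int p}. \<phi> x))"
    proof (cases "u = 0")
      case False
      hence "\<not> int p dvd u" using u by (auto dest: zdvd_imp_le)
      moreover have "\<not> int p dvd 2" using p_ge_5 by (auto dest: zdvd_imp_le)
      ultimately have nd: "\<not> int p dvd 2 * u" using prime_int_p prime_dvd_mult_iff by blast
      have per2: "periodic (\<lambda>x. \<phi> (x + u\<^sup>2))" by (intro per' cong_add cong_refl)
      have "(\<Sum>y\<in>{0..<int p}. \<phi> ((u + y)\<^sup>2 - y\<^sup>2)) = (\<Sum>y\<in>{0..<int p}. \<phi> (2 * u * y + u\<^sup>2))"
        by (intro sum.cong refl arg_cong[of _ _ \<phi>]) (simp add: power2_eq_square algebra_simps)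
      also have "\<dots> = (\<Sum>x\<in>{0..<int p}. \<phi> (x + u\<^sup>2))" by (rule sum_periodic_mult[OF per2 nd])
      also have "\<dots> = (\<Sum>x\<in>{0..<int p}. \<phi> x)" by (rule sum_periodic_shift[OF per])
      finally show ?thesis using False by simp
    qed (simp add: \<phi>0)
  qed
  also have "\<dots> = (\<Sum>u\<in>{0..<int p} - {0}. (\<Sum>x\<in>{0..<int p}. \<phi> x))"
    by (intro sum.mono_neutral_cong_right) auto
  also have "\<dots> = (real p - 1) * (\<Sum>x\<in>{0..<int p}. \<phi> x)" using p_ge_5 by (simp add: of_nat_diff)
  finally show ?thesis .
qed

text \<open>Folding both variables of the full double sum by evenness gives 8 X from the pairs and 4
  V from the axes x = 0 and y = 0, the diagonal being 0. The squares in V are hit with multiplicity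
  1 + chi, which is the source of the twisted part.\<close>

lemma sum_upper_pairs_squares:
  fixes \<phi> :: "int \<Rightarrow> real"
  assumes per: "periodic \<phi>" and ev: "\<And>x. \<phi> (- x) = \<phi> x" and \<phi>0: "\<phi> 0 = 0"
  shows "(\<Sum>(j, k)\<in>upper_pairs half. \<phi> ((int j)\<^sup>2 - (int k)\<^sup>2)) =
    (\<Sum>d\<in>{0..<int p}. \<phi> d * ((real p - 1) / 4 - (1 + chi d) / 2)) / 2"
proof -
  define X where "X = (\<Sum>(j, k)\<in>upper_pairs half. \<phi> ((int j)\<^sup>2 - (int k)\<^sup>2))"
  define V where "V = (\<Sum>x\<in>{1..half}. \<phi> ((int x)\<^sup>2))"
  have per': "periodic (\<lambda>x. \<phi> (g x))" if "\<And>x y. [x = y] (mod int p) \<Longrightarrow> [g x = g y] (mod int p)" for g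
    unfolding periodic_def using periodicD[OF per] that by blast
  have inner: "(\<Sum>x\<in>{0..<int p}. \<phi> (x\<^sup>2 - y\<^sup>2)) = \<phi> (y\<^sup>2) + 2 * (\<Sum>x\<in>{1..half}. \<phi> ((int x)\<^sup>2 - y\<^sup>2))" for y
  proof -
    have "(\<Sum>x\<in>{0..<int p}. \<phi> (x\<^sup>2 - y\<^sup>2)) = \<phi> (0\<^sup>2 - y\<^sup>2) + 2 * (\<Sum>x\<in>{1..half}. \<phi> ((int x)\<^sup>2 - y\<^sup>2))"
      by (rule sum_periodic_even) (auto intro!: per' cong_diff cong_pow)
    thus ?thesis using ev by simp
  qed
  have V: "(\<Sum>y\<in>{0..<int p}. \<phi> (y\<^sup>2)) = 2 * V"
  proof -
    have "(\<Sum>y\<in>{0..<int p}. \<phi> (y\<^sup>2)) = \<phi> (0\<^sup>2) + 2 * (\<Sum>x\<in>{1..half}. \<phi> ((int x)\<^sup>2))"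
      by (rule sum_periodic_even) (auto intro!: per' cong_pow)
    thus ?thesis unfolding V_def using \<phi>0 by simp
  qed
  have "(\<Sum>y\<in>{0..<int p}. \<Sum>x\<in>{0..<int p}. \<phi> (x\<^sup>2 - y\<^sup>2)) =
      2 * V + 2 * (\<Sum>y\<in>{0..<int p}. \<Sum>x\<in>{1..half}. \<phi> ((int x)\<^sup>2 - y\<^sup>2))"
    unfolding inner sum.distrib V by (simp add: sum_distrib_left)
  also have "(\<Sum>y\<in>{0..<int p}. \<Sum>x\<in>{1..half}. \<phi> ((int x)\<^sup>2 - y\<^sup>2)) =
      (\<Sum>x\<in>{1..half}. \<Sum>y\<in>{0..<int p}. \<phi> ((int x)\<^sup>2 - y\<^sup>2))" by (rule sum.swap)
  also have "\<dots> = (\<Sum>x\<in>{1..half}. \<phi> ((int x)\<^sup>2) + 2 * (\<Sum>y\<in>{1..half}. \<phi> ((int x)\<^sup>2 - (int y)\<^sup>2)))"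
  proof (intro sum.cong refl)
    fix x :: nat
    have "(\<Sum>y\<in>{0..<int p}. \<phi> ((int x)\<^sup>2 - y\<^sup>2)) = \<phi> ((int x)\<^sup>2 - 0\<^sup>2) + 2 * (\<Sum>y\<in>{1..half}. \<phi> ((int x)\<^sup>2 - (int y)\<^sup>2))"
      by (rule sum_periodic_even) (auto intro!: per' cong_diff cong_pow)
    thus "(\<Sum>y\<in>{0..<int p}. \<phi> ((int x)\<^sup>2 - y\<^sup>2)) = \<phi> ((int x)\<^sup>2) + 2 * (\<Sum>y\<in>{1..half}. \<phi> ((int x)\<^sup>2 - (int y)\<^sup>2))"
      by simp
  qed
  also have "\<dots> = V + 2 * (\<Sum>x\<in>{1..half}. \<Sum>y\<in>{1..half}. \<phi> ((int x)\<^sup>2 - (int y)\<^sup>2))"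
    unfolding V_def by (simp add: sum.distrib sum_distrib_left)
  also have "(\<Sum>x\<in>{1..half}. \<Sum>y\<in>{1..half}. \<phi> ((int x)\<^sup>2 - (int y)\<^sup>2)) = 2 * X"
  proof -
    have sym: "\<phi> ((int x)\<^sup>2 - (int y)\<^sup>2) = \<phi> ((int y)\<^sup>2 - (int x)\<^sup>2)" for x y
      using ev[of "(int y)\<^sup>2 - (int x)\<^sup>2"] by simp
    show ?thesis unfolding X_def
      by (subst sum_square_upper_pairs) (use sym \<phi>0 in auto)
  qed
  finally have A: "(real p - 1) * (\<Sum>x\<in>{0..<int p}. \<phi> x) = 4 * V + 8 * X"
    unfolding sum_difference_of_squares[OF per \<phi>0] by simp
  have "2 * V = (\<Sum>a\<in>{0..<int p}. (1 + chi a) * \<phi> a)"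
    using sum_periodic_squares[OF per] V by simp
  moreover have "(\<Sum>d\<in>{0..<int p}. \<phi> d * ((real p - 1) / 4 - (1 + chi d) / 2)) =
      (real p - 1) / 4 * (\<Sum>x\<in>{0..<int p}. \<phi> x) - (\<Sum>a\<in>{0..<int p}. (1 + chi a) * \<phi> a) / 2"
    unfolding sum_distrib_left sum_divide_distrib sum_subtractf[symmetric]
    by (intro sum.cong refl) (simp add: algebra_simps)
  ultimately have "(\<Sum>d\<in>{0..<int p}. \<phi> d * ((real p - 1) / 4 - (1 + chi d) / 2)) = 2 * X"
    using A by linarith
  thus ?thesis unfolding X_def by simp
qed

section \<open>Sums of two roots of unity as cosines\<close>

definition two_cos :: "int \<Rightarrow> real" where "two_cos t = 2 * Re (ez t)"

definition inv2 :: int where "inv2 = int half + 1"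

lemma inv2: "2 * inv2 = int p + 1" unfolding inv2_def using p_half by simp

lemma ez_inv2: "ez (inv2 * (2 * x)) = ez x"
proof -
  have "inv2 * (2 * x) = x + int p * x" using inv2 by (simp add: algebra_simps)
  thus ?thesis by (simp add: ez_add)
qed

lemma periodic_two_cos: "periodic two_cos" unfolding periodic_def two_cos_def using ez_cong by metis

lemma two_cos_minus [simp]: "two_cos (- t) = two_cos t" unfolding two_cos_def ez_minus by simp

lemma two_cos_0 [simp]: "two_cos 0 = 2" unfolding two_cos_def by simp

lemma ez_sum: "ez x + ez y = ez (inv2 * (x + y)) * of_real (two_cos (inv2 * (x - y)))"
proof -
  have "of_real (two_cos t) = ez t + ez (- t)" for t
    unfolding two_cos_def ez_minus by (simp add: complex_add_cnj)
  hence "ez (inv2 * (x + y)) * of_real (two_cos (inv2 * (x - y))) =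
      ez (inv2 * (x + y) + inv2 * (x - y)) + ez (inv2 * (x + y) + - (inv2 * (x - y)))"
    by (simp only: ez_add distrib_left)
  also have "inv2 * (x + y) + inv2 * (x - y) = inv2 * (2 * x)" by (simp add: algebra_simps)
  also have "inv2 * (x + y) + - (inv2 * (x - y)) = inv2 * (2 * y)" by (simp add: algebra_simps)
  finally show ?thesis by (simp add: ez_inv2)
qed

text \<open>With n = half, six times the sum is n (n + 1) (2n + 1), where 2n + 1 = p is prime to 6.
  Through the sum over pairs, this makes the root-of-unity factors multiply to 1.\<close>

lemma sum_squares_dvd: "int p dvd (\<Sum>j\<in>{1..half}. (int j)\<^sup>2)"
proof -
  have f: "6 * (\<Sum>j\<in>{1..n}. (int j)\<^sup>2) = int n * (int n + 1) * (2 * int n + 1)" for n :: nat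
    by (induction n) (simp_all add: power2_eq_square algebra_simps)
  have "int p dvd 6 * (\<Sum>j\<in>{1..half}. (int j)\<^sup>2)"  proof -
    have "2 * int half + 1 = int p" using p_half by linarith
    thus ?thesis unfolding f by simp
  qed
  moreover have "\<not> int p dvd 6"
  proof
    assume "int p dvd 6"
    hence "int p dvd 2 * 3" by simp
    hence "int p dvd 2 \<or> int p dvd 3" using prime_int_p prime_dvd_mult_iff by blast
    thus False using p_ge_5 by (auto dest: zdvd_imp_le)
  qed
  ultimately show ?thesis using prime_int_p prime_dvd_mult_iff by blast
qed

lemma sum_upper_pairs_dvd: "int p dvd (\<Sum>(j, k)\<in>upper_pairs half. (int j)\<^sup>2 + (int k)\<^sup>2)"
proof -
  define Q where "Q = (\<Sum>j\<in>{1..half}. (int j)\<^sup>2)"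
  have "(\<Sum>j\<in>{1..half}. \<Sum>k\<in>{1..half}. (int j)\<^sup>2 + (int k)\<^sup>2) =
      (\<Sum>j\<in>{1..half}. (int j)\<^sup>2 + (int j)\<^sup>2) + 2 * (\<Sum>(j, k)\<in>upper_pairs half. (int j)\<^sup>2 + (int k)\<^sup>2)"
    by (rule sum_square_upper_pairs) simp
  moreover have "(\<Sum>j\<in>{1..half}. \<Sum>k\<in>{1..half}. (int j)\<^sup>2 + (int k)\<^sup>2) = 2 * int half * Q"
    unfolding Q_def by (simp add: sum.distrib sum_distrib_left mult.assoc)
  moreover have "(\<Sum>j\<in>{1..half}. (int j)\<^sup>2 + (int j)\<^sup>2) = 2 * Q"
    unfolding Q_def by (simp add: sum.distrib sum_distrib_left)
  ultimately have "(\<Sum>(j, k)\<in>upper_pairs half. (int j)\<^sup>2 + (int k)\<^sup>2) = (int half - 1) * Q"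
    by (simp add: algebra_simps)
  thus ?thesis using sum_squares_dvd unfolding Q_def by simp
qed

lemma prod_ez: "finite A \<Longrightarrow> (\<Prod>x\<in>A. ez (g x)) = ez (\<Sum>x\<in>A. g x)"
  by (induction rule: finite_induct) (auto simp: ez_add)

lemma prod_ez_sum_eq_prod_two_cos:
  "(\<Prod>(j, k)\<in>upper_pairs half. ez (a * int j ^ 2) + ez (a * int k ^ 2)) =
    of_real (\<Prod>(j, k)\<in>upper_pairs half. two_cos (inv2 * a * ((int j)\<^sup>2 - (int k)\<^sup>2)))"
proof -
  have "(\<Prod>(j, k)\<in>upper_pairs half. ez (a * int j ^ 2) + ez (a * int k ^ 2)) =
      (\<Prod>(j, k)\<in>upper_pairs half. ez (inv2 * (a * (int j)\<^sup>2 + a * (int k)\<^sup>2))) *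
      (\<Prod>(j, k)\<in>upper_pairs half. of_real (two_cos (inv2 * a * ((int j)\<^sup>2 - (int k)\<^sup>2))))"
    unfolding prod.distrib[symmetric]
  proof (intro prod.cong refl, clarify)
    fix j k
    show "ez (a * int j ^ 2) + ez (a * int k ^ 2) =
      ez (inv2 * (a * (int j)\<^sup>2 + a * (int k)\<^sup>2)) * of_real (two_cos (inv2 * a * ((int j)\<^sup>2 - (int k)\<^sup>2)))"
      unfolding ez_sum by (simp add: algebra_simps)
  qed
  also have "(\<Prod>(j, k)\<in>upper_pairs half. ez (inv2 * (a * (int j)\<^sup>2 + a * (int k)\<^sup>2))) = 1"
  proof -
    have "(\<Prod>(j, k)\<in>upper_pairs half. ez (inv2 * (a * (int j)\<^sup>2 + a * (int k)\<^sup>2))) =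
        ez (\<Sum>(j, k)\<in>upper_pairs half. inv2 * (a * (int j)\<^sup>2 + a * (int k)\<^sup>2))"
      unfolding case_prod_unfold by (rule prod_ez) simp
    also have "(\<Sum>(j, k)\<in>upper_pairs half. inv2 * (a * (int j)\<^sup>2 + a * (int k)\<^sup>2)) =
        inv2 * a * (\<Sum>(j, k)\<in>upper_pairs half. (int j)\<^sup>2 + (int k)\<^sup>2)"
      unfolding sum_distrib_left case_prod_unfold by (intro sum.cong refl) (simp add: algebra_simps)
    finally show ?thesis using sum_upper_pairs_dvd ez_eq_1_iff by simp
  qed
  finally show ?thesis by (simp add: case_prod_unfold)
qed

section \<open>The absolute value of the product\<close>

lemma abs_two_cos: "\<bar>two_cos t\<bar> = norm (1 + ez (2 * t))"
proof -
  have "1 + ez (2 * t) = ez t * of_real (two_cos t)"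
  proof -
    have "of_real (two_cos t) = ez t + ez (- t)" unfolding two_cos_def ez_minus by (simp add: complex_add_cnj)
    hence "ez t * of_real (two_cos t) = ez (t + t) + ez (t + - t)" by (simp only: ez_add distrib_left)
    thus ?thesis by simp
  qed
  thus ?thesis by (simp add: norm_mult)
qed

lemma not_dvd_two: "\<not> int p dvd 2" using p_ge_5 by (auto dest: zdvd_imp_le)

lemma abs_two_cos_quotient:
  assumes "\<not> int p dvd x"
  shows "\<bar>two_cos (inv2 * x)\<bar> * norm (1 - ez x) = norm (1 - ez (2 * x))"
proof -
  have "ez (2 * (inv2 * x)) = ez x" using ez_inv2[of x] by (simp add: mult_ac)
  hence "\<bar>two_cos (inv2 * x)\<bar> * norm (1 - ez x) = norm ((1 + ez x) * (1 - ez x))"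
    unfolding abs_two_cos by (simp add: norm_mult)
  also have "(1 + ez x) * (1 - ez x) = 1 - ez (x + x)" unfolding ez_add by (simp add: algebra_simps)
  finally show ?thesis by simp
qed

lemma two_cos_nonzero: "two_cos (inv2 * x) \<noteq> 0"
proof (cases "int p dvd x")
  case True
  hence "two_cos (inv2 * x) = two_cos 0" by (intro periodicD[OF periodic_two_cos]) (simp add: cong_0_iff)
  thus ?thesis by simp
next
  case False
  hence "\<not> int p dvd 2 * x" using not_dvd_two prime_int_p prime_dvd_mult_iff by blast
  hence "norm (1 - ez (2 * x)) \<noteq> 0" using ez_eq_1_iff[of "2 * x"] by auto
  thus ?thesis using abs_two_cos_quotient[OF False] by auto
qed

text \<open>Equal to - L1 * Re tau by \<open>L1_formula\<close>; it carries the class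
  number.\<close>

definition Lam :: real where "Lam = (\<Sum>b\<in>{0..<int p}. chi b * ln (norm (1 - ez b)))"

lemma sum_chi_ln_twist:
  assumes "\<not> int p dvd a"
  shows "(\<Sum>b\<in>{0..<int p}. chi b * ln (norm (1 - ez (a * b)))) = chi a * Lam"
proof -
  have aa: "real_of_int (chi a) * chi a = 1" using chi_cases[of a] chi_eq_0_iff[of a] assms by auto
  have "periodic (\<lambda>b. chi b * ln (norm (1 - ez b)))"
    unfolding periodic_def using chi_cong ez_cong by metis
  from sum_periodic_mult[OF this assms]
  have "Lam = (\<Sum>b\<in>{0..<int p}. chi a * (chi b * ln (norm (1 - ez (a * b)))))"
    unfolding Lam_def by (simp add: chi_mult mult_ac)
  also have "\<dots> = chi a * (\<Sum>b\<in>{0..<int p}. chi b * ln (norm (1 - ez (a * b))))"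
    by (simp only: sum_distrib_left)
  finally have "chi a * Lam = chi a * chi a * (\<Sum>b\<in>{0..<int p}. chi b * ln (norm (1 - ez (a * b))))"
    by (simp only: mult.assoc of_int_mult)
  thus ?thesis by (simp only: of_int_mult aa mult_1)
qed

text \<open>The identity (1 + z) (1 - z) = 1 - z^2 splits the logarithm of each factor into two
  dilates of l. Their plain sums agree, and their chi-weighted sums are chi (2 a) Lam and chi a
  Lam.\<close>

lemma abs_prod_two_cos:
  assumes "\<not> int p dvd a"
  shows "\<bar>\<Prod>(j, k)\<in>upper_pairs half. two_cos (inv2 * a * ((int j)\<^sup>2 - (int k)\<^sup>2))\<bar> =
    exp (chi a * (1 - chi 2) / 4 * Lam)"
proof -
  \<comment> \<open>The value 0 at multiples of p secures phi 0 = 0; by nz no difference j^2 - k^2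
    in the product is such a multiple.\<close>
  define \<phi> where "\<phi> d = (if int p dvd d then 0 else ln \<bar>two_cos (inv2 * a * d)\<bar>)" for d
  have per: "periodic \<phi>" unfolding periodic_def
  proof (intro allI impI)
    fix x y assume xy: "[x = y] (mod int p)"
    have "two_cos (inv2 * a * x) = two_cos (inv2 * a * y)"
      by (rule periodicD[OF periodic_two_cos]) (intro cong_mult xy cong_refl)
    moreover have "int p dvd x \<longleftrightarrow> int p dvd y" using xy by (rule cong_dvd_iff[OF _ ])
    ultimately show "\<phi> x = \<phi> y" unfolding \<phi>_def by simp
  qed
  have ev: "\<phi> (- x) = \<phi> x" for x unfolding \<phi>_def by simp
  have nz: "\<not> int p dvd (int j)\<^sup>2 - (int k)\<^sup>2" if "(j, k) \<in> upper_pairs half" for j k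
  proof
    have jk: "1 \<le> j" "j < k" "k \<le> half" using that unfolding upper_pairs_def by auto
    assume "int p dvd (int j)\<^sup>2 - (int k)\<^sup>2"
    hence "int p dvd - ((int j)\<^sup>2 - (int k)\<^sup>2)" by (simp only: dvd_minus_iff)
    also have "- ((int j)\<^sup>2 - (int k)\<^sup>2) = (int k - int j) * (int k + int j)"
      by (simp add: power2_eq_square algebra_simps)
    finally have "int p dvd int k - int j \<or> int p dvd int k + int j"
      using prime_int_p prime_dvd_mult_iff by blast
    hence "int p \<le> int k - int j \<or> int p \<le> int k + int j" using jk by (auto dest: zdvd_imp_le)
    thus False using jk p_half by linarith
  qed
  have "\<bar>\<Prod>(j, k)\<in>upper_pairs half. two_cos (inv2 * a * ((int j)\<^sup>2 - (int k)\<^sup>2))\<bar> =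
      (\<Prod>(j, k)\<in>upper_pairs half. exp (\<phi> ((int j)\<^sup>2 - (int k)\<^sup>2)))"
    unfolding abs_prod
  proof (intro prod.cong refl, clarify)
    fix j k assume "(j, k) \<in> upper_pairs half"
    thus "\<bar>two_cos (inv2 * a * ((int j)\<^sup>2 - (int k)\<^sup>2))\<bar> = exp (\<phi> ((int j)\<^sup>2 - (int k)\<^sup>2))"
      unfolding \<phi>_def using nz two_cos_nonzero[of "a * ((int j)\<^sup>2 - (int k)\<^sup>2)"] by (simp add: mult.assoc)
  qed
  also have "\<dots> = exp (\<Sum>(j, k)\<in>upper_pairs half. \<phi> ((int j)\<^sup>2 - (int k)\<^sup>2))"
    by (simp add: exp_sum case_prod_unfold)
  also have "(\<Sum>(j, k)\<in>upper_pairs half. \<phi> ((int j)\<^sup>2 - (int k)\<^sup>2)) =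
    (\<Sum>d\<in>{0..<int p}. \<phi> d * ((real p - 1) / 4 - (1 + chi d) / 2)) / 2"
    by (rule sum_upper_pairs_squares[OF per ev]) (simp add: \<phi>_def)
  also have "(\<Sum>d\<in>{0..<int p}. \<phi> d * ((real p - 1) / 4 - (1 + chi d) / 2)) = chi a * (1 - chi 2) / 2 * Lam"
  proof -
    define l where "l x = (if int p dvd x then 0 else ln (norm (1 - ez x)))" for x
    have \<phi>l: "\<phi> d = l (2 * a * d) - l (a * d)" for d
    proof (cases "int p dvd d")
      case False
      hence nd: "\<not> int p dvd a * d" using assms prime_int_p prime_dvd_mult_iff by blast
      hence nd2: "\<not> int p dvd 2 * a * d" using not_dvd_two prime_int_p prime_dvd_mult_iff
        by (metis mult.assoc)
      have "norm (1 - ez (a * d)) > 0" using nd ez_eq_1_iff[of "a * d"] by auto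
      moreover have "\<bar>two_cos (inv2 * (a * d))\<bar> > 0" using two_cos_nonzero by simp
      ultimately have "ln \<bar>two_cos (inv2 * (a * d))\<bar> + ln (norm (1 - ez (a * d))) = ln (norm (1 - ez (2 * (a * d))))"
        unfolding abs_two_cos_quotient[OF nd, symmetric] by (simp add: ln_mult_pos)
      thus ?thesis unfolding \<phi>_def l_def using False nd nd2 by (simp add: mult.assoc)
    qed (simp add: \<phi>_def l_def)
    have pl: "periodic l" unfolding periodic_def
    proof (intro allI impI)
      fix x y assume xy: "[x = y] (mod int p)"
      show "l x = l y" unfolding l_def using ez_cong[OF xy] cong_dvd_iff[OF xy] by simp
    qed
    have nd2a: "\<not> int p dvd 2 * a" using assms not_dvd_two prime_int_p prime_dvd_mult_iff by blast
    have chil: "(\<Sum>d\<in>{0..<int p}. chi d * l (c * d)) = chi c * Lam" if "\<not> int p dvd c" for c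
    proof -
      have eq: "chi d * l (c * d) = chi d * ln (norm (1 - ez (c * d)))" for d
      proof (cases "int p dvd d")
        case True
        thus ?thesis using chi_eq_0_iff by simp
      next
        case False
        hence "\<not> int p dvd c * d" using that prime_int_p prime_dvd_mult_iff by blast
        thus ?thesis unfolding l_def by simp
      qed
      show ?thesis unfolding eq by (rule sum_chi_ln_twist[OF that])
    qed
    have "(\<Sum>d\<in>{0..<int p}. \<phi> d * ((real p - 1) / 4 - (1 + chi d) / 2)) =
      ((real p - 1) / 4 - 1 / 2) * ((\<Sum>d\<in>{0..<int p}. l (2 * a * d)) - (\<Sum>d\<in>{0..<int p}. l (a * d)))
      - 1 / 2 * ((\<Sum>d\<in>{0..<int p}. chi d * l (2 * a * d)) - (\<Sum>d\<in>{0..<int p}. chi d * l (a * d)))"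
      unfolding sum_subtractf[symmetric] sum_distrib_left \<phi>l
      by (intro sum.cong refl) (simp add: algebra_simps add_divide_distrib diff_divide_distrib)
    also have "\<dots> = - 1 / 2 * (chi (2 * a) * Lam - chi a * Lam)"
      unfolding sum_periodic_mult[OF pl nd2a] sum_periodic_mult[OF pl assms] chil[OF nd2a] chil[OF assms] by simp
    finally show ?thesis by (simp add: chi_mult algebra_simps)
  qed
  finally show ?thesis by (simp add: algebra_simps)
qed

section \<open>The sign of the product\<close>

lemma two_cos_neg_iff:
  assumes "1 \<le> t" "t \<le> half" shows "two_cos (int t) < 0 \<longleftrightarrow> p div 4 < t"
proof -
  define x where "x = 2 * pi * real t / real p"
  have p0: "real p > 0" using p_ge_5 by simp
  have two_cos: "two_cos (int t) = 2 * cos x" unfolding two_cos_def ez_def x_def by simp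
  have x0: "x > 0" unfolding x_def using assms p0 by simp
  have x_less: "x < y * pi" if "2 * real t < y * real p" for y
  proof -
    have "pi * (2 * real t) < pi * (y * real p)" using that by (intro mult_strict_left_mono) auto
    thus ?thesis unfolding x_def using p0 by (simp add: field_simps)
  qed
  have x_greater: "y * pi < x" if "y * real p < 2 * real t" for y
  proof -
    have "pi * (y * real p) < pi * (2 * real t)" using that by (intro mult_strict_left_mono) auto
    thus ?thesis unfolding x_def using p0 by (simp add: field_simps)
  qed
  have pm: "real p = 4 * real (p div 4) + 1" using p_eq by (metis of_nat_1 of_nat_add of_nat_mult of_nat_numeral)
  show ?thesis
  proof
    assume neg: "two_cos (int t) < 0"
    show "p div 4 < t"
    proof (rule ccontr)
      assume "\<not> p div 4 < t"
      hence "2 * real t < 1 / 2 * real p" using pm by simp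
      hence "x < 1 / 2 * pi" by (rule x_less)
      hence "cos x > 0" using x0 by (intro cos_gt_zero) auto
      thus False using neg two_cos by simp
    qed
  next
    assume "p div 4 < t"
    hence "real (p div 4) + 1 \<le> real t" by simp
    hence "1 / 2 * real p < 2 * real t" using pm by simp
    hence "1 / 2 * pi < x" by (rule x_greater)
    moreover have "2 * real t < 1 * real p" using assms p_half by simp
    hence "x < 1 * pi" by (rule x_less)
    ultimately have "cos (pi - x) > 0" by (intro cos_gt_zero) auto
    thus "two_cos (int t) < 0" using two_cos by (simp add: cos_diff)
  qed
qed

definition nonres :: nat where "nonres = card {k \<in> {1..p div 4}. chi (int k) = -1}"

lemma sum_chi_quarter: "(\<Sum>t\<in>{1..p div 4}. chi (int t)) = int (p div 4) - 2 * int nonres"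
proof -
  have "(\<Sum>t\<in>{1..p div 4}. chi (int t)) = (\<Sum>t\<in>{1..p div 4}. 1 - 2 * (if chi (int t) = -1 then 1 else 0))"
  proof (rule sum.cong[OF refl])
    fix t assume t: "t \<in> {1..p div 4}"
    have "\<not> int p dvd int t"
    proof
      assume "int p dvd int t"
      hence "int p \<le> int t" using t by (intro zdvd_imp_le) auto
      thus False using t p_eq by auto
    qed
    thus "chi (int t) = 1 - 2 * (if chi (int t) = -1 then 1 else 0)"
      using chi_cases[of "int t"] chi_eq_0_iff[of "int t"] by auto
  qed
  also have "\<dots> = int (p div 4) - 2 * (\<Sum>t\<in>{1..p div 4}. if chi (int t) = -1 then 1 else 0)"
    by (simp add: sum_subtractf sum_distrib_left)
  also have "(\<Sum>t\<in>{1..p div 4}. if chi (int t) = -1 then 1 else 0) = (\<Sum>t\<in>{t \<in> {1..p div 4}. chi (int t) = -1}. (1 :: int))"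
    by (rule sum.inter_filter[symmetric]) simp
  also have "\<dots> = int nonres" unfolding nonres_def by simp
  finally show ?thesis .
qed

text \<open>Since chi is even and sums to 0 over all residues, it sums to 0 over 1, ..., half; the
  second quarter is the negative of the first.\<close>

lemma sum_chi_second_quarter:
  "(\<Sum>t\<in>{p div 4 + 1..half}. chi (int t)) = 2 * int nonres - int (p div 4)"
proof -
  have "periodic (\<lambda>x. real_of_int (chi x))" unfolding periodic_def using chi_cong by metis
  from sum_periodic_even[OF this]
  have "real_of_int (\<Sum>x\<in>{0..<int p}. chi x) = 2 * real_of_int (\<Sum>t\<in>{1..half}. chi (int t))"
    using chi_eq_0_iff[of 0] by simp
  hence "real_of_int (\<Sum>t\<in>{1..half}. chi (int t)) = 0" unfolding sum_chi by simp
  hence "(\<Sum>t\<in>{1..half}. chi (int t)) = 0" by (simp only: of_int_eq_0_iff)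
  moreover have "{1..half} = {1..p div 4} \<union> {p div 4 + 1..half}" "{1..p div 4} \<inter> {p div 4 + 1..half} = {}"
    using half_p unfolding half_def by auto
  hence "(\<Sum>t\<in>{1..half}. chi (int t)) = (\<Sum>t\<in>{1..p div 4}. chi (int t)) + (\<Sum>t\<in>{p div 4 + 1..half}. chi (int t))"
    by (simp only: sum.union_disjoint finite_atLeastAtMost)
  ultimately show ?thesis using sum_chi_quarter by simp
qed

text \<open>c is the number of negative factors. By evenness only 1 <= t <= half matters for the
  argument t of the cosine; it is negative exactly beyond p div 4, where the character sum is known.
  The formula is doubled to stay within the integers.\<close>

lemma sign_prod_two_cos:
  assumes a: "\<not> int p dvd a"
  obtains c where
    "(\<Prod>(j, k)\<in>upper_pairs half. two_cos (inv2 * a * ((int j)\<^sup>2 - (int k)\<^sup>2))) =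
      (-1) ^ c * \<bar>\<Prod>(j, k)\<in>upper_pairs half. two_cos (inv2 * a * ((int j)\<^sup>2 - (int k)\<^sup>2))\<bar>"
    "2 * int c = 2 * (int (p div 4))\<^sup>2 - int (p div 4) - chi (2 * a) * (2 * int nonres - int (p div 4))"
proof -
  define m where "m = p div 4"
  have rm: "(real p - 1) / 4 = real m"
  proof -
    have "real p = 4 * real m + 1" unfolding m_def using p_eq by (metis of_nat_1 of_nat_add of_nat_mult of_nat_numeral)
    thus ?thesis by simp
  qed
  have hm: "half = 2 * m" unfolding half_def m_def by (rule half_p)
  define \<Psi> where "\<Psi> t = (if two_cos t < 0 then 1 else 0 :: nat)" for t
  define c where "c = (\<Sum>(j, k)\<in>upper_pairs half. \<Psi> (inv2 * a * ((int j)\<^sup>2 - (int k)\<^sup>2)))"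
  have CPsi: "two_cos t = (-1) ^ \<Psi> t * \<bar>two_cos t\<bar>" for t unfolding \<Psi>_def by simp
  have 1: "(\<Prod>(j, k)\<in>upper_pairs half. two_cos (inv2 * a * ((int j)\<^sup>2 - (int k)\<^sup>2))) =
      (-1) ^ c * \<bar>\<Prod>(j, k)\<in>upper_pairs half. two_cos (inv2 * a * ((int j)\<^sup>2 - (int k)\<^sup>2))\<bar>"
    unfolding c_def power_sum abs_prod prod.distrib[symmetric]
    by (intro prod.cong refl) (use CPsi in auto)
  have pC: "two_cos x = two_cos y" if "[x = y] (mod int p)" for x y by (rule periodicD[OF periodic_two_cos that])
  have caa: "chi a * chi a = 1" using chi_cases[of a] chi_eq_0_iff[of a] a by auto
  have c2i: "chi 2 * chi inv2 = 1"
  proof -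
    have "chi (2 * inv2) = chi 1" unfolding inv2 by (rule chi_cong) (simp add: cong_iff_dvd_diff)
    thus ?thesis by (simp add: chi_mult)
  qed
  have ni: "\<not> int p dvd inv2" using c2i chi_eq_0_iff[of inv2] by auto
  hence nia: "\<not> int p dvd inv2 * a" using a prime_int_p prime_dvd_mult_iff by blast
  \<comment> \<open>The weight of d rewritten in t = inv2 a d: then 2 a t = a^2 d modulo p, so chi d
    = chi (2 a t).\<close>
  define g where "g t = real (\<Psi> t) * (real m - (1 + chi (2 * a * t)) / 2)" for t
  have pg: "periodic g" unfolding periodic_def
  proof (intro allI impI)
    fix x y assume xy: "[x = y] (mod int p)"
    have "chi (2 * a * x) = chi (2 * a * y)" by (rule chi_cong) (intro cong_mult cong_refl xy)
    thus "g x = g y" unfolding g_def \<Psi>_def using pC[OF xy] by simp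
  qed
  have "real c = (\<Sum>(j, k)\<in>upper_pairs half. real (\<Psi> (inv2 * a * ((int j)\<^sup>2 - (int k)\<^sup>2))))"
    unfolding c_def by (simp add: case_prod_unfold)
  also have "\<dots> = (\<Sum>d\<in>{0..<int p}. real (\<Psi> (inv2 * a * d)) * ((real p - 1) / 4 - (1 + chi d) / 2)) / 2"
  proof (rule sum_upper_pairs_squares)
    show "periodic (\<lambda>d. real (\<Psi> (inv2 * a * d)))" unfolding periodic_def
    proof (intro allI impI)
      fix x y assume xy: "[x = y] (mod int p)"
      have "two_cos (inv2 * a * x) = two_cos (inv2 * a * y)" by (rule pC) (intro cong_mult cong_refl xy)
      thus "real (\<Psi> (inv2 * a * x)) = real (\<Psi> (inv2 * a * y))" unfolding \<Psi>_def by simp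
    qed
  qed (auto simp: \<Psi>_def)
  also have "(\<Sum>d\<in>{0..<int p}. real (\<Psi> (inv2 * a * d)) * ((real p - 1) / 4 - (1 + chi d) / 2)) =
      (\<Sum>d\<in>{0..<int p}. g (inv2 * a * d))"
  proof (intro sum.cong refl)
    fix d
    have "chi (2 * a * (inv2 * a * d)) = (chi 2 * chi inv2) * (chi a * chi a) * chi d"
      by (simp add: chi_mult mult_ac)
    hence "chi (2 * a * (inv2 * a * d)) = chi d" unfolding c2i caa by simp
    thus "real (\<Psi> (inv2 * a * d)) * ((real p - 1) / 4 - (1 + chi d) / 2) = g (inv2 * a * d)"
      unfolding g_def rm by simp
  qed
  also have "\<dots> = (\<Sum>t\<in>{0..<int p}. g t)" by (rule sum_periodic_mult[OF pg nia])
  also have "\<dots> = g 0 + 2 * (\<Sum>t\<in>{1..half}. g (int t))"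
    by (rule sum_periodic_even[OF pg]) (auto simp: g_def \<Psi>_def)
  also have "g 0 = 0" unfolding g_def \<Psi>_def by simp
  also have "(\<Sum>t\<in>{1..half}. g (int t)) = (\<Sum>t\<in>{m + 1..half}. real m - (1 + chi (2 * a * int t)) / 2)"
  proof (rule sum.mono_neutral_cong_right)
    show "\<forall>t\<in>{1..half} - {m + 1..half}. g (int t) = 0"
      using two_cos_neg_iff unfolding g_def \<Psi>_def m_def by auto
    show "g (int t) = real m - (1 + chi (2 * a * int t)) / 2" if "t \<in> {m + 1..half}" for t
      using two_cos_neg_iff[of t] that unfolding g_def \<Psi>_def m_def by auto
  qed auto
  also have "\<dots> = (\<Sum>t\<in>{m + 1..half}. real m - 1 / 2 - chi (2 * a) / 2 * chi (int t))"
    by (intro sum.cong refl) (simp add: chi_mult field_simps)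
  also have "\<dots> = real m * (real m - 1 / 2) - chi (2 * a) / 2 * of_int (\<Sum>t\<in>{m + 1..half}. chi (int t))"
    by (simp add: sum_subtractf sum_distrib_left hm)
  also have "(\<Sum>t\<in>{m + 1..half}. chi (int t)) = 2 * int nonres - int m"
    using sum_chi_second_quarter unfolding m_def .
  finally have "2 * real c = 2 * (real m)\<^sup>2 - real m - chi (2 * a) * (2 * real nonres - real m)"
    by (simp add: power2_eq_square field_simps)
  hence "real_of_int (2 * int c) = of_int (2 * (int m)\<^sup>2 - int m - chi (2 * a) * (2 * int nonres - int m))"
    by simp
  hence 2: "2 * int c = 2 * (int m)\<^sup>2 - int m - chi (2 * a) * (2 * int nonres - int m)"
    by (simp only: of_int_eq_iff)
  show ?thesis using that[OF 1 2[unfolded m_def]] .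
qed

text \<open>With m = p div 4, c is m^2 - nonres if chi (2 a) = 1 and m^2 - m + nonres if chi (2 a) =
  -1. For even m both have the parity of nonres. For odd m, where chi (2 a) = - chi a, the first has
  the opposite parity, which produces the factor chi a.\<close>

lemma prod_ez_sum:
  assumes a: "\<not> int p dvd a"
  shows "(\<Prod>(j, k)\<in>upper_pairs half. ez (a * int j ^ 2) + ez (a * int k ^ 2)) =
    of_real ((if p mod 8 = 1 then 1 else chi a) * (-1) ^ nonres * exp (chi a * (1 - chi 2) / 4 * Lam))"
proof -
  obtain c where c: "(\<Prod>(j, k)\<in>upper_pairs half. two_cos (inv2 * a * ((int j)\<^sup>2 - (int k)\<^sup>2))) =
      (-1) ^ c * \<bar>\<Prod>(j, k)\<in>upper_pairs half. two_cos (inv2 * a * ((int j)\<^sup>2 - (int k)\<^sup>2))\<bar>"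
    "2 * int c = 2 * (int (p div 4))\<^sup>2 - int (p div 4) - chi (2 * a) * (2 * int nonres - int (p div 4))"
    using sign_prod_two_cos[OF a] .
  define m where "m = p div 4"
  have ca: "chi a = 1 \<or> chi a = -1" using chi_cases[of a] chi_eq_0_iff[of a] a by auto
  have c1: "int c = int m * int m - int nonres" if "chi (2 * a) = 1"
    using c(2) that unfolding m_def by (simp add: power2_eq_square)
  have c2: "int c = int m * int m - int m + int nonres" if "chi (2 * a) = -1"
    using c(2) that unfolding m_def by (simp add: power2_eq_square)
  have sign: "(-1 :: real) ^ c = (if p mod 8 = 1 then 1 else chi a) * (-1) ^ nonres"
  proof (cases "p mod 8 = 1")
    case True
    hence ev: "even m" unfolding m_def by presburger
    hence "chi 2 = 1" using chi_two unfolding m_def by simp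
    hence "chi (2 * a) = 1 \<or> chi (2 * a) = -1" using ca by (simp add: chi_mult)
    hence "even (int c) = even (int nonres)"
    proof
      assume "chi (2 * a) = 1"
      thus ?thesis using ev by (simp only: c1) simp
    next
      assume "chi (2 * a) = -1"
      thus ?thesis using ev by (simp only: c2) simp
    qed
    thus ?thesis using True by (simp add: uminus_power_if)
  next
    case False
    hence od: "odd m" unfolding m_def using p_mod_4 by presburger
    hence "chi 2 = -1" using chi_two unfolding m_def by simp
    from ca show ?thesis
    proof
      assume "chi a = 1"
      hence "int c = int m * int m - int m + int nonres" using c2 \<open>chi 2 = -1\<close> by (simp add: chi_mult)
      hence "even (int c) = even (int m * int m - int m + int nonres)" by (simp only:)
      hence "even (int c) = even (int nonres)" using od by simp
      thus ?thesis using False \<open>chi a = 1\<close> by (simp add: uminus_power_if)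
    next
      assume "chi a = -1"
      hence "int c = int m * int m - int nonres" using c1 \<open>chi 2 = -1\<close> by (simp add: chi_mult)
      hence "even (int c) = even (int m * int m - int nonres)" by (simp only:)
      hence "even (int c) = odd (int nonres)" using od by simp
      thus ?thesis using False \<open>chi a = -1\<close> by (simp add: uminus_power_if)
    qed
  qed
  show ?thesis
    by (subst prod_ez_sum_eq_prod_two_cos, subst c(1)) (simp only: abs_prod_two_cos[OF a] sign)
qed

section \<open>Class number formula and Gauss sum combined; the theorem\<close>

lemma Lam_eq:
  assumes "p mod 8 = 5" shows "Lam = - 2 * real (class_number p) * ln (fundamental_unit p)"
proof -
  have "L1 * Re tau = - Lam" unfolding Lam_def by (rule L1_formula)
  moreover have "Re tau = rt" unfolding tau_eq[OF assms] rt_def by simp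
  moreover have "L1 = class_number p * (2 * ln (fundamental_unit p) / rt)"
    using class_number_formula unfolding class_density_def eps_def by simp
  ultimately show ?thesis using rt_pos by simp
qed

end

theorem theorem1p1:
  fixes p :: nat and a :: int and \<zeta> :: complex and N :: nat
  assumes "prime p" and "[p = 1] (mod 4)"
    and "\<zeta> = exp (2 * complex_of_real pi * \<i> / of_nat p)"
    and "\<not> int p dvd a"
    and "N = card {k::int. 1 \<le> k \<and> real_of_int k < real p / 4 \<and> Legendre k (int p) = -1}"
  shows "([p = 1] (mod 8) \<longrightarrow>
            (\<Prod>(j, k) \<in> {(j::nat, k::nat). 1 \<le> j \<and> j < k \<and> k \<le> (p - 1) div 2}.
               \<zeta> powi (a * int j ^ 2) + \<zeta> powi (a * int k ^ 2)) = (-1) ^ N)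
       \<and> ([p = 5] (mod 8) \<longrightarrow>
            (-1) ^ N *
            (\<Prod>(j, k) \<in> {(j::nat, k::nat). 1 \<le> j \<and> j < k \<and> k \<le> (p - 1) div 2}.
               \<zeta> powi (a * int j ^ 2) + \<zeta> powi (a * int k ^ 2))
            = of_int (Legendre a (int p)) *
              complex_of_real (fundamental_unit p powi
                (- Legendre a (int p) * int (class_number p))))"
proof -
  interpret prime_one_mod_four p
    using assms(1,2) by unfold_locales (auto simp: icong_def)
  have "\<zeta> = ez 1" unfolding assms(3) ez_def cis_conv_exp by (simp add: field_simps)
  moreover have "inverse (ez 1) = ez (- 1)"
    using ez_add[of 1 "-1"] by (intro inverse_unique) simp
  ultimately have zeta: "\<zeta> powi k = ez k" for k
    unfolding power_int_def by (simp add: ez_power)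
  have N: "N = nonres"
  proof -
    have "{k::int. 1 \<le> k \<and> real_of_int k < real p / 4 \<and> Legendre k (int p) = -1} =
        int ` {k \<in> {1..p div 4}. chi (int k) = -1}"
    proof (intro equalityI subsetI)
      fix k assume "k \<in> {k::int. 1 \<le> k \<and> real_of_int k < real p / 4 \<and> Legendre k (int p) = -1}"
      hence k: "1 \<le> k" "real_of_int k < real p / 4" "chi k = -1" unfolding chi_def by auto
      have "real_of_int (4 * k) < real_of_int (int p)" using k(2) by simp
      hence "4 * k < int p" by (simp only: of_int_less_iff)
      hence "nat k \<in> {1..p div 4}" using k(1) by auto
      thus "k \<in> int ` {k \<in> {1..p div 4}. chi (int k) = -1}" using k by (intro image_eqI[of _ _ "nat k"]) auto
    next
      fix k assume "k \<in> int ` {k \<in> {1..p div 4}. chi (int k) = -1}"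
      then obtain l where l: "k = int l" "1 \<le> l" "l \<le> p div 4" "chi (int l) = -1" by auto
      have "4 * l < p" using l p_eq by linarith
      thus "k \<in> {k::int. 1 \<le> k \<and> real_of_int k < real p / 4 \<and> Legendre k (int p) = -1}"
        using l unfolding chi_def by auto
    qed
    thus ?thesis unfolding assms(5) nonres_def by (simp add: card_image)
  qed
  have "{(j::nat, k::nat). 1 \<le> j \<and> j < k \<and> k \<le> (p - 1) div 2} = upper_pairs half"
    unfolding upper_pairs_def half_def ..
  hence prod: "(\<Prod>(j, k) \<in> {(j::nat, k::nat). 1 \<le> j \<and> j < k \<and> k \<le> (p - 1) div 2}.
      \<zeta> powi (a * int j ^ 2) + \<zeta> powi (a * int k ^ 2)) =
    of_real ((if p mod 8 = 1 then 1 else chi a) * (-1) ^ nonres * exp (chi a * (1 - chi 2) / 4 * Lam))"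
    unfolding zeta using prod_ez_sum[OF assms(4)] by simp
  show ?thesis
  proof (intro conjI impI)
    assume "[p = 1] (mod 8)"
    hence p8: "p mod 8 = 1" by (simp add: icong_def)
    hence "even (p div 4)" by presburger
    hence "chi 2 = 1" using chi_two by simp
    thus "(\<Prod>(j, k) \<in> {(j::nat, k::nat). 1 \<le> j \<and> j < k \<and> k \<le> (p - 1) div 2}.
        \<zeta> powi (a * int j ^ 2) + \<zeta> powi (a * int k ^ 2)) = (-1) ^ N"
      unfolding prod N using p8 by simp
  next
    assume "[p = 5] (mod 8)"
    hence p8: "p mod 8 = 5" by (simp add: icong_def)
    hence "odd (p div 4)" by presburger
    hence c2: "chi 2 = -1" using chi_two by simp
    define e where "e = fundamental_unit p"
    have e1: "e > 1" unfolding e_def by (rule fundamental_unit(2))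
    have "exp (chi a * (1 - chi 2) / 4 * Lam) = exp (of_int (- chi a * int (class_number p)) * ln e)"
      unfolding c2 Lam_eq[OF p8] e_def by simp
    also have "\<dots> = e powr of_int (- chi a * int (class_number p))" using e1 unfolding powr_def by simp
    also have "\<dots> = e powi (- chi a * int (class_number p))" using e1 by (intro powr_real_of_int') auto
    finally have E: "exp (chi a * (1 - chi 2) / 4 * Lam) = e powi (- chi a * int (class_number p))" .
    have "(-1) ^ N * (\<Prod>(j, k) \<in> {(j::nat, k::nat). 1 \<le> j \<and> j < k \<and> k \<le> (p - 1) div 2}.
        \<zeta> powi (a * int j ^ 2) + \<zeta> powi (a * int k ^ 2)) =
      (-1) ^ nonres * of_real (chi a * (-1) ^ nonres * e powi (- chi a * int (class_number p)))"
      unfolding prod E N using p8 by simp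
    also have "\<dots> = ((-1) ^ nonres * (-1) ^ nonres) * (of_int (chi a) * of_real (e powi (- chi a * int (class_number p))))"
      by (simp add: mult_ac del: of_real_power_int)
    also have "(-1 :: complex) ^ nonres * (-1) ^ nonres = 1" by (simp flip: power_add mult_2)
    finally show "(-1) ^ N * (\<Prod>(j, k) \<in> {(j::nat, k::nat). 1 \<le> j \<and> j < k \<and> k \<le> (p - 1) div 2}.
        \<zeta> powi (a * int j ^ 2) + \<zeta> powi (a * int k ^ 2)) =
      of_int (Legendre a (int p)) * complex_of_real (fundamental_unit p powi
        (- Legendre a (int p) * int (class_number p)))"
      unfolding chi_def e_def by simp
  qed
qed

end
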